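(* Let $q\in\mathbb{C}$ be non-zero and not a root of unity, let $A=\mathcal{O}_q(\mathrm{SL}_2(\mathbb{C}))$ be viewed as a right comodule algebra over $H=\mathcal{O}(U(1))=\mathbb{C}[t,t^{-1}]$, with the differential calculi $\Omega^\bullet(A)=A\oplus\Omega^1(A)\oplus\Omega^2(A)\oplus\Omega^3(A)$ and $\Omega^\bullet(H)=H\oplus\Omega^1(H)$ described in the context. Then $\Omega^\bullet(A)$ is complete. Moreover, with $B=A^{\mathrm{co}H}$ (the Podleś sphere): (i) the base forms $\Omega^\bullet(B)\subseteq\Omega^\bullet(A)$ are the pullback differential calculus generated by $B$; (ii) $\mathrm{ver}^\bullet=A\otimes(\mathbb{C}\oplus\Lambda^1)$ with $\Lambda^1=\mathrm{span}_{\mathbb{C}}\{t^{-1}\mathrm{d}t\}$, and $\mathrm{hor}^\bullet=A\,\Omega^\bullet(B)A$; (iii) the linear map $\Lambda^1\to\Omega^1(A)$, $t^{-1}\mathrm{d}t\mapsto e^0$, is a connection $1$-form on $\Omega^1(A)$.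
   Context: Algebras: $A$ is generated by $\alpha,\beta,\gamma,\delta$ with relations $\beta\alpha=q\alpha\beta$, $\gamma\alpha=q\alpha\gamma$, $\delta\beta=q\beta\delta$, $\delta\gamma=q\gamma\delta$, $\delta\alpha-\alpha\delta=(q-q^{-1})\beta\gamma$, $\gamma\beta=\beta\gamma$, $\alpha\delta-q^{-1}\beta\gamma=1$. $H=\mathbb{C}[t,t^{-1}]$ with $\Delta(t)=t\otimes t$, $\varepsilon(t)=1$, $S(t)=t^{-1}$. The coaction $\Delta_A\colon A\to A\otimes H$ is the algebra map with $\alpha\mapsto\alpha\otimes t$, $\gamma\mapsto\gamma\otimes t$, $\beta\mapsto\beta\otimes t^{-1}$, $\delta\mapsto\delta\otimes t^{-1}$. For $f\in\{\alpha,\beta,\gamma,\delta\}$ let $\Delta_A(f)=f\otimes t^{|f|}$, so $|\alpha|=|\gamma|=1$, $|\beta|=|\delta|=-1$. Calculi: a differential calculus (DC) on an algebra is a differential graded algebra (DGA) $(\Omega^\bullet,\wedge,\mathrm{d})$ whose degree-$0$ part is the algebra and whose degree-$k$ part is spanned by elements $a^0\mathrm{d}a^1\wedge\ldots\wedge\mathrm{d}a^k$. On $H$: $\Omega^1(H)$ is the free left $H$-module on $\mathrm{d}t$ with $\mathrm{d}t\,t=q^{2}t\,\mathrm{d}t$, and $\Omega^k(H)=0$ for $k\ge2$. On $A$: $\Omega^1(A)$ is the free left $A$-module with basis $e^+=q^{-1}\alpha\,\mathrm{d}\gamma-q^{-2}\gamma\,\mathrm{d}\alpha$, $e^-=\delta\,\mathrm{d}\beta-q\beta\,\mathrm{d}\delta$,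 $e^0=\delta\,\mathrm{d}\alpha-q\beta\,\mathrm{d}\gamma$ and right action determined by $e^\pm f=q^{|f|}fe^\pm$, $e^0f=q^{2|f|}fe^0$ for generators $f$; explicitly $\mathrm{d}\alpha=\alpha e^0+q\beta e^+$, $\mathrm{d}\gamma=\gamma e^0+q\delta e^+$, $\mathrm{d}\beta=\alpha e^--q^{-2}\beta e^0$, $\mathrm{d}\delta=\gamma e^--q^{-2}\delta e^0$. $\Omega^2(A)$ is the free left $A$-module with basis $e^+\wedge e^0$, $e^-\wedge e^0$, $e^+\wedge e^-$ and relations $e^+\wedge e^-=-q^{-2}e^-\wedge e^+$, $e^\pm\wedge e^0=-q^{\mp4}e^0\wedge e^\pm$, $e^\pm\wedge e^\pm=e^0\wedge e^0=0$, $\mathrm{d}e^0=q^3e^+\wedge e^-$, $\mathrm{d}e^\pm=\mp q^{\pm2}(1+q^{-2})e^\pm\wedge e^0$. $\Omega^3(A)$ is the free left $A$-module on $e^+\wedge e^-\wedge e^0$ (with the products induced by the relations $e^\pm f=q^{|f|}fe^\pm$, $e^0f=q^{2|f|}fe^0$ for generators $f$, $e^+\wedge e^-=-q^{-2}e^-\wedge e^+$, $e^\pm\wedge e^0=-q^{\mp4}e^0\wedge e^\pm$ and $e^\pm\wedge e^\pm=e^0\wedge e^0=0$) and $\Omega^k(A)=0$ for $k>3$. Complete: $\Delta_A$ extends to a morphism of DGAs $\Delta_A^\bullet\colon\Omega^\bullet(A)\to\Omega^\bullet(A)\otimes\Omega^\bullet(H)$, where the tensor product DGA has product $(\omega\otimes\omega')\wedge(\eta\otimes\eta')=(-1)^{|\omega'||\eta|}\omega\wedge\eta\otimes\omega'\wedge\eta'$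 and differential $\mathrm{d}_\otimes(\omega\otimes\omega')=\mathrm{d}\omega\otimes\omega'+(-1)^{|\omega|}\omega\otimes\mathrm{d}\omega'$ (here $|\cdot|$ is the form degree). Base forms: $\Omega^\bullet(B)=\{\omega\in\Omega^\bullet(A):\Delta_A^\bullet(\omega)=\omega\otimes1\}$. Horizontal forms: $\mathrm{hor}^\bullet=(\Delta_A^\bullet)^{-1}(\Omega^\bullet(A)\otimes H)$. Vertical forms: $\mathrm{ver}^\bullet=A\otimes\Lambda^\bullet$, where $\Lambda^\bullet$ is the space of left $H$-coinvariant forms in $\Omega^\bullet(H)$ (left coaction $h\,\mathrm{d}g\mapsto h_1g_1\otimes h_2\mathrm{d}g_2$). The pullback calculus on $B$ is the differential graded subalgebra of $\Omega^\bullet(A)$ spanned by $b^0\mathrm{d}b^1\wedge\ldots\wedge\mathrm{d}b^k$, $b^i\in B$. Connection $1$-form: a right $H$-colinear map $s\colon\Lambda^1\to\Omega^1(A)$ with $\pi_v(s(\vartheta))=1\otimes\vartheta$ for all $\vartheta\in\Lambda^1$, where $\Lambda^1$ carries the adjoint coaction $S(h_1)\mathrm{d}h_2\mapsto S(h_2)\mathrm{d}h_3\otimes S(h_1)h_4$, $\Omega^1(A)$ carries $a\,\mathrm{d}a'\mapsto a_0\mathrm{d}a'_0\otimes a_1a'_1$, and $\pi_v\colon\Omega^1(A)\to A\otimes\Lambda^1$, $\pi_v(a\,\mathrm{d}a')=aa'_0\otimes S(a'_1)\mathrm{d}a'_2$. *)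

theory Defs
  imports Complex_Main "HOL-Library.Poly_Mapping"
begin

section \<open>Complex vector spaces and complex algebras\<close>

class complex_vector = ab_group_add +
  fixes scaleC :: "complex \<Rightarrow> 'a \<Rightarrow> 'a"  (infixr "*\<^sub>C" 75)
  assumes scaleC_add_right: "c *\<^sub>C (x + y) = c *\<^sub>C x + c *\<^sub>C y"
    and scaleC_add_left: "(c + c') *\<^sub>C x = c *\<^sub>C x + c' *\<^sub>C x"
    and scaleC_scaleC: "c *\<^sub>C c' *\<^sub>C x = (c * c') *\<^sub>C x"
    and scaleC_one: "1 *\<^sub>C x = x"

class complex_algebra_1 = complex_vector + ring_1 +
  assumes mult_scaleC_left: "(c *\<^sub>C x) * y = c *\<^sub>C (x * y)"
    and mult_scaleC_right: "x * (c *\<^sub>C y) = c *\<^sub>C (x * y)"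

global_interpretation complex_vector: vector_space "scaleC :: complex \<Rightarrow> 'a \<Rightarrow> 'a::complex_vector"
  by unfold_locales (simp_all add: scaleC_add_right scaleC_add_left scaleC_scaleC scaleC_one)

abbreviation cspan :: "'a::complex_vector set \<Rightarrow> 'a set"
  where "cspan \<equiv> module.span scaleC"

abbreviation csubspace :: "'a::complex_vector set \<Rightarrow> bool"
  where "csubspace \<equiv> module.subspace scaleC"

abbreviation clinear :: "('a::complex_vector \<Rightarrow> 'b::complex_vector) \<Rightarrow> bool"
  where "clinear \<equiv> Vector_Spaces.linear scaleC scaleC"

definition cbilinear :: "('a::complex_vector \<Rightarrow> 'b::complex_vector \<Rightarrow> 'c::complex_vector) \<Rightarrow> bool"
  where "cbilinear F \<longleftrightarrow> (\<forall>x. clinear (F x)) \<and> (\<forall>y. clinear (\<lambda>x. F x y))"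

lemma clinearI:
  assumes "\<And>x y. f (x + y) = f x + f y" "\<And>c x. f (c *\<^sub>C x) = c *\<^sub>C f x"
  shows "clinear f"
  using assms by unfold_locales auto

lemma clinear_add: "clinear f \<Longrightarrow> f (x + y) = f x + f y"
  by (simp add: Vector_Spaces.linear_iff)

lemma clinear_scaleC: "clinear f \<Longrightarrow> f (c *\<^sub>C x) = c *\<^sub>C f x"
  by (simp add: Vector_Spaces.linear_iff)

lemma clinear_0: "clinear f \<Longrightarrow> f 0 = 0"
  using clinear_scaleC[of f 0 0] by simp

lemma clinear_uminus: "clinear f \<Longrightarrow> f (- x) = - f x"
  using clinear_scaleC[of f "-1" x] by (simp add: complex_vector.scale_minus_left scaleC_one)

lemma clinear_diff: "clinear f \<Longrightarrow> f (x - y) = f x - f y"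
  using clinear_add[of f x "- y"] clinear_uminus[of f y] by simp

lemma clinear_sum: "clinear f \<Longrightarrow> f (sum g S) = (\<Sum>i\<in>S. f (g i))"
  by (induction S rule: infinite_finite_induct) (auto simp: clinear_0 clinear_add)

lemma clinear_zero_fun: "clinear (\<lambda>x. 0)"
  by (rule clinearI) auto

lemma clinear_add_fun: "clinear f \<Longrightarrow> clinear g \<Longrightarrow> clinear (\<lambda>x. f x + g x)"
  by (rule clinearI) (auto simp: clinear_add clinear_scaleC scaleC_add_right)

lemma clinear_sum_fun: "(\<And>i. clinear (f i)) \<Longrightarrow> clinear (\<lambda>x. \<Sum>i\<in>S. f i x)"
  by (induction S rule: infinite_finite_induct) (auto intro: clinear_zero_fun clinear_add_fun)

lemma clinear_scaleC_fun: "clinear f \<Longrightarrow> clinear (\<lambda>x. c *\<^sub>C f x)"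
  by (rule clinearI) (auto simp: clinear_add clinear_scaleC scaleC_add_right mult.commute)

lemma clinear_comp: "clinear f \<Longrightarrow> clinear g \<Longrightarrow> clinear (\<lambda>x. g (f x))"
  by (rule clinearI) (auto simp: clinear_add clinear_scaleC)

lemma clinear_mult_left: "clinear (\<lambda>x. y * x :: 'a::complex_algebra_1)"
  by (rule clinearI) (auto simp: distrib_left mult_scaleC_right)

lemma clinear_mult_right: "clinear (\<lambda>x. x * y :: 'a::complex_algebra_1)"
  by (rule clinearI) (auto simp: distrib_right mult_scaleC_left)

lemmas clinear_intros = clinear_zero_fun clinear_add_fun clinear_sum_fun clinear_scaleC_fun
  clinear_mult_left clinear_mult_right

instantiation complex :: complex_algebra_1
begin

definition scaleC_complex :: "complex \<Rightarrow> complex \<Rightarrow> complex"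
  where "scaleC_complex c z = c * z"

instance
  by intro_classes (simp_all add: scaleC_complex_def algebra_simps)

end

definition alg_hom :: "('a::complex_algebra_1 \<Rightarrow> 'b::complex_algebra_1) \<Rightarrow> bool"
  where "alg_hom f \<longleftrightarrow> clinear f \<and> f 1 = 1 \<and> (\<forall>x y. f (x * y) = f x * f y)"


section \<open>Monoid algebras, free algebras and presentations\<close>

text \<open>
  \<open>'k \<Rightarrow>\<^sub>0 complex\<close> is the complex vector space with basis \<open>'k\<close>, and for a monoid \<open>'k\<close> the
  library product makes it the monoid algebra.
\<close>

instantiation poly_mapping :: (type, complex_vector) complex_vector
begin

definition scaleC_poly_mapping :: "complex \<Rightarrow> ('a \<Rightarrow>\<^sub>0 'b) \<Rightarrow> ('a \<Rightarrow>\<^sub>0 'b)"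
  where "scaleC_poly_mapping c p = Poly_Mapping.map (scaleC c) p"

instance
proof
  fix c c' :: complex and p r :: "'a \<Rightarrow>\<^sub>0 'b"
  have *: "Poly_Mapping.lookup (c *\<^sub>C p) k = c *\<^sub>C Poly_Mapping.lookup p k" for c and p :: "'a \<Rightarrow>\<^sub>0 'b" and k
    by (simp add: scaleC_poly_mapping_def Poly_Mapping.map.rep_eq when_def)
  show "c *\<^sub>C (p + r) = c *\<^sub>C p + c *\<^sub>C r"
    by (rule poly_mapping_eqI) (simp only: * lookup_add scaleC_add_right)
  show "(c + c') *\<^sub>C p = c *\<^sub>C p + c' *\<^sub>C p"
    by (rule poly_mapping_eqI) (simp only: * lookup_add scaleC_add_left)
  show "c *\<^sub>C c' *\<^sub>C p = (c * c') *\<^sub>C p"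
    by (rule poly_mapping_eqI) (simp only: * scaleC_scaleC)
  show "1 *\<^sub>C p = p"
    by (rule poly_mapping_eqI) (simp only: * scaleC_one)
qed

end

lemma lookup_scaleC: "Poly_Mapping.lookup (c *\<^sub>C p) k = c *\<^sub>C Poly_Mapping.lookup p k"
  by (simp add: scaleC_poly_mapping_def Poly_Mapping.map.rep_eq when_def)

lemma scaleC_single: "c *\<^sub>C Poly_Mapping.single k b = Poly_Mapping.single k (c *\<^sub>C b)"
  by (rule poly_mapping_eqI) (simp add: lookup_scaleC lookup_single when_def)

lemma poly_mapping_add_induct [case_names zero single add]:
  assumes "P 0" "\<And>k c. P (Poly_Mapping.single k c)" "\<And>p r. P p \<Longrightarrow> P r \<Longrightarrow> P (p + r)"
  shows "P (p :: 'k \<Rightarrow>\<^sub>0 'b::monoid_add)"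
proof (induction p rule: update_induct)
  case const
  then show ?case by (rule assms(1))
next
  case (update f a b)
  have "Poly_Mapping.update a b f = f + Poly_Mapping.single a b"
    using update(1)
    by (intro poly_mapping_eqI) (auto simp: lookup_update lookup_add lookup_single in_keys_iff when_def)
  then show ?case using assms(2,3) update(3) by simp
qed

instance poly_mapping :: (monoid_add, complex_algebra_1) complex_algebra_1
proof
  fix c :: complex and p r :: "'a \<Rightarrow>\<^sub>0 'b"
  have 1: "(c *\<^sub>C p) * Poly_Mapping.single k b = c *\<^sub>C (p * Poly_Mapping.single k b)
      \<and> p * (c *\<^sub>C Poly_Mapping.single k b) = c *\<^sub>C (p * Poly_Mapping.single k b)" for k b
    by (induction p rule: poly_mapping_add_induct)
      (simp_all add: scaleC_single mult_single mult_scaleC_left mult_scaleC_right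
        scaleC_add_right distrib_right)
  have 2: "(c *\<^sub>C p) * r = c *\<^sub>C (p * r) \<and> p * (c *\<^sub>C r) = c *\<^sub>C (p * r)"
    by (induction r rule: poly_mapping_add_induct)
      (simp_all add: 1 scaleC_add_right distrib_left)
  show "(c *\<^sub>C p) * r = c *\<^sub>C (p * r)" "p * (c *\<^sub>C r) = c *\<^sub>C (p * r)"
    using 2 by simp_all
qed

definition lin_ext :: "('k \<Rightarrow> 'a::complex_vector) \<Rightarrow> ('k \<Rightarrow>\<^sub>0 complex) \<Rightarrow> 'a"
  where "lin_ext f p = (\<Sum>k\<in>Poly_Mapping.keys p. Poly_Mapping.lookup p k *\<^sub>C f k)"

lemma lin_ext_superset:
  assumes "finite S" "Poly_Mapping.keys p \<subseteq> S"
  shows "lin_ext f p = (\<Sum>k\<in>S. Poly_Mapping.lookup p k *\<^sub>C f k)"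
  unfolding lin_ext_def using assms
  by (intro sum.mono_neutral_left) (auto simp: in_keys_iff)

lemma clinear_lin_ext: "clinear (lin_ext f)"
proof (rule clinearI)
  fix p r :: "'a \<Rightarrow>\<^sub>0 complex" and c :: complex
  let ?S = "Poly_Mapping.keys p \<union> Poly_Mapping.keys r"
  have "Poly_Mapping.keys (p + r) \<subseteq> ?S"
    by (rule Poly_Mapping.keys_add)
  then show "lin_ext f (p + r) = lin_ext f p + lin_ext f r"
    by (simp add: lin_ext_superset[of ?S] lookup_add scaleC_add_left sum.distrib)
  have "Poly_Mapping.keys (c *\<^sub>C p) \<subseteq> Poly_Mapping.keys p"
    by (auto simp: in_keys_iff lookup_scaleC)
  then show "lin_ext f (c *\<^sub>C p) = c *\<^sub>C lin_ext f p"
    by (simp add: lin_ext_superset[of "Poly_Mapping.keys p"] lookup_scaleC scaleC_complex_def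
        complex_vector.scale_sum_right)
qed

lemma lin_ext_single [simp]: "lin_ext f (Poly_Mapping.single k c) = c *\<^sub>C f k"
  by (subst lin_ext_superset[of "{k}"]) (auto simp: lookup_single)

datatype 'g word = Word (letters: "'g list")

instantiation word :: (type) monoid_add
begin

definition "0 = Word []"

definition "v + w = Word (letters v @ letters w)"

instance
  by intro_classes (auto simp: zero_word_def plus_word_def)

end

type_synonym 'g free_algebra = "'g word \<Rightarrow>\<^sub>0 complex"

definition free_gen :: "'g \<Rightarrow> 'g free_algebra"
  where "free_gen g = Poly_Mapping.single (Word [g]) 1"

definition free_eval :: "('g \<Rightarrow> 'a::complex_algebra_1) \<Rightarrow> 'g free_algebra \<Rightarrow> 'a"
  where "free_eval x = lin_ext (\<lambda>w. prod_list (map x (letters w)))"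

definition two_sided_ideal :: "'a::complex_algebra_1 set \<Rightarrow> 'a set"
  where "two_sided_ideal R = cspan {a * r * b |a r b. r \<in> R}"

text \<open>The algebra \<open>'a\<close> is generated by the \<open>x g\<close> subject exactly to the relations \<open>r = 0\<close>, \<open>r \<in> R\<close>.\<close>

definition presented_by :: "('g \<Rightarrow> 'a::complex_algebra_1) \<Rightarrow> 'g free_algebra set \<Rightarrow> bool"
  where "presented_by x R \<longleftrightarrow>
    surj (free_eval x) \<and> {p. free_eval x p = 0} = two_sided_ideal R"


section \<open>Tensor products of complex vector spaces\<close>

definition tensor_relators ::
    "(('a::complex_vector \<times> 'b::complex_vector) \<Rightarrow>\<^sub>0 complex) set"
  where "tensor_relators =
    {Poly_Mapping.single (x + x', y) 1 - Poly_Mapping.single (x, y) 1 - Poly_Mapping.single (x', y) 1 |x x' y. True} \<union>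
    {Poly_Mapping.single (x, y + y') 1 - Poly_Mapping.single (x, y) 1 - Poly_Mapping.single (x, y') 1 |x y y'. True} \<union>
    {Poly_Mapping.single (c *\<^sub>C x, y) 1 - c *\<^sub>C Poly_Mapping.single (x, y) 1 |c x y. True} \<union>
    {Poly_Mapping.single (x, c *\<^sub>C y) 1 - c *\<^sub>C Poly_Mapping.single (x, y) 1 |c x y. True}"

definition tensor_rel ::
    "(('a::complex_vector \<times> 'b::complex_vector) \<Rightarrow>\<^sub>0 complex) \<Rightarrow> (('a \<times> 'b) \<Rightarrow>\<^sub>0 complex) \<Rightarrow> bool"
  where "tensor_rel p r \<longleftrightarrow> p - r \<in> cspan tensor_relators"

lemma tensor_rel_refl: "tensor_rel p p"
  by (simp add: tensor_rel_def complex_vector.span_zero)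

lemma tensor_rel_sym: "tensor_rel p r \<Longrightarrow> tensor_rel r p"
  unfolding tensor_rel_def using complex_vector.span_neg[of "p - r"] by simp

lemma tensor_rel_trans: "tensor_rel p r \<Longrightarrow> tensor_rel r s \<Longrightarrow> tensor_rel p s"
  unfolding tensor_rel_def using complex_vector.span_add[of "p - r" _ "r - s"] by simp

quotient_type (overloaded) ('a, 'b) tensor =
    "('a::complex_vector \<times> 'b::complex_vector) \<Rightarrow>\<^sub>0 complex" / tensor_rel
  by (rule equivpI; (rule reflpI sympI transpI)?)
    (auto intro: tensor_rel_refl tensor_rel_sym tensor_rel_trans)

instantiation tensor :: (complex_vector, complex_vector) complex_vector
begin

lift_definition zero_tensor :: "('a, 'b) tensor" is 0 .

lift_definition plus_tensor :: "('a, 'b) tensor \<Rightarrow> ('a, 'b) tensor \<Rightarrow> ('a, 'b) tensor" is "(+)"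
  unfolding tensor_rel_def by (simp add: add_diff_add complex_vector.span_add)

lift_definition uminus_tensor :: "('a, 'b) tensor \<Rightarrow> ('a, 'b) tensor" is uminus
proof -
  fix p r :: "('a \<times> 'b) \<Rightarrow>\<^sub>0 complex"
  assume "tensor_rel p r"
  then have "- (p - r) \<in> cspan tensor_relators"
    unfolding tensor_rel_def by (rule complex_vector.span_neg)
  then show "tensor_rel (- p) (- r)"
    unfolding tensor_rel_def by (simp add: algebra_simps)
qed

lift_definition minus_tensor :: "('a, 'b) tensor \<Rightarrow> ('a, 'b) tensor \<Rightarrow> ('a, 'b) tensor" is "(-)"
proof -
  fix p p' r r' :: "('a \<times> 'b) \<Rightarrow>\<^sub>0 complex"
  assume "tensor_rel p p'" "tensor_rel r r'"
  then have "(p - p') - (r - r') \<in> cspan tensor_relators"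
    unfolding tensor_rel_def by (rule complex_vector.span_diff)
  then show "tensor_rel (p - r) (p' - r')"
    unfolding tensor_rel_def by (simp add: algebra_simps)
qed

lift_definition scaleC_tensor :: "complex \<Rightarrow> ('a, 'b) tensor \<Rightarrow> ('a, 'b) tensor" is scaleC
proof -
  fix c and p r :: "('a \<times> 'b) \<Rightarrow>\<^sub>0 complex"
  assume "tensor_rel p r"
  then have "c *\<^sub>C (p - r) \<in> cspan tensor_relators"
    unfolding tensor_rel_def by (rule complex_vector.span_scale)
  then show "tensor_rel (c *\<^sub>C p) (c *\<^sub>C r)"
    unfolding tensor_rel_def by (simp add: complex_vector.scale_right_diff_distrib)
qed

instance
proof
  fix a b c :: "('a, 'b) tensor" and x y :: complex
  show "a + b + c = a + (b + c)"
    by transfer (simp add: tensor_rel_refl add.assoc)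
  show "a + b = b + a"
    by transfer (simp add: tensor_rel_refl add.commute)
  show "0 + a = a"
    by transfer (simp add: tensor_rel_refl)
  show "- a + a = 0"
    by transfer (simp add: tensor_rel_refl)
  show "a - b = a + - b"
    by transfer (simp add: tensor_rel_refl)
  show "x *\<^sub>C (a + b) = x *\<^sub>C a + x *\<^sub>C b"
    by transfer (simp add: tensor_rel_refl scaleC_add_right)
  show "(x + y) *\<^sub>C a = x *\<^sub>C a + y *\<^sub>C a"
    by transfer (simp add: tensor_rel_refl scaleC_add_left)
  show "x *\<^sub>C y *\<^sub>C a = (x * y) *\<^sub>C a"
    by transfer (simp add: tensor_rel_refl scaleC_scaleC)
  show "1 *\<^sub>C a = a"
    by transfer (simp add: tensor_rel_refl scaleC_one)
qed

end

lift_definition pure_tensor :: "'a::complex_vector \<Rightarrow> 'b::complex_vector \<Rightarrow> ('a, 'b) tensor"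
    (infix "\<otimes>" 68)
  is "\<lambda>x y. Poly_Mapping.single (x, y) 1" .

text \<open>
  The linear map \<open>x \<otimes> y \<mapsto> F x y\<close>, meaningful for bilinear \<open>F\<close>. It also renders Sweedler notation:
  for a coproduct \<open>\<Delta> h = h\<^sub>1 \<otimes> h\<^sub>2\<close> the expression \<open>tensor_lift F (\<Delta> h)\<close> is \<open>F h\<^sub>1 h\<^sub>2\<close>.
\<close>

definition tensor_lift ::
    "('a::complex_vector \<Rightarrow> 'b::complex_vector \<Rightarrow> 'c::complex_vector) \<Rightarrow> ('a, 'b) tensor \<Rightarrow> 'c"
  where "tensor_lift F T = lin_ext (\<lambda>(x, y). F x y) (rep_tensor T)"

definition tensor_map ::
    "('a::complex_vector \<Rightarrow> 'c::complex_vector) \<Rightarrow> ('b::complex_vector \<Rightarrow> 'd::complex_vector) \<Rightarrow>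
      ('a, 'b) tensor \<Rightarrow> ('c, 'd) tensor"
  where "tensor_map f g = tensor_lift (\<lambda>x y. f x \<otimes> g y)"

definition tensor_sub ::
    "'a::complex_vector set \<Rightarrow> 'b::complex_vector set \<Rightarrow> ('a, 'b) tensor set"
  where "tensor_sub X Y = cspan {x \<otimes> y |x y. x \<in> X \<and> y \<in> Y}"

text \<open>The ungraded product on the tensor product of two algebras.\<close>

definition tensor_alg_mult ::
    "('a::complex_algebra_1, 'b::complex_algebra_1) tensor \<Rightarrow> ('a, 'b) tensor \<Rightarrow> ('a, 'b) tensor"
  where "tensor_alg_mult S T =
    tensor_lift (\<lambda>x y. tensor_lift (\<lambda>u v. x * u \<otimes> y * v) T) S"

lemma pure_tensor_add_left: "(x + x') \<otimes> y = x \<otimes> y + x' \<otimes> y"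
proof (transfer, unfold tensor_rel_def)
  fix x x' :: 'a and y :: 'b
  have "Poly_Mapping.single (x + x', y) 1 - Poly_Mapping.single (x, y) 1
      - Poly_Mapping.single (x', y) 1 \<in> cspan tensor_relators"
    by (rule complex_vector.span_base) (unfold tensor_relators_def, blast)
  then show "Poly_Mapping.single (x + x', y) 1 -
      (Poly_Mapping.single (x, y) 1 + Poly_Mapping.single (x', y) 1) \<in> cspan tensor_relators"
    by (simp add: diff_diff_eq)
qed

lemma pure_tensor_add_right: "x \<otimes> (y + y') = x \<otimes> y + x \<otimes> y'"
proof (transfer, unfold tensor_rel_def)
  fix x :: 'a and y y' :: 'b
  have "Poly_Mapping.single (x, y + y') 1 - Poly_Mapping.single (x, y) 1
      - Poly_Mapping.single (x, y') 1 \<in> cspan tensor_relators"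
    by (rule complex_vector.span_base) (unfold tensor_relators_def, blast)
  then show "Poly_Mapping.single (x, y + y') 1 -
      (Poly_Mapping.single (x, y) 1 + Poly_Mapping.single (x, y') 1) \<in> cspan tensor_relators"
    by (simp add: diff_diff_eq)
qed

lemma pure_tensor_scaleC_left: "(c *\<^sub>C x) \<otimes> y = c *\<^sub>C (x \<otimes> y)"
  by (transfer, unfold tensor_rel_def, rule complex_vector.span_base, unfold tensor_relators_def) blast

lemma pure_tensor_scaleC_right: "x \<otimes> (c *\<^sub>C y) = c *\<^sub>C (x \<otimes> y)"
  by (transfer, unfold tensor_rel_def, rule complex_vector.span_base, unfold tensor_relators_def) blast

lemmas pure_tensor_simps =
  pure_tensor_add_left pure_tensor_add_right pure_tensor_scaleC_left pure_tensor_scaleC_right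

lemma cbilinear_pure_tensor: "cbilinear (\<otimes>)"
  unfolding cbilinear_def by (auto intro!: clinearI simp: pure_tensor_simps)

lemma clinear_pure_left: "clinear f \<Longrightarrow> clinear (\<lambda>x. f x \<otimes> y)"
  by (rule clinearI) (auto simp: pure_tensor_simps clinear_add clinear_scaleC)

lemma clinear_pure_right: "clinear f \<Longrightarrow> clinear (\<lambda>y. x \<otimes> f y)"
  by (rule clinearI) (auto simp: pure_tensor_simps clinear_add clinear_scaleC)

lemma lin_ext_respects:
  assumes F: "cbilinear F" and "tensor_rel p r"
  shows "lin_ext (\<lambda>(x, y). F x y) p = lin_ext (\<lambda>(x, y). F x y) r"
proof -
  let ?L = "lin_ext (\<lambda>(x, y). F x y)"
  note lin = clinear_lin_ext[of "\<lambda>(x, y). F x y"]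
  have F1: "\<And>x. clinear (F x)" and F2: "\<And>y. clinear (\<lambda>x. F x y)"
    using F by (auto simp: cbilinear_def)
  have "?L s = 0" if "s \<in> cspan tensor_relators" for s
    using that
  proof (induction rule: complex_vector.span_induct_alt)
    case base
    show ?case by (rule clinear_0[OF lin])
  next
    case (step c s s')
    have "?L s = 0"
      using step(1) unfolding tensor_relators_def
      by (auto simp: clinear_diff[OF lin] clinear_scaleC[OF lin] clinear_add[OF F1]
          clinear_scaleC[OF F1] clinear_add[OF F2] clinear_scaleC[OF F2])
    then show ?case using step(2)
      by (simp add: clinear_add[OF lin] clinear_scaleC[OF lin])
  qed
  from this[of "p - r"] assms(2) show ?thesis
    by (simp add: tensor_rel_def clinear_diff[OF lin])
qed

lemma tensor_lift_abs:
  assumes "cbilinear F"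
  shows "tensor_lift F (abs_tensor p) = lin_ext (\<lambda>(x, y). F x y) p"
  unfolding tensor_lift_def
  by (rule lin_ext_respects[OF assms])
    (metis Quotient3_rep_abs Quotient3_tensor tensor_rel_refl)

lemma tensor_lift_pure: "cbilinear F \<Longrightarrow> tensor_lift F (x \<otimes> y) = F x y"
  by (simp add: pure_tensor.abs_eq tensor_lift_abs)

lemma clinear_tensor_lift:
  assumes "cbilinear F"
  shows "clinear (tensor_lift F)"
proof (rule clinearI)
  fix S T :: "('a, 'b) tensor" and c
  obtain p r where "S = abs_tensor p" "T = abs_tensor r"
    by (metis Quotient3_abs_rep Quotient3_tensor)
  then show "tensor_lift F (S + T) = tensor_lift F S + tensor_lift F T"
    and "tensor_lift F (c *\<^sub>C S) = c *\<^sub>C tensor_lift F S"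
    by (simp_all add: plus_tensor.abs_eq scaleC_tensor.abs_eq tensor_lift_abs[OF assms]
        clinear_add[OF clinear_lin_ext] clinear_scaleC[OF clinear_lin_ext])
qed

lemma clinear_tensor_lift_fun:
  assumes "\<And>x y. clinear (\<lambda>z. F z x y)"
  shows "clinear (\<lambda>z. tensor_lift (F z) T)"
proof (rule clinearI)
  fix z z' c
  show "tensor_lift (F (z + z')) T = tensor_lift (F z) T + tensor_lift (F z') T"
    unfolding tensor_lift_def lin_ext_def
    by (simp add: case_prod_beta clinear_add[OF assms] scaleC_add_right sum.distrib)
  show "tensor_lift (F (c *\<^sub>C z)) T = c *\<^sub>C tensor_lift (F z) T"
    unfolding tensor_lift_def lin_ext_def
    by (simp add: case_prod_beta clinear_scaleC[OF assms] complex_vector.scale_sum_right mult.commute)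
qed

lemma tensor_induct [case_names zero pure add]:
  assumes "P 0" "\<And>x y. P (x \<otimes> y)" "\<And>S T. P S \<Longrightarrow> P T \<Longrightarrow> P (S + T)"
  shows "P T"
proof -
  obtain p where T: "T = abs_tensor p"
    by (metis Quotient3_abs_rep Quotient3_tensor)
  have "P (abs_tensor p)"
  proof (induction p rule: poly_mapping_add_induct)
    case zero
    show ?case using assms(1) by (simp add: zero_tensor_def)
  next
    case (single k c)
    obtain x y where k: "k = (x, y)" by (cases k)
    have "abs_tensor (Poly_Mapping.single k c) = abs_tensor (c *\<^sub>C Poly_Mapping.single (x, y) 1)"
      by (simp add: k scaleC_single scaleC_complex_def)
    also have "\<dots> = (c *\<^sub>C x) \<otimes> y"
      by (simp only: pure_tensor_scaleC_left) (simp only: pure_tensor.abs_eq scaleC_tensor.abs_eq)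
    finally show ?case using assms(2) by simp
  next
    case (add p r)
    then show ?case using assms(3) by (simp flip: plus_tensor.abs_eq)
  qed
  then show ?thesis using T by simp
qed


section \<open>Differential graded algebras\<close>

text \<open>The operation \<open>hcomp k\<close> is the projection onto the homogeneous component of degree \<open>k\<close>.\<close>

class dga = complex_algebra_1 +
  fixes hcomp :: "nat \<Rightarrow> 'a \<Rightarrow> 'a"
    and dif :: "'a \<Rightarrow> 'a"
  assumes hcomp_add: "hcomp k (x + y) = hcomp k x + hcomp k y"
    and hcomp_scaleC: "hcomp k (c *\<^sub>C x) = c *\<^sub>C hcomp k x"
    and hcomp_hcomp: "hcomp j (hcomp k x) = (if j = k then hcomp k x else 0)"
    and finite_hcomp: "finite {k. hcomp k x \<noteq> 0}"
    and sum_hcomp: "(\<Sum>k | hcomp k x \<noteq> 0. hcomp k x) = x"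
    and hcomp_one: "hcomp 0 1 = 1"
    and hcomp_mult: "hcomp j x = x \<Longrightarrow> hcomp k y = y \<Longrightarrow> hcomp (j + k) (x * y) = x * y"
    and dif_add: "dif (x + y) = dif x + dif y"
    and dif_scaleC: "dif (c *\<^sub>C x) = c *\<^sub>C dif x"
    and hcomp_dif: "hcomp k x = x \<Longrightarrow> hcomp (Suc k) (dif x) = dif x"
    and dif_dif: "dif (dif x) = 0"
    and dif_mult: "hcomp k x = x \<Longrightarrow> dif (x * y) = dif x * y + (- 1) ^ k *\<^sub>C (x * dif y)"

definition forms :: "nat \<Rightarrow> 'a::dga set"
  where "forms k = {x. hcomp k x = x}"

definition dga_hom :: "('a::dga \<Rightarrow> 'b::dga) \<Rightarrow> bool"
  where "dga_hom f \<longleftrightarrow> alg_hom f \<and> (\<forall>k x. f (hcomp k x) = hcomp k (f x)) \<and> (\<forall>x. f (dif x) = dif (f x))"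

definition dg_subalgebra :: "'a::dga set \<Rightarrow> bool"
  where "dg_subalgebra S \<longleftrightarrow> csubspace S \<and> 1 \<in> S \<and> (\<forall>x\<in>S. \<forall>y\<in>S. x * y \<in> S) \<and>
    (\<forall>k. \<forall>x\<in>S. hcomp k x \<in> S) \<and> (\<forall>x\<in>S. dif x \<in> S)"

lemma clinear_hcomp: "clinear (hcomp k)"
  by (rule clinearI) (auto simp: hcomp_add hcomp_scaleC)

lemma clinear_dif: "clinear dif"
  by (rule clinearI) (auto simp: dif_add dif_scaleC)

lemma hcomp_in_forms: "hcomp k x \<in> forms k"
  by (simp add: forms_def hcomp_hcomp)

lemma hcomp_forms: "x \<in> forms k \<Longrightarrow> hcomp j x = (if j = k then x else 0)"
  by (metis (mono_tags, lifting) forms_def hcomp_hcomp mem_Collect_eq)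

lemma forms_mult: "x \<in> forms j \<Longrightarrow> y \<in> forms k \<Longrightarrow> x * y \<in> forms (j + k)"
  by (simp add: forms_def hcomp_mult)

lemma forms_dif: "x \<in> forms k \<Longrightarrow> dif x \<in> forms (Suc k)"
  by (simp add: forms_def hcomp_dif)

lemma forms_one: "1 \<in> forms 0"
  by (simp add: forms_def hcomp_one)

lemma dif_mult_forms:
  "x \<in> forms k \<Longrightarrow> dif (x * y) = dif x * y + (- 1) ^ k *\<^sub>C (x * dif y)"
  by (simp add: forms_def dif_mult)

text \<open>
  The linear map that is \<open>G k\<close> on forms of degree \<open>k\<close>.
\<close>

definition graded_map :: "(nat \<Rightarrow> 'a::dga \<Rightarrow> 'b::complex_vector) \<Rightarrow> 'a \<Rightarrow> 'b"
  where "graded_map G x = (\<Sum>k | hcomp k x \<noteq> 0. G k (hcomp k x))"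

lemma graded_map_superset:
  assumes "\<And>k. clinear (G k)" "finite S" "{k. hcomp k x \<noteq> 0} \<subseteq> S"
  shows "graded_map G x = (\<Sum>k\<in>S. G k (hcomp k x))"
  unfolding graded_map_def using assms(2,3)
  by (intro sum.mono_neutral_left) (auto simp: clinear_0[OF assms(1)])

lemma clinear_graded_map:
  assumes "\<And>k. clinear (G k)"
  shows "clinear (graded_map G)"
proof (rule clinearI)
  fix x y :: 'a and c :: complex
  let ?S = "{k. hcomp k x \<noteq> 0} \<union> {k. hcomp k y \<noteq> 0}"
  have S: "finite ?S" by (simp add: finite_hcomp)
  have sub: "{k. hcomp k (x + y) \<noteq> 0} \<subseteq> ?S" "{k. hcomp k (c *\<^sub>C x) \<noteq> 0} \<subseteq> ?S"
    by (auto simp: hcomp_add hcomp_scaleC)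
  note sup = graded_map_superset[OF assms S]
  have gx: "graded_map G x = (\<Sum>k\<in>?S. G k (hcomp k x))" and gy: "graded_map G y = (\<Sum>k\<in>?S. G k (hcomp k y))"
    by (rule sup, blast)+
  show "graded_map G (x + y) = graded_map G x + graded_map G y"
    unfolding gx gy sup[OF sub(1)] by (simp add: hcomp_add clinear_add[OF assms] sum.distrib)
  show "graded_map G (c *\<^sub>C x) = c *\<^sub>C graded_map G x"
    unfolding gx sup[OF sub(2)]
    by (simp add: hcomp_scaleC clinear_scaleC[OF assms] complex_vector.scale_sum_right)
qed

lemma graded_map_forms:
  assumes "\<And>k. clinear (G k)" "x \<in> forms k"
  shows "graded_map G x = G k x"
  by (subst graded_map_superset[OF assms(1), of "{k}"]) (auto simp: hcomp_forms[OF assms(2)] split: if_splits)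

lemma clinear_graded_map_fun:
  assumes "\<And>k x. clinear (\<lambda>z. F z k x)"
  shows "clinear (\<lambda>z. graded_map (F z) x)"
  unfolding graded_map_def by (rule clinear_sum_fun) (rule assms)

lemma dga_induct [case_names zero homogeneous add]:
  fixes x :: "'a::dga"
  assumes "P 0" "\<And>k x. x \<in> forms k \<Longrightarrow> P x" "\<And>x y. P x \<Longrightarrow> P y \<Longrightarrow> P (x + y)"
  shows "P x"
proof -
  have "P (\<Sum>k\<in>S. hcomp k x)" for S
    by (induction S rule: infinite_finite_induct) (auto intro: assms hcomp_in_forms)
  from this[of "{k. hcomp k x \<noteq> 0}"] show ?thesis
    by (simp add: sum_hcomp)
qed

lemma tensor_homogeneous_induct [case_names zero pure add]:
  fixes T :: "('a::dga, 'b::dga) tensor"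
  assumes zero: "P 0"
    and pure: "\<And>i j x y. x \<in> forms i \<Longrightarrow> y \<in> forms j \<Longrightarrow> P (x \<otimes> y)"
    and add: "\<And>S T. P S \<Longrightarrow> P T \<Longrightarrow> P (S + T)"
  shows "P T"
proof (induction T rule: tensor_induct)
  case (pure x y)
  show ?case
  proof (induction x rule: dga_induct)
    case zero
    show ?case using clinear_0[OF clinear_pure_left[OF complex_vector.linear_ident]] assms(1) by metis
  next
    case (homogeneous i x)
    show ?case
    proof (induction y rule: dga_induct)
      case zero
      show ?case using clinear_0[OF clinear_pure_right[OF complex_vector.linear_ident]] assms(1) by metis
    qed (auto intro: assms homogeneous simp: pure_tensor_simps)
  qed (auto intro: assms simp: pure_tensor_simps)
qed (auto intro: assms)


subsection \<open>The tensor product of differential graded algebras\<close>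

instantiation tensor :: (dga, dga) dga
begin

definition one_tensor :: "('a, 'b) tensor"
  where "one_tensor = 1 \<otimes> 1"

text \<open>\<open>(x \<otimes> y) (u \<otimes> v) = (-1)\<^sup>j\<^sup>k x u \<otimes> y v\<close> if \<open>y\<close> has degree \<open>j\<close> and \<open>u\<close> has degree \<open>k\<close>\<close>

definition times_tensor :: "('a, 'b) tensor \<Rightarrow> ('a, 'b) tensor \<Rightarrow> ('a, 'b) tensor"
  where "S * T = tensor_lift (\<lambda>x y. tensor_lift (\<lambda>u v.
    graded_map (\<lambda>j y. graded_map (\<lambda>k u. (- 1) ^ (j * k) *\<^sub>C (x * u \<otimes> y * v)) u) y) T) S"

definition hcomp_tensor :: "nat \<Rightarrow> ('a, 'b) tensor \<Rightarrow> ('a, 'b) tensor"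
  where "hcomp n = tensor_lift (\<lambda>x y. \<Sum>i\<le>n. hcomp i x \<otimes> hcomp (n - i) y)"

definition dif_tensor :: "('a, 'b) tensor \<Rightarrow> ('a, 'b) tensor"
  where "dif = tensor_lift (\<lambda>x y. dif x \<otimes> y + graded_map (\<lambda>i x. (- 1) ^ i *\<^sub>C (x \<otimes> dif y)) x)"

lemma clinear_tensor_sign:
  fixes x u :: "'a::dga" and y v :: "'b::dga"
  shows "clinear (\<lambda>x. (c *\<^sub>C (x * u \<otimes> y * v)))" "clinear (\<lambda>y. (c *\<^sub>C (x * u \<otimes> y * v)))"
    "clinear (\<lambda>u. (c *\<^sub>C (x * u \<otimes> y * v)))" "clinear (\<lambda>v. (c *\<^sub>C (x * u \<otimes> y * v)))"
  by (intro clinear_scaleC_fun clinear_pure_left clinear_pure_right clinear_intros)+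

lemma cbilinear_tensor_mult_inner:
  "cbilinear (\<lambda>u v. graded_map (\<lambda>j y. graded_map (\<lambda>k u. (- 1) ^ (j * k) *\<^sub>C ((x::'a) * u \<otimes> (y::'b) * v)) u) y)"
  unfolding cbilinear_def
  by (intro conjI allI clinear_graded_map_fun clinear_graded_map clinear_tensor_sign)

lemma cbilinear_tensor_mult_outer:
  "cbilinear (\<lambda>x y. tensor_lift (\<lambda>u v.
    graded_map (\<lambda>j y. graded_map (\<lambda>k u. (- 1) ^ (j * k) *\<^sub>C ((x::'a) * u \<otimes> (y::'b) * v)) u) y) T)"
  unfolding cbilinear_def
proof (intro conjI allI clinear_tensor_lift_fun)
  show "clinear (\<lambda>y. graded_map (\<lambda>j y. graded_map (\<lambda>k u. (- 1) ^ (j * k) *\<^sub>C ((x::'a) * u \<otimes> (y::'b) * v)) u) y)"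
    for x u v
    by (intro clinear_graded_map clinear_graded_map_fun clinear_tensor_sign)
  show "clinear (\<lambda>x. graded_map (\<lambda>j y. graded_map (\<lambda>k u. (- 1) ^ (j * k) *\<^sub>C ((x::'a) * u \<otimes> (y::'b) * v)) u) y)"
    for y u v
    by (intro clinear_graded_map_fun clinear_tensor_sign)
qed

lemma clinear_tensor_times_left: "clinear (\<lambda>S. S * (T :: ('a, 'b) tensor))"
  unfolding times_tensor_def by (rule clinear_tensor_lift[OF cbilinear_tensor_mult_outer])

lemma clinear_tensor_times_right: "clinear (\<lambda>T. S * (T :: ('a, 'b) tensor))"
  unfolding times_tensor_def
  by (intro clinear_tensor_lift_fun clinear_tensor_lift cbilinear_tensor_mult_inner)

lemma tensor_times_homogeneous:
  fixes x u :: 'a and y v :: 'b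
  assumes "y \<in> forms j" "u \<in> forms k"
  shows "(x \<otimes> y) * (u \<otimes> v) = (- 1) ^ (j * k) *\<^sub>C (x * u \<otimes> y * v)"
proof -
  have "(x \<otimes> y) * (u \<otimes> v) =
      graded_map (\<lambda>j y. graded_map (\<lambda>k u. (- 1) ^ (j * k) *\<^sub>C (x * u \<otimes> y * v)) u) y"
    unfolding times_tensor_def
    by (subst tensor_lift_pure[OF cbilinear_tensor_mult_outer],
        subst tensor_lift_pure[OF cbilinear_tensor_mult_inner], rule refl)
  also have "\<dots> = graded_map (\<lambda>k u. (- 1) ^ (j * k) *\<^sub>C (x * u \<otimes> y * v)) u"
    by (rule graded_map_forms[OF _ assms(1)]) (intro clinear_graded_map_fun clinear_tensor_sign)
  also have "\<dots> = (- 1) ^ (j * k) *\<^sub>C (x * u \<otimes> y * v)"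
    by (rule graded_map_forms[OF _ assms(2)]) (intro clinear_tensor_sign)
  finally show ?thesis .
qed

lemma cbilinear_tensor_hcomp:
  "cbilinear (\<lambda>(x::'a) (y::'b). \<Sum>i\<le>n. hcomp i x \<otimes> hcomp (n - i) y)"
  unfolding cbilinear_def
  by (intro conjI allI clinear_sum_fun clinear_pure_left clinear_pure_right clinear_hcomp)

lemma clinear_tensor_hcomp: "clinear (hcomp n :: ('a, 'b) tensor \<Rightarrow> _)"
  unfolding hcomp_tensor_def by (rule clinear_tensor_lift[OF cbilinear_tensor_hcomp])

lemma pure_tensor_zero [simp]: "0 \<otimes> (y :: 'b) = (0 :: ('a, 'b) tensor)" "(x :: 'a) \<otimes> 0 = (0 :: ('a, 'b) tensor)"
  using clinear_0[OF clinear_pure_left[OF complex_vector.linear_ident]]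
    clinear_0[OF clinear_pure_right[OF complex_vector.linear_ident]] by metis+

lemma tensor_hcomp_homogeneous:
  fixes x :: 'a and y :: 'b
  assumes "x \<in> forms i" "y \<in> forms j"
  shows "hcomp n (x \<otimes> y) = (if n = i + j then x \<otimes> y else 0)"
proof -
  have "hcomp n (x \<otimes> y) = (\<Sum>l\<le>n. hcomp l x \<otimes> hcomp (n - l) y)"
    unfolding hcomp_tensor_def by (rule tensor_lift_pure[OF cbilinear_tensor_hcomp])
  also have "\<dots> = (\<Sum>l\<le>n. if l = i then (if n = i + j then x \<otimes> y else 0) else 0)"
    by (rule sum.cong) (auto simp: hcomp_forms[OF assms(1)] hcomp_forms[OF assms(2)])
  also have "\<dots> = (if n = i + j then x \<otimes> y else 0)"
    by (subst sum.delta) auto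
  finally show ?thesis .
qed

lemma cbilinear_tensor_dif:
  "cbilinear (\<lambda>(x::'a) (y::'b). dif x \<otimes> y + graded_map (\<lambda>i x. (- 1) ^ i *\<^sub>C (x \<otimes> dif y)) x)"
  unfolding cbilinear_def
  by (intro conjI allI clinear_add_fun clinear_graded_map clinear_graded_map_fun clinear_scaleC_fun
      clinear_pure_left clinear_pure_right clinear_dif complex_vector.linear_ident)

lemma clinear_tensor_dif: "clinear (dif :: ('a, 'b) tensor \<Rightarrow> _)"
  unfolding dif_tensor_def by (rule clinear_tensor_lift[OF cbilinear_tensor_dif])

lemma tensor_dif_homogeneous:
  fixes x :: 'a and y :: 'b
  assumes "x \<in> forms i"
  shows "dif (x \<otimes> y) = dif x \<otimes> y + (- 1) ^ i *\<^sub>C (x \<otimes> dif y)"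
  unfolding dif_tensor_def tensor_lift_pure[OF cbilinear_tensor_dif]
  by (subst graded_map_forms[OF _ assms])
    (auto intro!: clinear_scaleC_fun clinear_pure_left complex_vector.linear_ident)

lemmas tensor_times_linear =
  clinear_0[OF clinear_tensor_times_left] clinear_0[OF clinear_tensor_times_right]
  clinear_add[OF clinear_tensor_times_left] clinear_add[OF clinear_tensor_times_right]
  clinear_scaleC[OF clinear_tensor_times_left] clinear_scaleC[OF clinear_tensor_times_right]

lemmas tensor_hcomp_linear =
  clinear_0[OF clinear_tensor_hcomp] clinear_add[OF clinear_tensor_hcomp] clinear_scaleC[OF clinear_tensor_hcomp]

lemmas tensor_dif_linear =
  clinear_0[OF clinear_tensor_dif] clinear_add[OF clinear_tensor_dif] clinear_scaleC[OF clinear_tensor_dif]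

lemma tensor_one_neq_zero: "(1 :: 'a) \<otimes> (1 :: 'b) \<noteq> 0"
proof
  assume 0: "(1 :: 'a) \<otimes> (1 :: 'b) = 0"
  interpret A: vector_space_pair "scaleC :: complex \<Rightarrow> 'a \<Rightarrow> 'a" "scaleC :: complex \<Rightarrow> complex \<Rightarrow> complex"
    by unfold_locales
  interpret B: vector_space_pair "scaleC :: complex \<Rightarrow> 'b \<Rightarrow> 'b" "scaleC :: complex \<Rightarrow> complex \<Rightarrow> complex"
    by unfold_locales
  obtain f :: "'a \<Rightarrow> complex" where f: "clinear f" "f 1 = 1"
    using A.linear_independent_extend[of "{1}" "\<lambda>_. 1"] by (auto simp: complex_vector.independent_insert)
  obtain g :: "'b \<Rightarrow> complex" where g: "clinear g" "g 1 = 1"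
    using B.linear_independent_extend[of "{1}" "\<lambda>_. 1"] by (auto simp: complex_vector.independent_insert)
  have bil: "cbilinear (\<lambda>x y. f x * g y)"
    unfolding cbilinear_def using clinear_comp[OF f(1) clinear_mult_right] clinear_comp[OF g(1) clinear_mult_left]
    by auto
  have "tensor_lift (\<lambda>x y. f x * g y) (1 \<otimes> 1) = 1"
    by (simp add: tensor_lift_pure[OF bil] f g)
  then show False
    by (simp add: 0 clinear_0[OF clinear_tensor_lift[OF bil]])
qed

lemma tensor_mult_assoc:
  fixes S T U :: "('a, 'b) tensor"
  shows "(S * T) * U = S * (T * U)"
proof (induction S rule: tensor_homogeneous_induct)
  case (pure i j x y)
  note xy = pure
  show ?case
  proof (induction T rule: tensor_homogeneous_induct)
    case (pure k l u v)
    note uv = pure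
    show ?case
    proof (induction U rule: tensor_homogeneous_induct)
      case (pure m n w z)
      show ?case
        by (simp add: tensor_times_homogeneous[OF xy(2) uv(1)] tensor_times_homogeneous[OF uv(2) pure(1)]
            tensor_times_homogeneous[OF forms_mult[OF xy(2) uv(2)] pure(1)]
            tensor_times_homogeneous[OF xy(2) forms_mult[OF uv(1) pure(1)]]
            tensor_times_linear scaleC_scaleC mult.assoc)
          (simp add: algebra_simps flip: power_add)
    qed (simp_all add: tensor_times_linear)
  qed (simp_all add: tensor_times_linear)
qed (simp_all add: tensor_times_linear)

lemma tensor_mult_one:
  fixes S :: "('a, 'b) tensor"
  shows "(1 \<otimes> 1) * S = S" "S * (1 \<otimes> 1) = S"
  by (induction S rule: tensor_homogeneous_induct)
    (simp_all add: tensor_times_linear tensor_times_homogeneous[OF forms_one] tensor_times_homogeneous[OF _ forms_one])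

lemma tensor_sum_hcomp:
  fixes T :: "('a, 'b) tensor"
  shows "finite {k. hcomp k T \<noteq> 0}" "(\<Sum>k | hcomp k T \<noteq> 0. hcomp k T) = T"
proof -
  have "\<exists>S. finite S \<and> (\<forall>k. k \<notin> S \<longrightarrow> hcomp k T = 0) \<and> (\<Sum>k\<in>S. hcomp k T) = T"
  proof (induction T rule: tensor_homogeneous_induct)
    case zero
    show ?case by (rule exI[of _ "{}"]) (simp add: tensor_hcomp_linear)
  next
    case (pure i j x y)
    show ?case by (rule exI[of _ "{i + j}"]) (simp add: tensor_hcomp_homogeneous[OF pure])
  next
    case (add S T)
    then obtain K L where K: "finite K" "\<forall>k. k \<notin> K \<longrightarrow> hcomp k S = 0" "(\<Sum>k\<in>K. hcomp k S) = S"
      and L: "finite L" "\<forall>k. k \<notin> L \<longrightarrow> hcomp k T = 0" "(\<Sum>k\<in>L. hcomp k T) = T"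
      by blast
    have "(\<Sum>k\<in>K \<union> L. hcomp k S) = S"
      using K L by (subst sum.mono_neutral_right[of "K \<union> L" K]) auto
    moreover have "(\<Sum>k\<in>K \<union> L. hcomp k T) = T"
      using K L by (subst sum.mono_neutral_right[of "K \<union> L" L]) auto
    ultimately show ?case
      using K L by (intro exI[of _ "K \<union> L"]) (simp add: tensor_hcomp_linear sum.distrib)
  qed
  then obtain S where S: "finite S" "\<forall>k. k \<notin> S \<longrightarrow> hcomp k T = 0" "(\<Sum>k\<in>S. hcomp k T) = T"
    by blast
  then have sub: "{k. hcomp k T \<noteq> 0} \<subseteq> S"
    by auto
  with S(1) show "finite {k. hcomp k T \<noteq> 0}"
    by (rule finite_subset[rotated])
  show "(\<Sum>k | hcomp k T \<noteq> 0. hcomp k T) = T"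
    using sum.mono_neutral_left[OF S(1) sub, of "\<lambda>k. hcomp k T"] S(3) by auto
qed

lemma tensor_hcomp_mult:
  fixes S T :: "('a, 'b) tensor"
  shows "hcomp (m + n) (hcomp m S * hcomp n T) = hcomp m S * hcomp n T"
proof (induction S rule: tensor_homogeneous_induct)
  case (pure i j x y)
  note xy = pure
  show ?case
  proof (induction T rule: tensor_homogeneous_induct)
    case (pure k l u v)
    have "hcomp (i + j + (k + l)) (x * u \<otimes> y * v) = x * u \<otimes> y * v"
      using tensor_hcomp_homogeneous[OF forms_mult[OF xy(1) pure(1)] forms_mult[OF xy(2) pure(2)]]
      by (simp add: ac_simps)
    then show ?case
      by (simp add: tensor_hcomp_homogeneous[OF xy] tensor_hcomp_homogeneous[OF pure]
          tensor_times_homogeneous[OF xy(2) pure(1)] tensor_hcomp_linear tensor_times_linear)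
  qed (simp_all add: tensor_hcomp_linear tensor_times_linear)
qed (simp_all add: tensor_hcomp_linear tensor_times_linear)

lemma tensor_hcomp_dif:
  fixes T :: "('a, 'b) tensor"
  shows "hcomp (Suc n) (dif (hcomp n T)) = dif (hcomp n T)"
proof (induction T rule: tensor_homogeneous_induct)
  case (pure i j x y)
  have "hcomp (Suc (i + j)) (dif x \<otimes> y) = dif x \<otimes> y" "hcomp (Suc (i + j)) (x \<otimes> dif y) = x \<otimes> dif y"
    using tensor_hcomp_homogeneous[OF forms_dif[OF pure(1)] pure(2)]
      tensor_hcomp_homogeneous[OF pure(1) forms_dif[OF pure(2)]] by simp_all
  then show ?case
    by (simp add: tensor_hcomp_homogeneous[OF pure] tensor_dif_homogeneous[OF pure(1)]
        tensor_hcomp_linear tensor_dif_linear)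
qed (simp_all add: tensor_hcomp_linear tensor_dif_linear)

lemma tensor_dif_dif:
  fixes T :: "('a, 'b) tensor"
  shows "dif (dif T) = 0"
proof (induction T rule: tensor_homogeneous_induct)
  case (pure i j x y)
  then show ?case
    by (simp add: tensor_dif_homogeneous[OF pure(1)] tensor_dif_homogeneous[OF forms_dif[OF pure(1)]]
        tensor_dif_linear dif_dif complex_vector.scale_minus_left)
qed (simp_all add: tensor_dif_linear)

lemma tensor_dif_mult:
  fixes S T :: "('a, 'b) tensor"
  shows "dif (hcomp n S * T) = dif (hcomp n S) * T + (- 1) ^ n *\<^sub>C (hcomp n S * dif T)"
proof (induction S rule: tensor_homogeneous_induct)
  case (pure i j x y)
  note xy = pure
  show ?case
  proof (induction T rule: tensor_homogeneous_induct)
    case (pure k l u v)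
    have "dif ((x \<otimes> y) * (u \<otimes> v)) = dif (x \<otimes> y) * (u \<otimes> v) + (- 1) ^ (i + j) *\<^sub>C ((x \<otimes> y) * dif (u \<otimes> v))"
      by (simp add: tensor_times_homogeneous[OF xy(2) pure(1)] tensor_dif_homogeneous[OF xy(1)]
          tensor_dif_homogeneous[OF pure(1)] tensor_dif_homogeneous[OF forms_mult[OF xy(1) pure(1)]]
          tensor_times_homogeneous[OF forms_dif[OF xy(2)] pure(1)]
          tensor_times_homogeneous[OF xy(2) forms_dif[OF pure(1)]]
          dif_mult_forms[OF xy(1)] dif_mult_forms[OF xy(2)]
          tensor_dif_linear tensor_times_linear pure_tensor_simps scaleC_add_right scaleC_scaleC,
          cases "even i"; cases "even j"; cases "even k";
          simp add: complex_vector.scale_minus_left)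
    then show ?case
      by (simp add: tensor_hcomp_homogeneous[OF xy] tensor_hcomp_linear tensor_dif_linear tensor_times_linear)
  qed (simp_all add: tensor_dif_linear tensor_times_linear scaleC_add_right algebra_simps)
qed (simp_all add: tensor_hcomp_linear tensor_dif_linear tensor_times_linear scaleC_add_right algebra_simps)

instance
proof
  fix S T U :: "('a, 'b) tensor" and c :: complex and j k :: nat
  show "S * T * U = S * (T * U)" by (rule tensor_mult_assoc)
  show "(S + T) * U = S * U + T * U" "S * (T + U) = S * T + S * U"
    "(c *\<^sub>C S) * T = c *\<^sub>C (S * T)" "S * (c *\<^sub>C T) = c *\<^sub>C (S * T)"
    by (simp_all add: tensor_times_linear)
  show "1 * S = S" "S * 1 = S"
    by (simp_all add: one_tensor_def tensor_mult_one)
  show "(0 :: ('a, 'b) tensor) \<noteq> 1"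
    using tensor_one_neq_zero by (simp add: one_tensor_def)
  show "hcomp k (S + T) = hcomp k S + hcomp k T" "hcomp k (c *\<^sub>C S) = c *\<^sub>C hcomp k S"
    "dif (S + T) = dif S + dif T" "dif (c *\<^sub>C S) = c *\<^sub>C dif S"
    by (simp_all add: tensor_hcomp_linear tensor_dif_linear)
  show "hcomp j (hcomp k S) = (if j = k then hcomp k S else 0)"
    by (induction S rule: tensor_homogeneous_induct)
      (auto simp: tensor_hcomp_linear tensor_hcomp_homogeneous)
  show "finite {k. hcomp k S \<noteq> 0}" "(\<Sum>k | hcomp k S \<noteq> 0. hcomp k S) = S"
    by (rule tensor_sum_hcomp)+
  show "hcomp 0 (1 :: ('a, 'b) tensor) = 1"
    by (simp add: one_tensor_def tensor_hcomp_homogeneous[OF forms_one forms_one])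
  show "hcomp j S = S \<Longrightarrow> hcomp k T = T \<Longrightarrow> hcomp (j + k) (S * T) = S * T"
    using tensor_hcomp_mult[of j k S T] by simp
  show "hcomp k S = S \<Longrightarrow> hcomp (Suc k) (dif S) = dif S"
    using tensor_hcomp_dif[of k S] by simp
  show "dif (dif S) = 0"
    by (rule tensor_dif_dif)
  show "hcomp k S = S \<Longrightarrow> dif (S * T) = dif S * T + (- 1) ^ k *\<^sub>C (S * dif T)"
    using tensor_dif_mult[of k S T] by simp
qed

end


section \<open>The Hopf algebra of Laurent polynomials\<close>

type_synonym laurent = "int \<Rightarrow>\<^sub>0 complex"

definition tpow :: "int \<Rightarrow> laurent"
  where "tpow n = Poly_Mapping.single n 1"

definition comult :: "laurent \<Rightarrow> (laurent, laurent) tensor"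
  where "comult = lin_ext (\<lambda>n. tpow n \<otimes> tpow n)"

definition antipode :: "laurent \<Rightarrow> laurent"
  where "antipode = lin_ext (\<lambda>n. tpow (- n))"

text \<open>These are the algebra maps determined by \<open>t \<mapsto> t \<otimes> t\<close> and \<open>t \<mapsto> t\<^sup>-\<^sup>1\<close>.\<close>

lemma tpow_mult: "tpow m * tpow n = tpow (m + n)"
  by (simp add: tpow_def mult_single)

lemma tpow_0: "tpow 0 = 1"
  by (simp add: tpow_def)

lemma comult_tpow: "comult (tpow n) = tpow n \<otimes> tpow n"
  by (simp add: comult_def tpow_def scaleC_one)

lemma antipode_tpow: "antipode (tpow n) = tpow (- n)"
  by (simp add: antipode_def tpow_def scaleC_one)

lemma clinear_comult: "clinear comult"
  unfolding comult_def by (rule clinear_lin_ext)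

lemma clinear_antipode: "clinear antipode"
  unfolding antipode_def by (rule clinear_lin_ext)

lemma laurent_induct [case_names zero tpow add]:
  assumes "P 0" "\<And>c n. P (c *\<^sub>C tpow n)" "\<And>g h. P g \<Longrightarrow> P h \<Longrightarrow> P (g + h)"
  shows "P (h :: laurent)"
proof (induction h rule: poly_mapping_add_induct)
  case (single k c)
  show ?case using assms(2)[of c k] by (simp add: tpow_def scaleC_single scaleC_complex_def)
qed (auto intro: assms)

lemma cbilinear_tensor_alg_mult_inner:
  "cbilinear (\<lambda>u v. (x :: 'a::complex_algebra_1) * u \<otimes> (y :: 'b::complex_algebra_1) * v)"
  unfolding cbilinear_def
  by (intro conjI allI clinear_pure_left clinear_pure_right clinear_mult_left)

lemma cbilinear_tensor_alg_mult_outer: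
  "cbilinear (\<lambda>x y. tensor_lift (\<lambda>u v. (x :: 'a::complex_algebra_1) * u \<otimes> (y :: 'b::complex_algebra_1) * v) T)"
  unfolding cbilinear_def
  by (intro conjI allI clinear_tensor_lift_fun clinear_pure_left clinear_pure_right clinear_mult_right)

lemma tensor_alg_mult_pure: "tensor_alg_mult (x \<otimes> y) (u \<otimes> v) = x * u \<otimes> y * v"
  unfolding tensor_alg_mult_def
  by (subst tensor_lift_pure[OF cbilinear_tensor_alg_mult_outer],
      subst tensor_lift_pure[OF cbilinear_tensor_alg_mult_inner], rule refl)

lemma clinear_tensor_alg_mult_left: "clinear (\<lambda>S. tensor_alg_mult S T)"
  unfolding tensor_alg_mult_def by (rule clinear_tensor_lift[OF cbilinear_tensor_alg_mult_outer])

lemma clinear_tensor_alg_mult_right: "clinear (\<lambda>T. tensor_alg_mult S T)"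
  unfolding tensor_alg_mult_def
  by (intro clinear_tensor_lift_fun clinear_tensor_lift cbilinear_tensor_alg_mult_inner)

lemma comult_mult: "comult (g * h) = tensor_alg_mult (comult g) (comult h)"
proof -
  note lin = clinear_comult clinear_tensor_alg_mult_left clinear_tensor_alg_mult_right
  show ?thesis
  proof (induction g rule: laurent_induct)
    case zero
    show ?case by (simp add: lin[THEN clinear_0])
  next
    case (tpow c m)
    show ?case
    proof (induction h rule: laurent_induct)
      case zero
      show ?case by (simp add: lin[THEN clinear_0])
    next
      case (tpow d n)
      show ?case
        by (simp add: lin[THEN clinear_scaleC] comult_tpow tpow_mult tensor_alg_mult_pure
            mult_scaleC_left mult_scaleC_right)
    next
      case (add g h)
      then show ?case by (simp add: distrib_left lin[THEN clinear_add])
    qed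
  next
    case (add g g')
    then show ?case by (simp add: distrib_right lin[THEN clinear_add])
  qed
qed


section \<open>Differential calculi\<close>

text \<open>
  \<open>i\<close> identifies the algebra \<open>'a\<close> with the degree zero part of the differential graded algebra \<open>'w\<close>.
\<close>

definition diff_calculus :: "('a::complex_algebra_1 \<Rightarrow> 'w::dga) \<Rightarrow> bool"
  where "diff_calculus i \<longleftrightarrow> alg_hom i \<and> inj i \<and> range i = forms 0 \<and>
    (\<forall>k. forms k = cspan {i a * prod_list (map (\<lambda>b. dif (i b)) bs) |a bs. length bs = k})"

text \<open>The forms of degree \<open>k\<close> are a free left module over the degree zero part, with basis \<open>es\<close>.\<close>

definition left_basis :: "('a::complex_algebra_1 \<Rightarrow> 'w::dga) \<Rightarrow> nat \<Rightarrow> 'w list \<Rightarrow> bool"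
  where "left_basis i k es \<longleftrightarrow> set es \<subseteq> forms k \<and>
    (\<forall>\<omega>\<in>forms k. \<exists>!as. length as = length es \<and> \<omega> = sum_list (map2 (\<lambda>a e. i a * e) as es))"

definition pullback_calculus :: "('a::complex_algebra_1 \<Rightarrow> 'w::dga) \<Rightarrow> 'a set \<Rightarrow> 'w set"
  where "pullback_calculus i B =
    cspan {i b * prod_list (map (\<lambda>c. dif (i c)) cs) |b cs. b \<in> B \<and> set cs \<subseteq> B}"


subsection \<open>The calculus on Laurent polynomials\<close>

definition U1_calculus :: "complex \<Rightarrow> (laurent \<Rightarrow> 'h::dga) \<Rightarrow> bool"
  where "U1_calculus q i \<longleftrightarrow> diff_calculus i \<and>
    left_basis i 1 [dif (i (tpow 1))] \<and>
    dif (i (tpow 1)) * i (tpow 1) = q ^ 2 *\<^sub>C (i (tpow 1) * dif (i (tpow 1))) \<and>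
    (\<forall>k\<ge>2. forms k = ({0} :: 'h set))"


subsection \<open>Quantum \<open>SL\<^sub>2\<close> and its three-dimensional calculus\<close>

datatype sl2_gen = Alpha | Beta | Gamma | Delta

fun sl2_deg :: "sl2_gen \<Rightarrow> int" where
  "sl2_deg Alpha = 1"
| "sl2_deg Beta = - 1"
| "sl2_deg Gamma = 1"
| "sl2_deg Delta = - 1"

definition SL2_relators :: "complex \<Rightarrow> sl2_gen free_algebra set"
  where "SL2_relators q =
   (let \<alpha> = free_gen Alpha; \<beta> = free_gen Beta; \<gamma> = free_gen Gamma; \<delta> = free_gen Delta in
    {\<beta> * \<alpha> - q *\<^sub>C (\<alpha> * \<beta>),
     \<gamma> * \<alpha> - q *\<^sub>C (\<alpha> * \<gamma>),
     \<delta> * \<beta> - q *\<^sub>C (\<beta> * \<delta>),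
     \<delta> * \<gamma> - q *\<^sub>C (\<gamma> * \<delta>),
     (\<delta> * \<alpha> - \<alpha> * \<delta>) - (q - q powi (- 1)) *\<^sub>C (\<beta> * \<gamma>),
     \<gamma> * \<beta> - \<beta> * \<gamma>,
     (\<alpha> * \<delta> - q powi (- 1) *\<^sub>C (\<beta> * \<gamma>)) - 1})"

definition SL2_e_plus :: "complex \<Rightarrow> (sl2_gen \<Rightarrow> 'a) \<Rightarrow> ('a::complex_algebra_1 \<Rightarrow> 'w::dga) \<Rightarrow> 'w"
  where "SL2_e_plus q x i = q powi (- 1) *\<^sub>C (i (x Alpha) * dif (i (x Gamma)))
    - q powi (- 2) *\<^sub>C (i (x Gamma) * dif (i (x Alpha)))"

definition SL2_e_minus :: "complex \<Rightarrow> (sl2_gen \<Rightarrow> 'a) \<Rightarrow> ('a::complex_algebra_1 \<Rightarrow> 'w::dga) \<Rightarrow> 'w"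
  where "SL2_e_minus q x i = i (x Delta) * dif (i (x Beta)) - q *\<^sub>C (i (x Beta) * dif (i (x Delta)))"

definition SL2_e_zero :: "complex \<Rightarrow> (sl2_gen \<Rightarrow> 'a) \<Rightarrow> ('a::complex_algebra_1 \<Rightarrow> 'w::dga) \<Rightarrow> 'w"
  where "SL2_e_zero q x i = i (x Delta) * dif (i (x Alpha)) - q *\<^sub>C (i (x Beta) * dif (i (x Gamma)))"

definition SL2_calculus :: "complex \<Rightarrow> (sl2_gen \<Rightarrow> 'a) \<Rightarrow> ('a::complex_algebra_1 \<Rightarrow> 'w::dga) \<Rightarrow> bool"
  where "SL2_calculus q x i \<longleftrightarrow>
   (let ep = SL2_e_plus q x i; em = SL2_e_minus q x i; e0 = SL2_e_zero q x i;
        \<alpha> = i (x Alpha); \<beta> = i (x Beta); \<gamma> = i (x Gamma); \<delta> = i (x Delta)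
    in diff_calculus i \<and>
       left_basis i 1 [ep, em, e0] \<and>
       left_basis i 2 [ep * e0, em * e0, ep * em] \<and>
       left_basis i 3 [ep * em * e0] \<and>
       (\<forall>k>3. forms k = ({0} :: 'w set)) \<and>
       (\<forall>f. ep * i (x f) = q powi sl2_deg f *\<^sub>C (i (x f) * ep)) \<and>
       (\<forall>f. em * i (x f) = q powi sl2_deg f *\<^sub>C (i (x f) * em)) \<and>
       (\<forall>f. e0 * i (x f) = q powi (2 * sl2_deg f) *\<^sub>C (i (x f) * e0)) \<and>
       dif \<alpha> = \<alpha> * e0 + q *\<^sub>C (\<beta> * ep) \<and>
       dif \<gamma> = \<gamma> * e0 + q *\<^sub>C (\<delta> * ep) \<and>
       dif \<beta> = \<alpha> * em - q powi (- 2) *\<^sub>C (\<beta> * e0) \<and>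
       dif \<delta> = \<gamma> * em - q powi (- 2) *\<^sub>C (\<delta> * e0) \<and>
       ep * em = - (q powi (- 2) *\<^sub>C (em * ep)) \<and>
       ep * e0 = - (q powi (- 4) *\<^sub>C (e0 * ep)) \<and>
       em * e0 = - (q powi 4 *\<^sub>C (e0 * em)) \<and>
       ep * ep = 0 \<and> em * em = 0 \<and> e0 * e0 = 0 \<and>
       dif e0 = q ^ 3 *\<^sub>C (ep * em) \<and>
       dif ep = - ((q powi 2 * (1 + q powi (- 2))) *\<^sub>C (ep * e0)) \<and>
       dif em = (q powi (- 2) * (1 + q powi (- 2))) *\<^sub>C (em * e0))"

definition SL2_coaction ::
    "(sl2_gen \<Rightarrow> 'a::complex_algebra_1) \<Rightarrow> ('a \<Rightarrow> ('a, laurent) tensor) \<Rightarrow> bool"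
  where "SL2_coaction x \<Delta> \<longleftrightarrow> clinear \<Delta> \<and> \<Delta> 1 = 1 \<otimes> 1 \<and>
    (\<forall>a b. \<Delta> (a * b) = tensor_alg_mult (\<Delta> a) (\<Delta> b)) \<and>
    (\<forall>f. \<Delta> (x f) = x f \<otimes> tpow (sl2_deg f))"


section \<open>Base, horizontal and vertical forms\<close>

text \<open>
  Below, \<open>iA\<close> and \<open>iH\<close> are calculi on a comodule algebra \<open>'a\<close> with coaction \<open>\<Delta>\<close> and on \<open>H\<close>.
  Maps prescribed only on a subspace (such as \<open>\<Omega>\<^sup>1\<close>) are chosen as linear maps on all forms; the
  prescription determines them on that subspace, and they are used only there.
\<close>

definition coinvariants :: "('a::complex_algebra_1 \<Rightarrow> ('a, laurent) tensor) \<Rightarrow> 'a set"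
  where "coinvariants \<Delta> = {b. \<Delta> b = b \<otimes> 1}"

definition extends_coaction ::
    "('a::complex_algebra_1 \<Rightarrow> 'w::dga) \<Rightarrow> (laurent \<Rightarrow> 'h::dga) \<Rightarrow> ('a \<Rightarrow> ('a, laurent) tensor) \<Rightarrow>
      ('w \<Rightarrow> ('w, 'h) tensor) \<Rightarrow> bool"
  where "extends_coaction iA iH \<Delta> \<Phi> \<longleftrightarrow> dga_hom \<Phi> \<and> (\<forall>a. \<Phi> (iA a) = tensor_map iA iH (\<Delta> a))"

definition complete_calculus ::
    "('a::complex_algebra_1 \<Rightarrow> 'w::dga) \<Rightarrow> (laurent \<Rightarrow> 'h::dga) \<Rightarrow> ('a \<Rightarrow> ('a, laurent) tensor) \<Rightarrow> bool"
  where "complete_calculus iA iH \<Delta> \<longleftrightarrow> (\<exists>\<Phi>. extends_coaction iA iH \<Delta> \<Phi>)"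

text \<open>Unique if it exists, since a calculus is generated by its degree zero part and \<open>dif\<close>.\<close>

definition ext_coaction ::
    "('a::complex_algebra_1 \<Rightarrow> 'w::dga) \<Rightarrow> (laurent \<Rightarrow> 'h::dga) \<Rightarrow> ('a \<Rightarrow> ('a, laurent) tensor) \<Rightarrow>
      'w \<Rightarrow> ('w, 'h) tensor"
  where "ext_coaction iA iH \<Delta> = (THE \<Phi>. extends_coaction iA iH \<Delta> \<Phi>)"

definition base_forms ::
    "('a::complex_algebra_1 \<Rightarrow> 'w::dga) \<Rightarrow> (laurent \<Rightarrow> 'h::dga) \<Rightarrow> ('a \<Rightarrow> ('a, laurent) tensor) \<Rightarrow> 'w set"
  where "base_forms iA iH \<Delta> = {\<omega>. ext_coaction iA iH \<Delta> \<omega> = \<omega> \<otimes> 1}"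

definition hor_forms ::
    "('a::complex_algebra_1 \<Rightarrow> 'w::dga) \<Rightarrow> (laurent \<Rightarrow> 'h::dga) \<Rightarrow> ('a \<Rightarrow> ('a, laurent) tensor) \<Rightarrow> 'w set"
  where "hor_forms iA iH \<Delta> = {\<omega>. ext_coaction iA iH \<Delta> \<omega> \<in> tensor_sub UNIV (range iH)}"

text \<open>
  The coaction \<open>h \<mapsto> h\<^sub>1 \<otimes> h\<^sub>2\<close>, \<open>h dg \<mapsto> h\<^sub>1 g\<^sub>1 \<otimes> h\<^sub>2 dg\<^sub>2\<close>; there are no forms of degree above one here.
\<close>

definition left_coaction :: "(laurent \<Rightarrow> 'h::dga) \<Rightarrow> 'h \<Rightarrow> (laurent, 'h) tensor"
  where "left_coaction iH = (SOME L. clinear L \<and>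
    (\<forall>h. L (iH h) = tensor_map id iH (comult h)) \<and>
    (\<forall>h g. L (iH h * dif (iH g)) =
      tensor_lift (\<lambda>h1 h2. tensor_lift (\<lambda>g1 g2. h1 * g1 \<otimes> iH h2 * dif (iH g2)) (comult g)) (comult h)))"

definition left_inv_forms :: "(laurent \<Rightarrow> 'h::dga) \<Rightarrow> 'h set"
  where "left_inv_forms iH = {\<theta>. left_coaction iH \<theta> = 1 \<otimes> \<theta>}"

definition left_inv_1_forms :: "(laurent \<Rightarrow> 'h::dga) \<Rightarrow> 'h set"
  where "left_inv_1_forms iH = left_inv_forms iH \<inter> forms 1"

definition ver_forms :: "(laurent \<Rightarrow> 'h::dga) \<Rightarrow> ('a::complex_algebra_1, 'h) tensor set"
  where "ver_forms iH = tensor_sub UNIV (left_inv_forms iH)"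


section \<open>Connection 1-forms\<close>

text \<open>\<open>a da' \<mapsto> a a'\<^sub>0 \<otimes> S(a'\<^sub>1) da'\<^sub>2\<close>\<close>

definition ver_projection ::
    "('a::complex_algebra_1 \<Rightarrow> 'w::dga) \<Rightarrow> (laurent \<Rightarrow> 'h::dga) \<Rightarrow> ('a \<Rightarrow> ('a, laurent) tensor) \<Rightarrow>
      'w \<Rightarrow> ('a, 'h) tensor"
  where "ver_projection iA iH \<Delta> = (SOME \<pi>. clinear \<pi> \<and>
    (\<forall>a a'. \<pi> (iA a * dif (iA a')) =
      tensor_lift (\<lambda>a0 h. tensor_lift (\<lambda>h1 h2. a * a0 \<otimes> iH (antipode h1) * dif (iH h2)) (comult h)) (\<Delta> a')))"

text \<open>\<open>a da' \<mapsto> a\<^sub>0 da'\<^sub>0 \<otimes> a\<^sub>1 a'\<^sub>1\<close>\<close>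

definition right_coaction_1 ::
    "('a::complex_algebra_1 \<Rightarrow> 'w::dga) \<Rightarrow> ('a \<Rightarrow> ('a, laurent) tensor) \<Rightarrow> 'w \<Rightarrow> ('w, laurent) tensor"
  where "right_coaction_1 iA \<Delta> = (SOME R. clinear R \<and>
    (\<forall>a a'. R (iA a * dif (iA a')) =
      tensor_lift (\<lambda>a0 h. tensor_lift (\<lambda>a0' h'. iA a0 * dif (iA a0') \<otimes> h * h') (\<Delta> a')) (\<Delta> a)))"

text \<open>\<open>S(h\<^sub>1) dh\<^sub>2 \<mapsto> S(h\<^sub>2) dh\<^sub>3 \<otimes> S(h\<^sub>1) h\<^sub>4\<close>\<close>

definition adjoint_coaction :: "(laurent \<Rightarrow> 'h::dga) \<Rightarrow> 'h \<Rightarrow> ('h, laurent) tensor"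
  where "adjoint_coaction iH = (SOME R. clinear R \<and>
    (\<forall>h. R (tensor_lift (\<lambda>h1 h2. iH (antipode h1) * dif (iH h2)) (comult h)) =
      tensor_lift (\<lambda>h1 k. tensor_lift (\<lambda>h2 l. tensor_lift (\<lambda>h3 h4.
        iH (antipode h2) * dif (iH h3) \<otimes> antipode h1 * h4) (comult l)) (comult k)) (comult h)))"

text \<open>Only the restriction of \<open>s\<close> to the left invariant 1-forms is relevant.\<close>

definition connection_1_form ::
    "('a::complex_algebra_1 \<Rightarrow> 'w::dga) \<Rightarrow> (laurent \<Rightarrow> 'h::dga) \<Rightarrow> ('a \<Rightarrow> ('a, laurent) tensor) \<Rightarrow>
      ('h \<Rightarrow> 'w) \<Rightarrow> bool"
  where "connection_1_form iA iH \<Delta> s \<longleftrightarrow> clinear s \<and>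
    (\<forall>\<theta>\<in>left_inv_1_forms iH. s \<theta> \<in> forms 1) \<and>
    (\<forall>\<theta>\<in>left_inv_1_forms iH. right_coaction_1 iA \<Delta> (s \<theta>) = tensor_map s id (adjoint_coaction iH \<theta>)) \<and>
    (\<forall>\<theta>\<in>left_inv_1_forms iH. ver_projection iA iH \<Delta> (s \<theta>) = 1 \<otimes> \<theta>)"

end

theory Submission
  imports Defs
begin

text \<open>
  Put \<open>\<tau> = t\<^sup>-\<^sup>1 dt\<close>. The extended coaction \<open>\<Phi>\<close> must send \<open>e\<^sup>\<plusminus>\<close> to \<open>e\<^sup>\<plusminus> \<otimes> t\<^sup>\<plusminus>\<^sup>2\<close> and \<open>e\<^sup>0\<close> to
  \<open>e\<^sup>0 \<otimes> 1 + 1 \<otimes> \<tau>\<close>. These three images satisfy the same exterior relations, and the same commutation rules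
  with degree zero, as \<open>e\<^sup>+, e\<^sup>-, e\<^sup>0\<close>, so the left linear extension to the free modules \<open>\<Omega>\<^sup>k(A)\<close> is multiplicative, and
  compatibility with the differential only has to be checked on generators.

  If \<open>N \<omega>\<close> is the contraction of \<open>\<Phi> \<omega>\<close> with the functional \<open>t\<^sup>n \<mapsto> 0\<close>, \<open>t\<^sup>n \<tau> \<mapsto> 1\<close>, then \<open>\<omega> - N \<omega> e\<^sup>0\<close> has no \<open>e\<^sup>0\<close>
  component; hence horizontal forms lie in the \<open>A\<close>-span of \<open>1, e\<^sup>+, e\<^sup>-, e\<^sup>+ e\<^sup>-\<close>, and base forms in its part of
  weight zero. Squaring the two quantum determinant relations gives weight \<open>\<plusminus>2\<close> elements expressing \<open>e\<^sup>\<plusminus>\<close> through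
  \<open>d(\<alpha>\<beta>)\<close>, \<open>d(\<alpha>\<delta>)\<close> and \<open>d(\<gamma>\<delta>)\<close>, so these forms lie in the pullback calculus. The maps in the definition of a
  connection 1-form are slices of \<open>\<Phi>\<close>.
\<close>

section \<open>Tensor products, presentations and calculi\<close>

lemma sum_list_map2_nth:
  assumes "length as = length es"
  shows "sum_list (map2 f as es) = (\<Sum>j<length es. f (as ! j) (es ! j))"
  using assms by (simp add: sum_list_sum_nth atLeast0LessThan)

text \<open>Uniqueness of the coordinate list makes each coordinate map linear. The maps are
  extended by zero to the other degrees, so that extensions from several degrees can simply be
  added.\<close>

lemma left_basis_coeffs:
  fixes i :: "'a::complex_algebra_1 \<Rightarrow> 'w::dga"
  assumes lin: "clinear i" and deg: "range i \<subseteq> forms 0" and basis: "left_basis i k es"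
  obtains c :: "nat \<Rightarrow> 'w \<Rightarrow> 'a" where "\<And>j. j < length es \<Longrightarrow> clinear (c j)"
    "\<And>\<omega>. \<omega> \<in> forms k \<Longrightarrow> \<omega> = (\<Sum>j<length es. i (c j \<omega>) * es ! j)"
    "\<And>a j l. j < length es \<Longrightarrow> l < length es \<Longrightarrow> c l (i a * es ! j) = (if l = j then a else 0)"
    "\<And>\<omega> m j. \<omega> \<in> forms m \<Longrightarrow> m \<noteq> k \<Longrightarrow> j < length es \<Longrightarrow> c j \<omega> = 0"
proof -
  let ?R = "\<lambda>as \<omega>. length as = length es \<and> \<omega> = (\<Sum>j<length es. i (as ! j) * es ! j)"
  have ex1: "\<exists>!as. ?R as \<omega>" if "\<omega> \<in> forms k" for \<omega>
    using basis that by (auto simp: left_basis_def sum_list_map2_nth cong: conj_cong)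
  have es: "es ! j \<in> forms k" if "j < length es" for j
    using basis that nth_mem unfolding left_basis_def by blast
  \<comment> \<open>Reading coordinates off the degree \<open>k\<close> component makes the maps
    total and zero on forms of any other degree.\<close>
  define cf where "cf \<omega> = (THE as. ?R as (hcomp k \<omega>))" for \<omega>
  have cf: "?R (cf \<omega>) (hcomp k \<omega>)" for \<omega>
    unfolding cf_def by (rule theI'[OF ex1[OF hcomp_in_forms]])
  have cfI: "cf \<omega> = as" if "?R as (hcomp k \<omega>)" for \<omega> as
    unfolding cf_def by (rule the1_equality[OF ex1[OF hcomp_in_forms] that])
  note len = cf[THEN conjunct1]
  note eq = cf[THEN conjunct2]
  show ?thesis
  proof (rule that[of "\<lambda>j \<omega>. cf \<omega> ! j"])
    fix j assume j: "j < length es"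
    show "clinear (\<lambda>\<omega>. cf \<omega> ! j)"
    proof (rule clinearI)
      fix \<omega> \<eta> and d :: complex
      have "cf (\<omega> + \<eta>) = map2 (+) (cf \<omega>) (cf \<eta>)"
        by (rule cfI) (auto simp: len eq[of \<omega>] eq[of \<eta>] hcomp_add clinear_add[OF lin] distrib_right sum.distrib)
      then show "cf (\<omega> + \<eta>) ! j = cf \<omega> ! j + cf \<eta> ! j"
        using j by (simp add: len)
      have "cf (d *\<^sub>C \<omega>) = map (scaleC d) (cf \<omega>)"
        by (rule cfI) (auto simp: len eq[of \<omega>] hcomp_scaleC clinear_scaleC[OF lin] mult_scaleC_left complex_vector.scale_sum_right)
      then show "cf (d *\<^sub>C \<omega>) ! j = d *\<^sub>C (cf \<omega> ! j)"
        using j by (simp add: len)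
    qed
  next
    fix \<omega> :: 'w assume "\<omega> \<in> forms k"
    then show "\<omega> = (\<Sum>j<length es. i (cf \<omega> ! j) * es ! j)"
      using eq[of \<omega>] by (simp add: forms_def)
  next
    fix a j l assume jl: "j < length es" "l < length es"
    have "i a * es ! j \<in> forms (0 + k)"
      using deg es[OF jl(1)] by (intro forms_mult) auto
    then have h: "hcomp k (i a * es ! j) = i a * es ! j"
      by (simp add: forms_def)
    have "cf (i a * es ! j) = map (\<lambda>l. if l = j then a else 0) [0..<length es]"
    proof (rule cfI, unfold h, intro conjI)
      have "(\<Sum>l<length es. i (map (\<lambda>l. if l = j then a else 0) [0..<length es] ! l) * es ! l)
          = (\<Sum>l<length es. if l = j then i a * es ! j else 0)"
        by (rule sum.cong) (auto simp: clinear_0[OF lin])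
      then show "i a * es ! j = (\<Sum>l<length es. i (map (\<lambda>l. if l = j then a else 0) [0..<length es] ! l) * es ! l)"
        using jl by simp
    qed simp
    then show "cf (i a * es ! j) ! l = (if l = j then a else 0)"
      using jl by simp
  next
    fix \<omega> :: 'w and m j assume m: "\<omega> \<in> forms m" "m \<noteq> k" and j: "j < length es"
    have "cf \<omega> = replicate (length es) 0"
      by (rule cfI) (use m in \<open>auto simp: hcomp_forms clinear_0[OF lin]\<close>)
    then show "cf \<omega> ! j = 0"
      using j by simp
  qed
qed

text \<open>The images are prescribed as complex linear functions of the coefficient instead of by
  module linearity. This covers maps that transform the coefficient, such as a coaction, and
  functionals.\<close>

lemma left_basis_extend:
  fixes i :: "'a::complex_algebra_1 \<Rightarrow> 'w::dga" and f :: "nat \<Rightarrow> 'a \<Rightarrow> 'v::complex_vector"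
  assumes "clinear i" "range i \<subseteq> forms 0" "left_basis i k es" and f: "\<And>j. clinear (f j)"
  obtains F :: "'w \<Rightarrow> 'v" where "clinear F"
    "\<And>a j. j < length es \<Longrightarrow> F (i a * es ! j) = f j a"
    "\<And>\<omega> m. \<omega> \<in> forms m \<Longrightarrow> m \<noteq> k \<Longrightarrow> F \<omega> = 0"
proof -
  obtain c :: "nat \<Rightarrow> 'w \<Rightarrow> 'a" where c: "\<And>j. j < length es \<Longrightarrow> clinear (c j)"
    "\<And>a j l. j < length es \<Longrightarrow> l < length es \<Longrightarrow> c l (i a * es ! j) = (if l = j then a else 0)"
    "\<And>\<omega> m j. \<omega> \<in> forms m \<Longrightarrow> m \<noteq> k \<Longrightarrow> j < length es \<Longrightarrow> c j \<omega> = 0"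
    by (rule left_basis_coeffs[OF assms(1-3)]) blast
  show ?thesis
  proof (rule that[of "\<lambda>\<omega>. \<Sum>j<length es. f j (c j \<omega>)"])
    show "clinear (\<lambda>\<omega>. \<Sum>j<length es. f j (c j \<omega>))"
      by (rule clinearI) (simp_all add: clinear_add[OF c(1)] clinear_scaleC[OF c(1)] clinear_add[OF f]
          clinear_scaleC[OF f] sum.distrib complex_vector.scale_sum_right)
    fix a j assume j: "j < length es"
    have "(\<Sum>l<length es. f l (c l (i a * es ! j))) = (\<Sum>l<length es. if l = j then f j a else 0)"
      by (rule sum.cong) (auto simp: c(2) j clinear_0[OF f])
    then show "(\<Sum>l<length es. f l (c l (i a * es ! j))) = f j a"
      using j by simp
  qed (simp add: c(3) clinear_0[OF f])
qed

lemma left_basis_induct [consumes 4, case_names zero basis add]: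
  fixes i :: "'a::complex_algebra_1 \<Rightarrow> 'w::dga"
  assumes "clinear i" "range i \<subseteq> forms 0" "left_basis i k es" "\<omega> \<in> forms k"
    and "P 0" "\<And>a j. j < length es \<Longrightarrow> P (i a * es ! j)" "\<And>\<omega> \<eta>. P \<omega> \<Longrightarrow> P \<eta> \<Longrightarrow> P (\<omega> + \<eta>)"
  shows "P \<omega>"
proof -
  obtain c :: "nat \<Rightarrow> 'w \<Rightarrow> 'a" where
    c: "\<And>\<omega>. \<omega> \<in> forms k \<Longrightarrow> \<omega> = (\<Sum>j<length es. i (c j \<omega>) * es ! j)"
    by (rule left_basis_coeffs[OF assms(1-3)]) blast
  have "P (\<Sum>j\<in>S. i (c j \<omega>) * es ! j)" if "S \<subseteq> {..<length es}" for S
    using that by (induction S rule: infinite_finite_induct) (auto intro: assms(5-7))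
  then show ?thesis
    using c[OF assms(4)] by (metis order_refl)
qed

text \<open>Injectivity of \<open>i\<close> makes degree zero free of rank one on 1, so all degrees
  can be handled by the same extension and induction rules.\<close>

lemma left_basis_degree_0:
  assumes "diff_calculus i"
  shows "left_basis i 0 [1]"
  unfolding left_basis_def
proof (intro conjI ballI ex_ex1I)
  have i: "inj i" "range i = forms 0"
    using assms by (auto simp: diff_calculus_def)
  show "set [1] \<subseteq> (forms 0 :: 'b set)" by (simp add: forms_one)
  fix \<omega> :: 'b assume "\<omega> \<in> forms 0"
  then obtain a where "\<omega> = i a" using i by auto
  then show "\<exists>as. length as = length [1::'b] \<and> \<omega> = sum_list (map2 (\<lambda>a. (*) (i a)) as [1])"
    by (intro exI[of _ "[a]"]) simp
  show "as = bs" if "length as = length [1::'b] \<and> \<omega> = sum_list (map2 (\<lambda>a. (*) (i a)) as [1])"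
    "length bs = length [1::'b] \<and> \<omega> = sum_list (map2 (\<lambda>a. (*) (i a)) bs [1])" for as bs
    using that i(1) by (auto simp: length_Suc_conv inj_eq)
qed

section \<open>Signs in the graded tensor product\<close>

lemma tensor_times_degree_0_left:
  fixes x u :: "'a::dga" and y v :: "'b::dga"
  assumes "y \<in> forms 0"
  shows "(x \<otimes> y) * (u \<otimes> v) = x * u \<otimes> y * v"
  by (induction u rule: dga_induct)
    (simp_all add: tensor_times_homogeneous[OF assms] scaleC_one pure_tensor_simps distrib_left)

lemma tensor_times_degree_0_right:
  fixes x u :: "'a::dga" and y v :: "'b::dga"
  assumes "u \<in> forms 0"
  shows "(x \<otimes> y) * (u \<otimes> v) = x * u \<otimes> y * v"
  by (induction y rule: dga_induct)
    (simp_all add: tensor_times_homogeneous[OF _ assms] scaleC_one pure_tensor_simps distrib_left distrib_right)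

text \<open>The only case with a sign that arises below, since forms on H stop at degree
  one.\<close>

lemma tensor_times_degree_1:
  fixes x u :: "'a::dga" and y v :: "'b::dga"
  assumes "y \<in> forms 1" "u \<in> forms 1"
  shows "(x \<otimes> y) * (u \<otimes> v) = - (x * u \<otimes> y * v)"
  using tensor_times_homogeneous[OF assms] by (simp add: complex_vector.scale_minus_left scaleC_one)

lemma pure_tensor_uminus:
  "(- x) \<otimes> y = - (x \<otimes> y)" "x \<otimes> (- y) = - (x \<otimes> y)"
  using pure_tensor_scaleC_left[of "-1" x y] pure_tensor_scaleC_right[of x "-1" y]
  by (simp_all add: complex_vector.scale_minus_left scaleC_one)

lemma pure_tensor_diff:
  "(x - x') \<otimes> y = x \<otimes> y - x' \<otimes> y" "x \<otimes> (y - y') = x \<otimes> y - x \<otimes> y'"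
  using pure_tensor_add_left[of x "- x'" y] pure_tensor_add_right[of x y "- y'"]
  by (simp_all add: pure_tensor_uminus)

section \<open>Induction over presented algebras\<close>

lemma alg_homD:
  assumes "alg_hom f"
  shows "clinear f" "f 1 = 1" "f (x * y) = f x * f y"
  using assms by (auto simp: alg_hom_def)

lemma free_eval_single: "free_eval x (Poly_Mapping.single w c) = c *\<^sub>C prod_list (map x (letters w))"
  by (simp add: free_eval_def)

lemma alg_hom_free_eval: "alg_hom (free_eval x)"
proof -
  have lin: "clinear (free_eval x)"
    unfolding free_eval_def by (rule clinear_lin_ext)
  note l = clinear_0[OF lin] clinear_add[OF lin]
  have "free_eval x (p * r) = free_eval x p * free_eval x r" for p r
  proof (induction p rule: poly_mapping_add_induct)
    case (single v c)
    show ?case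
      by (induction r rule: poly_mapping_add_induct)
        (simp_all add: l distrib_left mult_single free_eval_single plus_word_def mult_scaleC_left
          mult_scaleC_right scaleC_scaleC mult.commute)
  qed (simp_all add: l distrib_right)
  moreover have "free_eval x 1 = 1"
    using free_eval_single[of x 0 1] by (simp add: zero_word_def scaleC_one flip: single_one)
  ultimately show ?thesis
    using lin by (simp add: alg_hom_def)
qed

lemma free_eval_gen: "free_eval x (free_gen g) = x g"
  by (simp add: free_gen_def free_eval_single scaleC_one)

text \<open>Scalars are kept with the word, so zero is the case of coefficient 0 and the empty
  word.\<close>

lemma presented_by_induct [consumes 1, case_names word add]:
  assumes "presented_by x R" "\<And>c ws. P (c *\<^sub>C prod_list (map x ws))" "\<And>a b. P a \<Longrightarrow> P b \<Longrightarrow> P (a + b)"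
  shows "P a"
proof -
  obtain p where p: "a = free_eval x p"
    using assms(1) unfolding presented_by_def surj_def by blast
  note lin = alg_homD(1)[OF alg_hom_free_eval]
  have "P (free_eval x p)"
  proof (induction p rule: poly_mapping_add_induct)
    case zero
    show ?case using assms(2)[of 0 "[]"] by (simp add: clinear_0[OF lin])
  qed (auto simp: free_eval_single clinear_add[OF lin] intro: assms)
  then show ?thesis by (simp add: p)
qed

lemma presented_by_relator:
  assumes "presented_by x R" "r \<in> R"
  shows "free_eval x r = 0"
proof -
  have "r = 1 * r * 1" by simp
  then have "r \<in> {a * r * b |a r b. r \<in> R}"
    using assms(2) by blast
  then have "r \<in> two_sided_ideal R"
    unfolding two_sided_ideal_def by (rule complex_vector.span_base)
  then show ?thesis
    using assms(1) unfolding presented_by_def by blast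
qed

section \<open>Maps and subspaces determined by a calculus\<close>

lemma dif_1: "dif (1 :: 'v::dga) = 0"
  using dif_mult_forms[OF forms_one, of "1 :: 'v"] by (simp add: scaleC_one)

text \<open>Scalars are absorbed into the coefficient \<open>a\<close>, hence there is no case for
  scalar multiples.\<close>

lemma diff_calculus_induct [consumes 1, case_names zero form add]:
  fixes i :: "'a::complex_algebra_1 \<Rightarrow> 'w::dga"
  assumes "diff_calculus i" and zero: "P 0"
    and form: "\<And>a bs. P (i a * prod_list (map (\<lambda>b. dif (i b)) bs))"
    and add: "\<And>\<omega> \<eta>. P \<omega> \<Longrightarrow> P \<eta> \<Longrightarrow> P (\<omega> + \<eta>)"
  shows "P \<omega>"
proof (induction \<omega> rule: dga_induct)
  case (homogeneous k \<omega>)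
  have lin: "clinear i" using assms(1) by (simp add: diff_calculus_def alg_homD)
  have "\<omega> \<in> cspan {i a * prod_list (map (\<lambda>b. dif (i b)) bs) |a bs. length bs = k}"
    using assms(1) homogeneous by (auto simp: diff_calculus_def)
  then show ?case
  proof (induction rule: complex_vector.span_induct_alt)
    case (step c \<omega> \<eta>)
    then obtain a bs where "\<omega> = i a * prod_list (map (\<lambda>b. dif (i b)) bs)" by blast
    then have "c *\<^sub>C \<omega> = i (c *\<^sub>C a) * prod_list (map (\<lambda>b. dif (i b)) bs)"
      by (simp add: clinear_scaleC[OF lin] mult_scaleC_left)
    then show ?case using form step(2) add by metis
  qed (rule zero)
qed (simp_all add: zero add)

text \<open>A DGA morphism is determined by its values in degree zero, because these and their
  differentials generate all forms. This identifies the definite description with any extension that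
  has been constructed.\<close>

lemma ext_coaction_eq:
  assumes "diff_calculus iA" "extends_coaction iA iH \<Delta> \<Phi>"
  shows "ext_coaction iA iH \<Delta> = \<Phi>"
  unfolding ext_coaction_def
proof (rule the_equality)
  show "extends_coaction iA iH \<Delta> \<Phi>" by (rule assms(2))
  fix \<Psi> assume \<Psi>: "extends_coaction iA iH \<Delta> \<Psi>"
  have hom: "clinear F" "F 1 = 1" "F (\<omega> * \<eta>) = F \<omega> * F \<eta>" "F (dif \<omega>) = dif (F \<omega>)" "F (iA a) = tensor_map iA iH (\<Delta> a)"
    if "extends_coaction iA iH \<Delta> F" for F \<omega> \<eta> a
    using that by (auto simp: extends_coaction_def dga_hom_def alg_hom_def)
  have words: "\<Psi> (prod_list (map (\<lambda>b. dif (iA b)) bs)) = \<Phi> (prod_list (map (\<lambda>b. dif (iA b)) bs))" for bs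
    by (induction bs) (simp_all add: hom[OF \<Psi>] hom[OF assms(2)])
  show "\<Psi> = \<Phi>"
  proof
    fix \<omega>
    show "\<Psi> \<omega> = \<Phi> \<omega>"
      using assms(1)
    proof (induction \<omega> rule: diff_calculus_induct)
      case zero
      show ?case by (simp add: clinear_0[OF hom(1)[OF \<Psi>]] clinear_0[OF hom(1)[OF assms(2)]])
    next
      case (form a bs)
      show ?case by (simp add: hom[OF \<Psi>] hom[OF assms(2)] words)
    next
      case (add \<omega> \<eta>)
      then show ?case by (simp add: clinear_add[OF hom(1)[OF \<Psi>]] clinear_add[OF hom(1)[OF assms(2)]])
    qed
  qed
qed

lemma tensor_one_dga_hom:
  fixes \<omega> :: "'a::dga"
  shows "hcomp k (\<omega> \<otimes> (1 :: 'b::dga)) = hcomp k \<omega> \<otimes> 1" "dif (\<omega> \<otimes> (1 :: 'b)) = dif \<omega> \<otimes> 1"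
proof (induction \<omega> rule: dga_induct)
  case (homogeneous j \<omega>)
  show "hcomp k (\<omega> \<otimes> (1 :: 'b)) = hcomp k \<omega> \<otimes> 1"
    using tensor_hcomp_homogeneous[OF homogeneous forms_one[where 'a = 'b], of k]
    by (simp add: hcomp_forms[OF homogeneous])
  show "dif (\<omega> \<otimes> (1 :: 'b)) = dif \<omega> \<otimes> 1"
    by (simp add: tensor_dif_homogeneous[OF homogeneous] dif_1)
qed (simp_all add: clinear_0[OF clinear_hcomp] clinear_0[OF clinear_dif] hcomp_add dif_add pure_tensor_simps)

text \<open>Bilinearity behind the slice maps, which contract the second tensor leg with a
  functional.\<close>

lemma cbilinear_functional_right:
  fixes \<phi> :: "'b::complex_vector \<Rightarrow> complex"
  shows "clinear \<phi> \<Longrightarrow> cbilinear (\<lambda>(v :: 'a::complex_vector) h. \<phi> h *\<^sub>C v)"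
  unfolding cbilinear_def
  by (auto intro!: clinearI simp: clinear_add clinear_scaleC scaleC_add_left scaleC_add_right scaleC_scaleC
      scaleC_complex_def mult.commute)

text \<open>The set is the equalizer of two DGA morphisms, \<open>F\<close> and \<omega> \<mapsto>
  \<omega> \<otimes> 1.\<close>

lemma dg_subalgebra_coinvariant:
  fixes F :: "'a::dga \<Rightarrow> ('a, 'b::dga) tensor"
  assumes "dga_hom F"
  shows "dg_subalgebra {\<omega>. F \<omega> = \<omega> \<otimes> 1}"
proof -
  have F: "clinear F" "F 1 = 1" "F (\<omega> * \<eta>) = F \<omega> * F \<eta>" "F (dif \<omega>) = dif (F \<omega>)" "F (hcomp k \<omega>) = hcomp k (F \<omega>)"
    for \<omega> \<eta> k
    using assms by (auto simp: dga_hom_def alg_hom_def)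
  show ?thesis
    unfolding dg_subalgebra_def complex_vector.subspace_def
    by (auto simp: F(2-5) clinear_0[OF F(1)] clinear_add[OF F(1)] clinear_scaleC[OF F(1)] pure_tensor_simps
        one_tensor_def tensor_times_degree_0_left[OF forms_one] tensor_one_dga_hom)
qed

text \<open>Appending an exact factor to a spanning form gives another spanning form; no Leibniz
  rule is involved.\<close>

lemma pullback_calculus_mult_dif:
  assumes "\<omega> \<in> pullback_calculus i B" "b \<in> B"
  shows "\<omega> * dif (i b) \<in> pullback_calculus i B"
  using assms(1) unfolding pullback_calculus_def
proof (induction rule: complex_vector.span_induct_alt)
  case base
  show ?case by (simp add: complex_vector.span_zero)
next
  case (step c \<omega> \<eta>)
  then obtain b' cs where \<omega>: "\<omega> = i b' * prod_list (map (\<lambda>c. dif (i c)) cs)" "b' \<in> B" "set cs \<subseteq> B"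
    by blast
  have "\<omega> * dif (i b) = i b' * prod_list (map (\<lambda>c. dif (i c)) (cs @ [b]))"
    by (simp add: \<omega>(1) mult.assoc)
  then have "\<omega> * dif (i b) \<in> {i b * prod_list (map (\<lambda>c. dif (i c)) cs) |b cs. b \<in> B \<and> set cs \<subseteq> B}"
    using \<omega>(2,3) assms(2) by (metis (mono_tags, lifting) mem_Collect_eq set_append Un_subset_iff list.set(1) list.set(2) insert_subset empty_subsetI)
  then show ?case
    using step(2) by (simp add: distrib_right mult_scaleC_left complex_vector.span_add complex_vector.span_scale complex_vector.span_base)
qed

lemma pullback_calculus_base: "b \<in> B \<Longrightarrow> i b \<in> pullback_calculus i B"
  unfolding pullback_calculus_def
  by (rule complex_vector.span_base) (auto intro!: exI[of _ b] exI[of _ "[]"])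

lemma pullback_calculus_add:
  "\<omega> \<in> pullback_calculus i B \<Longrightarrow> \<eta> \<in> pullback_calculus i B \<Longrightarrow> \<omega> + \<eta> \<in> pullback_calculus i B"
  unfolding pullback_calculus_def by (rule complex_vector.span_add)

lemma pullback_calculus_scaleC:
  "\<omega> \<in> pullback_calculus i B \<Longrightarrow> c *\<^sub>C \<omega> \<in> pullback_calculus i B"
  unfolding pullback_calculus_def by (rule complex_vector.span_scale)

lemma pullback_calculus_diff:
  "\<omega> \<in> pullback_calculus i B \<Longrightarrow> \<eta> \<in> pullback_calculus i B \<Longrightarrow> \<omega> - \<eta> \<in> pullback_calculus i B"
  unfolding pullback_calculus_def by (rule complex_vector.span_diff)

section \<open>Normal ordering of exterior products\<close>

lemmas bilinear_simps = distrib_left distrib_right mult_scaleC_left mult_scaleC_right pure_tensor_simps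

text \<open>Oriented rules that sort products into the order \<open>p\<close>, \<open>m\<close>,
  \<open>z\<close>; the versions with a tail \<open>u\<close> act inside right-nested products. The
  elements are abstract because the rules serve both for the basis forms on A and for their images
  under the coaction.\<close>

lemma exterior_normal_form:
  fixes q :: complex and p m z :: "'v::complex_algebra_1"
  assumes q: "q \<noteq> 0"
    and pm: "p * m = - (q powi (- 2) *\<^sub>C (m * p))"
    and pz: "p * z = - (q powi (- 4) *\<^sub>C (z * p))"
    and mz: "m * z = - (q powi 4 *\<^sub>C (z * m))"
    and sq: "p * p = 0" "m * m = 0" "z * z = 0"
  shows "m * p = - (q powi 2 *\<^sub>C (p * m))" "z * p = - (q powi 4 *\<^sub>C (p * z))"
    "z * m = - (q powi (- 4) *\<^sub>C (m * z))"
    "m * (p * u) = - (q powi 2 *\<^sub>C (p * (m * u)))" "z * (p * u) = - (q powi 4 *\<^sub>C (p * (z * u)))"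
    "z * (m * u) = - (q powi (- 4) *\<^sub>C (m * (z * u)))"
    "p * (p * u) = 0" "m * (m * u) = 0" "z * (z * u) = 0"
proof -
  have inv: "q powi n *\<^sub>C q powi (- n) *\<^sub>C v = v" for n and v :: 'v
    using q by (simp add: scaleC_scaleC scaleC_one power_int_minus)
  show 1: "m * p = - (q powi 2 *\<^sub>C (p * m))" "z * p = - (q powi 4 *\<^sub>C (p * z))"
    "z * m = - (q powi (- 4) *\<^sub>C (m * z))"
    using inv[of 2] inv[of 4] inv[of "- 4"] by (simp_all add: pm pz mz)
  show "m * (p * u) = - (q powi 2 *\<^sub>C (p * (m * u)))" "z * (p * u) = - (q powi 4 *\<^sub>C (p * (z * u)))"
    "z * (m * u) = - (q powi (- 4) *\<^sub>C (m * (z * u)))"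
    using 1[THEN arg_cong, of "\<lambda>v. v * u"] by (simp_all add: mult.assoc mult_scaleC_left)
  show "p * (p * u) = 0" "m * (m * u) = 0" "z * (z * u) = 0"
    using sq[THEN arg_cong, of "\<lambda>v. v * u"] by (simp_all add: mult.assoc)
qed


section \<open>The calculus on Laurent polynomials\<close>

locale laurent_calculus =
  fixes q :: complex and iH :: "laurent \<Rightarrow> 'h::dga"
  assumes q_nonzero: "q \<noteq> 0" and calculus: "U1_calculus q iH"
begin

definition T :: "int \<Rightarrow> 'h"
  where "T n = iH (tpow n)"

definition \<tau> :: 'h
  where "\<tau> = T (- 1) * dif (T 1)"

lemma iH_calculus: "diff_calculus iH"
  and iH_basis: "left_basis iH 1 [dif (T 1)]"
  and dif_T_1_T: "dif (T 1) * T 1 = q ^ 2 *\<^sub>C (T 1 * dif (T 1))"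
  and forms_ge_2: "k \<ge> 2 \<Longrightarrow> forms k = ({0} :: 'h set)"
  using calculus by (auto simp: U1_calculus_def T_def)

lemma iH_hom: "alg_hom iH" and iH_range: "range iH = forms 0"
  using iH_calculus by (auto simp: diff_calculus_def)

lemmas iH_linear = alg_homD(1)[OF iH_hom]

lemma T_mult: "T m * T n = T (m + n)"
  by (simp add: T_def tpow_mult flip: alg_homD(3)[OF iH_hom])

lemma T_mult': "T m * (T n * z) = T (m + n) * z"
  by (simp add: T_mult flip: mult.assoc)

lemma T_0: "T 0 = 1"
  by (simp add: T_def tpow_0 alg_homD(2)[OF iH_hom])

lemma T_forms: "T n \<in> forms 0"
  using iH_range by (auto simp: T_def)

lemma tau_forms: "\<tau> \<in> forms 1"
  using forms_mult[OF T_forms forms_dif[OF T_forms]] by (simp add: \<tau>_def)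

lemma T_tau_forms: "T n * \<tau> \<in> forms 1"
  using forms_mult[OF T_forms tau_forms] by simp

lemma dif_T_1: "dif (T 1) = T 1 * \<tau>"
  by (simp add: \<tau>_def T_mult' T_0)

text \<open>The relation between dt and t settles exponent 1, its conjugate by t settles exponent
  -1, and the rest is induction in both directions.\<close>

lemma tau_T: "\<tau> * T n = q powi (2 * n) *\<^sub>C (T n * \<tau>)"
proof -
  have 1: "\<tau> * T 1 = q ^ 2 *\<^sub>C (T 1 * \<tau>)"
    by (simp add: \<tau>_def mult.assoc dif_T_1_T mult_scaleC_right T_mult' T_0)
  \<comment> \<open>Multiplying the relation for exponent 1 by the inverse of t on both sides turns
    it into the one for exponent -1.\<close>
  have "T (- 1) * (\<tau> * T 1) * T (- 1) = T (- 1) * (q ^ 2 *\<^sub>C (T 1 * \<tau>)) * T (- 1)"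
    by (simp only: 1)
  then have "T (- 1) * \<tau> = q ^ 2 *\<^sub>C (\<tau> * T (- 1))"
    by (simp add: mult.assoc mult_scaleC_right mult_scaleC_left T_mult T_mult' T_0)
  then have "inverse (q ^ 2) *\<^sub>C (T (- 1) * \<tau>) = inverse (q ^ 2) *\<^sub>C q ^ 2 *\<^sub>C (\<tau> * T (- 1))"
    by (rule arg_cong)
  then have 2: "\<tau> * T (- 1) = inverse (q ^ 2) *\<^sub>C (T (- 1) * \<tau>)"
    using q_nonzero by (simp add: scaleC_scaleC scaleC_one)
  show ?thesis
  proof (induction n rule: int_induct[of _ 0])
    case base
    show ?case by (simp add: T_0 scaleC_one)
  next
    case (step1 i)
    have "\<tau> * T (i + 1) = \<tau> * T i * T 1"
      by (simp add: mult.assoc T_mult)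
    also have "\<dots> = (q powi (2 * i) * q ^ 2) *\<^sub>C (T (i + 1) * \<tau>)"
      by (simp add: step1 mult_scaleC_left mult.assoc 1 mult_scaleC_right scaleC_scaleC T_mult')
    also have "q powi (2 * i) * q ^ 2 = q powi (2 * (i + 1))"
      using q_nonzero by (simp add: power_int_add algebra_simps)
    finally show ?case .
  next
    case (step2 i)
    have "\<tau> * T (i - 1) = \<tau> * T i * T (- 1)"
      by (simp add: mult.assoc T_mult)
    also have "\<dots> = (q powi (2 * i) * inverse (q ^ 2)) *\<^sub>C (T (i - 1) * \<tau>)"
      by (simp add: step2 mult_scaleC_left mult.assoc 2 mult_scaleC_right scaleC_scaleC T_mult')
    also have "q powi (2 * i) * inverse (q ^ 2) = q powi (2 * (i - 1))"
      using q_nonzero by (simp add: power_int_diff algebra_simps field_simps)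
    finally show ?case .
  qed
qed

text \<open>The square and the differential of \<open>\<tau>\<close> have degree two, where H has no
  forms.\<close>

lemma tau_tau: "\<tau> * \<tau> = 0"
  using forms_mult[OF tau_forms tau_forms] forms_ge_2[of 2] by (simp add: numeral_2_eq_2)

lemma dif_tau: "dif \<tau> = 0"
  using forms_dif[OF tau_forms] forms_ge_2[of 2] by (simp add: numeral_2_eq_2)

lemma dif_T_mult: "dif (T m * T n) = dif (T m) * T n + T m * dif (T n)"
  using dif_mult_forms[OF T_forms, of m "T n"] by (simp add: scaleC_one)

text \<open>Differentiate the product of t with its inverse and multiply by the inverse from the
  right.\<close>

lemma dif_T_minus_1: "dif (T (- 1)) = - (q powi (- 2) *\<^sub>C (T (- 1) * \<tau>))"
proof -
  have "dif (T (- 1) * T 1) = 0"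
    by (simp add: T_mult T_0 dif_1)
  then have "(dif (T (- 1)) * T 1 + T (- 1) * dif (T 1)) * T (- 1) = 0"
    by (simp add: dif_T_mult)
  then have "dif (T (- 1)) + \<tau> * T (- 1) = 0"
    by (simp add: \<tau>_def distrib_right mult.assoc T_mult T_0)
  then show ?thesis
    by (simp add: tau_T eq_neg_iff_add_eq_0)
qed

text \<open>The coefficient is written exactly as in the structure equation for
  \<open>dif ep\<close>, to which it will be compared; likewise the next lemma for
  \<open>dif em\<close>.\<close>

lemma dif_T_2: "dif (T 2) = (q powi 2 * (1 + q powi (- 2))) *\<^sub>C (T 2 * \<tau>)"
proof -
  have "dif (T 2) = dif (T 1 * T 1)" by (simp add: T_mult)
  also have "\<dots> = (q powi 2 + 1) *\<^sub>C (T 2 * \<tau>)"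
    by (simp add: dif_T_mult dif_T_1 mult.assoc tau_T mult_scaleC_right T_mult' scaleC_add_left scaleC_one)
  also have "q powi 2 + 1 = q powi 2 * (1 + q powi (- 2))"
    using q_nonzero by (simp add: power_int_minus field_simps)
  finally show ?thesis .
qed

lemma dif_T_minus_2: "dif (T (- 2)) = - ((q powi (- 2) * (1 + q powi (- 2))) *\<^sub>C (T (- 2) * \<tau>))"
proof -
  have "dif (T (- 2)) = dif (T (- 1) * T (- 1))" by (simp add: T_mult)
  also have "\<dots> = - (q powi (- 2) *\<^sub>C q powi (- 2) *\<^sub>C (T (- 2) * \<tau>)) - q powi (- 2) *\<^sub>C (T (- 2) * \<tau>)"
    by (simp add: dif_T_mult dif_T_minus_1 mult.assoc tau_T mult_scaleC_right mult_scaleC_left T_mult')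
  also have "\<dots> = - ((q powi (- 2) * (1 + q powi (- 2))) *\<^sub>C (T (- 2) * \<tau>))"
    by (simp add: distrib_left scaleC_scaleC scaleC_add_left)
  finally show ?thesis .
qed

text \<open>For n > 0 the recursion yields the q-integer 1 + q^2 + ... + q^(2n-2). Later arguments
  use only proportionality to \<open>T n * \<tau>\<close>.\<close>

lemma dif_T: "\<exists>c. dif (T n) = c *\<^sub>C (T n * \<tau>)"
proof (induction n rule: int_induct[of _ 0])
  case base
  show ?case by (intro exI[of _ 0]) (simp add: T_0 dif_1)
next
  case (step1 i)
  then obtain c where "dif (T i) = c *\<^sub>C (T i * \<tau>)" by blast
  then have "dif (T (i + 1)) = (c * q powi 2 + 1) *\<^sub>C (T (i + 1) * \<tau>)"
    using dif_T_mult[of i 1]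
    by (simp add: T_mult dif_T_1 mult_scaleC_left mult_scaleC_right mult.assoc tau_T scaleC_scaleC T_mult'
        scaleC_add_left scaleC_one)
  then show ?case by blast
next
  case (step2 i)
  then obtain c where "dif (T i) = c *\<^sub>C (T i * \<tau>)" by blast
  then have "dif (T (i - 1)) = (c * q powi (- 2) + (- (q powi (- 2)))) *\<^sub>C (T (i - 1) * \<tau>)"
    using dif_T_mult[of i "- 1"]
    by (simp add: T_mult dif_T_minus_1 mult_scaleC_left mult_scaleC_right mult.assoc tau_T scaleC_scaleC T_mult'
        complex_vector.scale_left_diff_distrib)
  then show ?case by blast
qed

lemma form_induct [case_names zero T T_tau add]:
  assumes zero: "P 0" and T: "\<And>c n. P (c *\<^sub>C T n)" and T_tau: "\<And>c n. P (c *\<^sub>C (T n * \<tau>))"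
    and add: "\<And>x y. P x \<Longrightarrow> P y \<Longrightarrow> P (x + y)"
  shows "P (\<theta> :: 'h)"
proof (induction \<theta> rule: dga_induct)
  case (homogeneous k \<theta>)
  consider "k = 0" | "k = 1" | "k \<ge> 2" by linarith
  then show ?case
  proof cases
    case 1
    then obtain h where h: "\<theta> = iH h" using homogeneous iH_range by blast
    have "P (iH h)"
      by (induction h rule: laurent_induct)
        (auto simp: clinear_0[OF iH_linear] clinear_add[OF iH_linear] clinear_scaleC[OF iH_linear]
          zero add T[unfolded T_def])
    then show ?thesis by (simp add: h)
  next
    case 2
    have "P (iH h * dif (T 1))" for h
    proof (induction h rule: laurent_induct)
      case (tpow c n)
      show ?case
        \<comment> \<open>The module generator is dt, which equals t times \<open>\<tau>\<close>;
          this shifts the exponent by one.\<close>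
        using T_tau[of c "n + 1"]
        by (simp add: clinear_scaleC[OF iH_linear] mult_scaleC_left dif_T_1 T_mult' flip: T_def)
    qed (simp_all add: clinear_0[OF iH_linear] clinear_add[OF iH_linear] distrib_right zero add)
    moreover have "range iH \<subseteq> forms 0" "\<theta> \<in> forms 1"
      using iH_range homogeneous 2 by simp_all
    ultimately show ?thesis
      using left_basis_induct[OF iH_linear _ iH_basis, of \<theta> P] by (auto simp: zero add)
  next
    case 3
    then show ?thesis using homogeneous forms_ge_2[of k] zero by simp
  qed
qed (simp_all add: zero add)

text \<open>Together with \<open>form_induct\<close> this says that the \<open>T n\<close> and
  \<open>T n * \<tau>\<close> form a complex basis of the forms on H. All functionals and coactions
  on H below are built from it.\<close>

lemma extend_T_tau:
  fixes f g :: "int \<Rightarrow> 'v::complex_vector"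
  obtains F :: "'h \<Rightarrow> 'v" where "clinear F" "\<And>n. F (T n) = f n" "\<And>n. F (T n * \<tau>) = g n"
proof -
  have range: "range iH \<subseteq> forms 0" using iH_range by simp
  obtain F where F: "clinear F" "\<And>h. F (iH h * [1] ! 0) = lin_ext f h" "\<And>\<omega> m. \<omega> \<in> forms m \<Longrightarrow> m \<noteq> 0 \<Longrightarrow> F \<omega> = 0"
    by (rule left_basis_extend[OF iH_linear range left_basis_degree_0[OF iH_calculus],
          where f = "\<lambda>_. lin_ext f", OF clinear_lin_ext]) auto
  \<comment> \<open>The index is shifted because \<open>T n * \<tau>\<close> has coefficient t^(n-1)
    with respect to dt.\<close>
  obtain G where G: "clinear G" "\<And>h. G (iH h * [dif (T 1)] ! 0) = lin_ext (\<lambda>n. g (n + 1)) h" "\<And>\<omega> m. \<omega> \<in> forms m \<Longrightarrow> m \<noteq> 1 \<Longrightarrow> G \<omega> = 0"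
    by (rule left_basis_extend[OF iH_linear range iH_basis,
          where f = "\<lambda>_. lin_ext (\<lambda>n. g (n + 1))", OF clinear_lin_ext]) auto
  show ?thesis
  proof (rule that[of "\<lambda>x. F x + G x"])
    show "clinear (\<lambda>x. F x + G x)" by (rule clinear_add_fun[OF F(1) G(1)])
    show "F (T n) + G (T n) = f n" for n
      using F(2)[of "tpow n"] G(3)[OF T_forms[of n]] by (simp add: T_def) (simp add: tpow_def scaleC_one)
    have "T n * \<tau> = iH (tpow (n - 1)) * dif (T 1)" for n
      by (simp add: dif_T_1 T_mult' flip: T_def)
    then show "F (T n * \<tau>) + G (T n * \<tau>) = g n" for n
      using F(3)[OF T_tau_forms[of n]] G(2)[of "tpow (n - 1)"] by simp (simp add: tpow_def scaleC_one)
  qed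
qed

section \<open>The left coaction and invariant forms\<close>

lemma comult_lift: "cbilinear F \<Longrightarrow> tensor_lift F (comult (tpow n)) = F (tpow n) (tpow n)"
  by (simp add: comult_tpow tensor_lift_pure)

lemmas iH_map_linear = clinear_add[OF iH_linear] clinear_scaleC[OF iH_linear] clinear_add[OF clinear_dif]
  clinear_scaleC[OF clinear_dif] clinear_add[OF clinear_antipode] clinear_scaleC[OF clinear_antipode]

lemma cbilinear_left_coaction_inner:
  "cbilinear (\<lambda>g1 g2. (h1 :: laurent) * g1 \<otimes> iH h2 * dif (iH g2))"
  unfolding cbilinear_def by (auto intro!: clinearI simp: iH_map_linear bilinear_simps)

lemma cbilinear_left_coaction_outer:
  "cbilinear (\<lambda>h1 h2. tensor_lift (\<lambda>g1 g2. (h1 :: laurent) * g1 \<otimes> iH h2 * dif (iH g2)) S)"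
  unfolding cbilinear_def
  by (intro conjI allI clinear_tensor_lift_fun clinearI) (auto simp: iH_map_linear bilinear_simps)

lemma cbilinear_id_iH: "cbilinear (\<lambda>x y. id x \<otimes> iH y)"
  unfolding cbilinear_def by (auto intro!: clinearI simp: iH_map_linear bilinear_simps)

text \<open>The chosen map meets its specification once some map does. The witness attaches t^n to
  both \<open>T n\<close> and \<open>T n * \<tau>\<close>, and by \<open>dif_T\<close> it has the
  required values on all h dg.\<close>

lemma left_coaction_spec:
  "clinear (left_coaction iH)"
  "left_coaction iH (iH h) = tensor_map id iH (comult h)"
  "left_coaction iH (iH h * dif (iH g)) =
    tensor_lift (\<lambda>h1 h2. tensor_lift (\<lambda>g1 g2. h1 * g1 \<otimes> iH h2 * dif (iH g2)) (comult g)) (comult h)"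
proof -
  let ?spec = "\<lambda>L. clinear L \<and> (\<forall>h. L (iH h) = tensor_map id iH (comult h)) \<and>
    (\<forall>h g. L (iH h * dif (iH g)) =
      tensor_lift (\<lambda>h1 h2. tensor_lift (\<lambda>g1 g2. h1 * g1 \<otimes> iH h2 * dif (iH g2)) (comult g)) (comult h))"
  obtain L where L: "clinear L" "\<And>n. L (T n) = tpow n \<otimes> T n" "\<And>n. L (T n * \<tau>) = tpow n \<otimes> (T n * \<tau>)"
    using extend_T_tau[of "\<lambda>n. tpow n \<otimes> T n" "\<lambda>n. tpow n \<otimes> (T n * \<tau>)"] by blast
  have "?spec L"
  proof (intro conjI allI L(1))
    show "L (iH h) = tensor_map id iH (comult h)" for h
    proof -
      have lin: "clinear (\<lambda>h. tensor_map id iH (comult h))" "clinear (\<lambda>h. L (iH h))"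
        unfolding tensor_map_def
        by (rule clinear_comp[OF clinear_comult clinear_tensor_lift[OF cbilinear_id_iH]])
          (rule clinear_comp[OF iH_linear L(1)])
      have "L (iH (tpow n)) = tensor_map id iH (comult (tpow n))" for n
        using L(2)[of n] unfolding tensor_map_def comult_lift[OF cbilinear_id_iH] by (simp add: T_def)
      then show ?thesis
        by (induction h rule: laurent_induct)
          (simp_all add: lin[THEN clinear_0] lin[THEN clinear_add] lin[THEN clinear_scaleC])
    qed
    show "L (iH h * dif (iH g)) =
      tensor_lift (\<lambda>h1 h2. tensor_lift (\<lambda>g1 g2. h1 * g1 \<otimes> iH h2 * dif (iH g2)) (comult g)) (comult h)" for h g
    proof (induction h rule: laurent_induct)
      case zero
      show ?case
        by (simp add: clinear_0[OF clinear_comult] clinear_0[OF clinear_tensor_lift[OF cbilinear_left_coaction_outer]]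
          clinear_0[OF L(1)] clinear_0[OF iH_linear])
    next
      case (tpow c m)
      note lin = clinear_tensor_lift[OF cbilinear_left_coaction_inner]
      have "L (T m * dif (iH g)) =
        tensor_lift (\<lambda>g1 g2. tpow m * g1 \<otimes> T m * dif (iH g2)) (comult g)"
      proof (induction g rule: laurent_induct)
        case zero
        show ?case
          by (simp add: T_def clinear_0[OF clinear_comult] clinear_0[OF lin]
            clinear_0[OF L(1)] clinear_0[OF iH_linear] clinear_0[OF clinear_dif])
      next
        case (tpow d n)
        obtain c where c: "dif (T n) = c *\<^sub>C (T n * \<tau>)" using dif_T by blast
        have "L (T m * dif (T n)) = tpow m * tpow n \<otimes> T m * dif (T n)"
          by (simp add: c mult_scaleC_right T_mult' clinear_scaleC[OF L(1)] L(3) tpow_mult pure_tensor_simps)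
        then show ?case
          by (simp add: T_def clinear_scaleC[OF iH_linear] clinear_scaleC[OF clinear_dif] mult_scaleC_right
            clinear_scaleC[OF clinear_comult] clinear_scaleC[OF L(1)] clinear_scaleC[OF lin]
            comult_lift[OF cbilinear_left_coaction_inner])
      next
        case (add g g')
        then show ?case
          by (simp add: T_def clinear_add[OF iH_linear] clinear_add[OF clinear_dif] distrib_left
            clinear_add[OF clinear_comult] clinear_add[OF L(1)] clinear_add[OF lin])
      qed
      then show ?case
        by (simp add: T_def clinear_scaleC[OF iH_linear] mult_scaleC_left clinear_scaleC[OF L(1)]
          clinear_scaleC[OF clinear_comult] clinear_scaleC[OF clinear_tensor_lift[OF cbilinear_left_coaction_outer]]
          comult_lift[OF cbilinear_left_coaction_outer])
    next
      case (add h h')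
      then show ?case
        by (simp add: clinear_add[OF clinear_comult] clinear_add[OF clinear_tensor_lift[OF cbilinear_left_coaction_outer]]
          clinear_add[OF L(1)] clinear_add[OF iH_linear] distrib_right)
    qed
  qed
  then have "?spec (left_coaction iH)"
    unfolding left_coaction_def by (rule someI[of ?spec])
  then show "clinear (left_coaction iH)"
    "left_coaction iH (iH h) = tensor_map id iH (comult h)"
    "left_coaction iH (iH h * dif (iH g)) =
      tensor_lift (\<lambda>h1 h2. tensor_lift (\<lambda>g1 g2. h1 * g1 \<otimes> iH h2 * dif (iH g2)) (comult g)) (comult h)"
    by blast+
qed

lemma left_coaction_T: "left_coaction iH (T n) = tpow n \<otimes> T n"
  unfolding T_def left_coaction_spec(2) tensor_map_def comult_lift[OF cbilinear_id_iH] by simp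

lemma left_coaction_T_tau: "left_coaction iH (T n * \<tau>) = tpow n \<otimes> (T n * \<tau>)"
proof -
  have "T n * \<tau> = iH (tpow (n - 1)) * dif (iH (tpow 1))"
    using dif_T_1 by (simp add: T_mult' flip: T_def)
  moreover have "left_coaction iH (iH (tpow (n - 1)) * dif (iH (tpow 1)))
      = tpow (n - 1) * tpow 1 \<otimes> iH (tpow (n - 1)) * dif (iH (tpow 1))"
    unfolding left_coaction_spec(3)
    by (subst comult_lift[OF cbilinear_left_coaction_outer], subst comult_lift[OF cbilinear_left_coaction_inner], rule refl)
  ultimately show ?thesis
    by (simp add: tpow_mult)
qed

lemma left_inv_forms_iff: "\<theta> \<in> left_inv_forms iH \<longleftrightarrow> (\<exists>c d. \<theta> = c *\<^sub>C 1 + d *\<^sub>C \<tau>)"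
proof
  assume "\<theta> \<in> left_inv_forms iH"
  then have inv: "left_coaction iH \<theta> = 1 \<otimes> \<theta>" by (simp add: left_inv_forms_def)
  \<comment> \<open>Contract the left leg with the coefficient of t^0. This recovers \<theta> from 1
    \<otimes> \<theta>, while a general form retains only multiples of 1 and
    \<open>\<tau>\<close>.\<close>
  let ?F = "\<lambda>l h. Poly_Mapping.lookup l 0 *\<^sub>C h :: 'h"
  have bil: "cbilinear ?F"
    unfolding cbilinear_def
    by (auto intro!: clinearI simp: lookup_add scaleC_add_left scaleC_add_right lookup_scaleC scaleC_scaleC
        scaleC_complex_def mult.commute)
  note lin = clinear_comp[OF left_coaction_spec(1) clinear_tensor_lift[OF bil]]
  have "\<exists>c d. tensor_lift ?F (left_coaction iH \<theta>) = c *\<^sub>C 1 + d *\<^sub>C \<tau>"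
  proof (induction \<theta> rule: form_induct)
    case zero
    show ?case by (intro exI[of _ 0]) (simp add: clinear_0[OF lin])
  next
    case (T c n)
    show ?case
      by (rule exI[of _ "if n = 0 then c else 0"], rule exI[of _ 0])
        (simp add: clinear_scaleC[OF lin] left_coaction_T tensor_lift_pure[OF bil], simp add: tpow_def lookup_single T_0 scaleC_one)
  next
    case (T_tau c n)
    show ?case
      by (rule exI[of _ 0], rule exI[of _ "if n = 0 then c else 0"])
        (simp add: clinear_scaleC[OF lin] left_coaction_T_tau tensor_lift_pure[OF bil], simp add: tpow_def lookup_single T_0 scaleC_one)
  next
    case (add x y)
    then obtain c d c' d' where "tensor_lift ?F (left_coaction iH x) = c *\<^sub>C 1 + d *\<^sub>C \<tau>"
      "tensor_lift ?F (left_coaction iH y) = c' *\<^sub>C 1 + d' *\<^sub>C \<tau>" by blast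
    then show ?case
      by (intro exI[of _ "c + c'"] exI[of _ "d + d'"]) (simp add: clinear_add[OF lin] scaleC_add_left)
  qed
  then show "\<exists>c d. \<theta> = c *\<^sub>C 1 + d *\<^sub>C \<tau>"
    by (simp add: inv tensor_lift_pure[OF bil] scaleC_one)
next
  assume "\<exists>c d. \<theta> = c *\<^sub>C 1 + d *\<^sub>C \<tau>"
  then show "\<theta> \<in> left_inv_forms iH"
    using left_coaction_T[of 0] left_coaction_T_tau[of 0]
    by (auto simp: left_inv_forms_def clinear_add[OF left_coaction_spec(1)] clinear_scaleC[OF left_coaction_spec(1)]
        T_0 tpow_0 pure_tensor_simps)
qed

text \<open>Projection to degree one deletes the constant summand of a left invariant form.\<close>

lemma left_inv_1_forms_eq: "left_inv_1_forms iH = cspan {\<tau>}"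
proof -
  have "\<theta> = d *\<^sub>C \<tau>" if "\<theta> \<in> forms 1" "\<theta> = c *\<^sub>C 1 + d *\<^sub>C \<tau>" for \<theta> c d
  proof -
    have "hcomp 1 \<theta> = d *\<^sub>C \<tau>"
      by (simp add: that(2) hcomp_add hcomp_scaleC hcomp_forms[OF forms_one] hcomp_forms[OF tau_forms, unfolded One_nat_def])
    then show ?thesis using that(1) by (simp add: forms_def)
  qed
  moreover have "d *\<^sub>C \<tau> = 0 *\<^sub>C 1 + d *\<^sub>C \<tau>" "d *\<^sub>C \<tau> \<in> forms 1" for d
    using tau_forms by (auto simp: forms_def hcomp_scaleC)
  ultimately show ?thesis
    unfolding left_inv_1_forms_def complex_vector.span_singleton
    by (intro equalityI subsetI) (fastforce simp: left_inv_forms_iff, blast intro: left_inv_forms_iff[THEN iffD2])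
qed

lemma ver_forms_eq:
  "ver_forms iH = (tensor_sub UNIV {c *\<^sub>C 1 + \<theta> |c \<theta>. \<theta> \<in> left_inv_1_forms iH} :: ('a::complex_algebra_1, 'h) tensor set)"
proof -
  have "left_inv_forms iH = {c *\<^sub>C 1 + \<theta> |c \<theta>. \<theta> \<in> left_inv_1_forms iH}"
    unfolding left_inv_1_forms_eq complex_vector.span_singleton by (force simp: left_inv_forms_iff)
  then show ?thesis by (simp add: ver_forms_def)
qed

text \<open>On a group-like t^n the outer factors S(h_1) h_4 multiply to 1, so the adjoint coaction
  is trivial, and \<theta> \<mapsto> \<theta> \<otimes> 1 shows that the specification can be
  met.\<close>

lemma adjoint_coaction_left_inv:
  assumes "\<theta> \<in> left_inv_1_forms iH"
  shows "adjoint_coaction iH \<theta> = \<theta> \<otimes> 1"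
proof -
  let ?mc = "\<lambda>h. tensor_lift (\<lambda>h1 h2. iH (antipode h1) * dif (iH h2)) (comult h)"
  let ?ad2 = "\<lambda>h1 h2 l. tensor_lift (\<lambda>h3 h4. iH (antipode h2) * dif (iH h3) \<otimes> antipode h1 * h4) (comult l)"
  let ?ad1 = "\<lambda>h1 k. tensor_lift (\<lambda>h2 l. ?ad2 h1 h2 l) (comult k)"
  let ?ad = "\<lambda>h. tensor_lift (\<lambda>h1 k. ?ad1 h1 k) (comult h)"
  let ?spec = "\<lambda>R. clinear R \<and> (\<forall>h. R (?mc h) = ?ad h)"
  note lin = clinear_antipode iH_linear clinear_dif clinear_comult
  \<comment> \<open>Each nested integrand has to be bilinear before \<open>tensor_lift\<close> can
    be evaluated; the checks go from the innermost one outwards.\<close>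
  have b0: "cbilinear (\<lambda>h1 h2. iH (antipode h1) * dif (iH h2))"
    unfolding cbilinear_def by (auto intro!: clinearI simp: lin[THEN clinear_add] lin[THEN clinear_scaleC] algebra_simps mult_scaleC_left mult_scaleC_right)
  have b3: "cbilinear (\<lambda>h3 h4. iH (antipode h2) * dif (iH h3) \<otimes> antipode h1 * h4)" for h1 h2
    unfolding cbilinear_def by (auto intro!: clinearI simp: lin[THEN clinear_add] lin[THEN clinear_scaleC] algebra_simps mult_scaleC_left mult_scaleC_right pure_tensor_simps)
  have b2: "cbilinear (\<lambda>h2 l. ?ad2 h1 h2 l)" for h1
    unfolding cbilinear_def
  proof (intro conjI allI)
    show "clinear (\<lambda>l. ?ad2 h1 h2 l)" for h2
      by (rule clinear_comp[OF clinear_comult clinear_tensor_lift[OF b3]])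
    show "clinear (\<lambda>h2. ?ad2 h1 h2 l)" for l
      by (rule clinear_tensor_lift_fun, rule clinearI) (auto simp: lin[THEN clinear_add] lin[THEN clinear_scaleC] algebra_simps mult_scaleC_left mult_scaleC_right pure_tensor_simps)
  qed
  have b1: "cbilinear (\<lambda>h1 k. ?ad1 h1 k)"
    unfolding cbilinear_def
  proof (intro conjI allI)
    show "clinear (\<lambda>k. ?ad1 h1 k)" for h1
      by (rule clinear_comp[OF clinear_comult clinear_tensor_lift[OF b2]])
    show "clinear (\<lambda>h1. ?ad1 h1 k)" for k
      by (rule clinear_tensor_lift_fun, rule clinear_tensor_lift_fun, rule clinearI) (auto simp: lin[THEN clinear_add] lin[THEN clinear_scaleC] algebra_simps mult_scaleC_left mult_scaleC_right pure_tensor_simps)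
  qed
  have lmc: "clinear ?mc" and lad: "clinear ?ad"
    using clinear_comp[OF clinear_comult clinear_tensor_lift[OF b0]] clinear_comp[OF clinear_comult clinear_tensor_lift[OF b1]] .
  have mc: "?mc (tpow n) = T (- n) * dif (T n)" for n
    by (simp add: comult_lift[OF b0] antipode_tpow T_def)
  have ad: "?ad (tpow n) = T (- n) * dif (T n) \<otimes> 1" for n
    by (subst comult_lift[OF b1], subst comult_lift[OF b2], subst comult_lift[OF b3])
      (simp add: antipode_tpow tpow_mult tpow_0 T_def)
  have "?spec (\<lambda>\<omega>. \<omega> \<otimes> 1)"
  proof (intro conjI allI)
    show l1: "clinear (\<lambda>\<omega>. \<omega> \<otimes> 1)"
      by (rule clinear_pure_left[OF complex_vector.linear_ident])
    show "?mc h \<otimes> 1 = ?ad h" for h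
    proof (induction h rule: laurent_induct)
      case zero
      show ?case unfolding clinear_0[OF lmc] clinear_0[OF lad] by (rule clinear_0[OF l1])
    next
      case (tpow c n)
      show ?case
        unfolding clinear_scaleC[OF lmc] clinear_scaleC[OF lad] pure_tensor_simps mc ad ..
    next
      case (add g h)
      show ?case
        unfolding clinear_add[OF lmc] clinear_add[OF lad] pure_tensor_simps add ..
    qed
  qed
  then have spec: "?spec (adjoint_coaction iH)"
    unfolding adjoint_coaction_def by (rule someI[of ?spec])
  \<comment> \<open>For h = t the form S(h_1) dh_2 is \<open>\<tau>\<close> itself.\<close>
  then have "adjoint_coaction iH (?mc (tpow 1)) = ?ad (tpow 1)"
    by blast
  then have "adjoint_coaction iH \<tau> = \<tau> \<otimes> 1"
    unfolding mc ad by (simp add: \<tau>_def)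
  moreover obtain c where "\<theta> = c *\<^sub>C \<tau>"
    using assms by (auto simp: left_inv_1_forms_eq complex_vector.span_singleton)
  ultimately show ?thesis
    using spec by (simp add: clinear_scaleC pure_tensor_simps)
qed

end


section \<open>Weights on quantum \<open>SL\<^sub>2\<close>\<close>

locale quantum_hopf_fibration = laurent_calculus q iH
  for q and iH :: "laurent \<Rightarrow> 'h::dga" +
  fixes x :: "sl2_gen \<Rightarrow> 'a::complex_algebra_1" and iA :: "'a \<Rightarrow> 'w::dga"
    and \<Delta> :: "'a \<Rightarrow> ('a, laurent) tensor"
  assumes presentation: "presented_by x (SL2_relators q)"
    and coaction: "SL2_coaction x \<Delta>"
    and SL2_calculus: "SL2_calculus q x iA"
begin

abbreviation \<alpha> where "\<alpha> \<equiv> x Alpha"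
abbreviation \<beta> where "\<beta> \<equiv> x Beta"
abbreviation \<gamma> where "\<gamma> \<equiv> x Gamma"
abbreviation \<delta> where "\<delta> \<equiv> x Delta"
abbreviation ep where "ep \<equiv> SL2_e_plus q x iA"
abbreviation em where "em \<equiv> SL2_e_minus q x iA"
abbreviation e0 where "e0 \<equiv> SL2_e_zero q x iA"

lemma relations:
  "\<beta> * \<alpha> = q *\<^sub>C (\<alpha> * \<beta>)" "\<gamma> * \<alpha> = q *\<^sub>C (\<alpha> * \<gamma>)"
  "\<delta> * \<beta> = q *\<^sub>C (\<beta> * \<delta>)" "\<delta> * \<gamma> = q *\<^sub>C (\<gamma> * \<delta>)" "\<gamma> * \<beta> = \<beta> * \<gamma>"
  "\<alpha> * \<delta> = 1 + q powi (- 1) *\<^sub>C (\<beta> * \<gamma>)" "\<delta> * \<alpha> = 1 + q *\<^sub>C (\<beta> * \<gamma>)"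
proof -
  have "\<forall>r\<in>SL2_relators q. free_eval x r = 0"
    using presented_by_relator[OF presentation] by blast
  note * = this[unfolded SL2_relators_def Let_def, simplified ball_simps alg_homD[OF alg_hom_free_eval] clinear_diff[OF alg_homD(1)[OF alg_hom_free_eval]]
      clinear_scaleC[OF alg_homD(1)[OF alg_hom_free_eval]] free_eval_gen]
  show 1: "\<beta> * \<alpha> = q *\<^sub>C (\<alpha> * \<beta>)" "\<gamma> * \<alpha> = q *\<^sub>C (\<alpha> * \<gamma>)"
    "\<delta> * \<beta> = q *\<^sub>C (\<beta> * \<delta>)" "\<delta> * \<gamma> = q *\<^sub>C (\<gamma> * \<delta>)" "\<gamma> * \<beta> = \<beta> * \<gamma>"
    and 2: "\<alpha> * \<delta> = 1 + q powi (- 1) *\<^sub>C (\<beta> * \<gamma>)"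
    using * by (simp_all add: diff_eq_eq)
  \<comment> \<open>The coefficients 1/q and q - 1/q of \<beta>\<gamma> add up to q: this is the
    second quantum determinant relation.\<close>
  have "\<delta> * \<alpha> = \<alpha> * \<delta> + (q - q powi (- 1)) *\<^sub>C (\<beta> * \<gamma>)"
    using * by (simp add: diff_eq_eq add.commute)
  then show "\<delta> * \<alpha> = 1 + q *\<^sub>C (\<beta> * \<gamma>)"
    by (simp add: 2 complex_vector.scale_left_diff_distrib)
qed

lemma iA_calculus: "diff_calculus iA"
  and bases: "left_basis iA 1 [ep, em, e0]" "left_basis iA 2 [ep * e0, em * e0, ep * em]"
    "left_basis iA 3 [ep * em * e0]"
  and forms_gt_3: "k > 3 \<Longrightarrow> forms k = ({0} :: 'w set)"
  and e_gen: "ep * iA (x f) = q powi sl2_deg f *\<^sub>C (iA (x f) * ep)"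
    "em * iA (x f) = q powi sl2_deg f *\<^sub>C (iA (x f) * em)"
    "e0 * iA (x f) = q powi (2 * sl2_deg f) *\<^sub>C (iA (x f) * e0)"
  and dif_gen: "dif (iA \<alpha>) = iA \<alpha> * e0 + q *\<^sub>C (iA \<beta> * ep)"
    "dif (iA \<gamma>) = iA \<gamma> * e0 + q *\<^sub>C (iA \<delta> * ep)"
    "dif (iA \<beta>) = iA \<alpha> * em - q powi (- 2) *\<^sub>C (iA \<beta> * e0)"
    "dif (iA \<delta>) = iA \<gamma> * em - q powi (- 2) *\<^sub>C (iA \<delta> * e0)"
  and e_relations: "ep * em = - (q powi (- 2) *\<^sub>C (em * ep))" "ep * e0 = - (q powi (- 4) *\<^sub>C (e0 * ep))"
    "em * e0 = - (q powi 4 *\<^sub>C (e0 * em))" "ep * ep = 0" "em * em = 0" "e0 * e0 = 0"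
  and dif_e: "dif e0 = q ^ 3 *\<^sub>C (ep * em)"
    "dif ep = - ((q powi 2 * (1 + q powi (- 2))) *\<^sub>C (ep * e0))"
    "dif em = (q powi (- 2) * (1 + q powi (- 2))) *\<^sub>C (em * e0)"
  using SL2_calculus unfolding SL2_calculus_def Let_def by blast+

lemmas e_normal_form = exterior_normal_form[OF q_nonzero e_relations] e_relations(4-6)

lemma iA_hom: "alg_hom iA" and iA_range: "range iA = forms 0"
  using iA_calculus by (auto simp: diff_calculus_def)

lemmas iA_linear = alg_homD(1)[OF iA_hom]
lemmas iA_mult = alg_homD(3)[OF iA_hom]
lemmas iA_1 = alg_homD(2)[OF iA_hom]

lemma iA_mult': "iA a * (iA b * \<omega>) = iA (a * b) * \<omega>"
  by (simp add: iA_mult mult.assoc)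

lemma iA_forms: "iA a \<in> forms 0"
  using iA_range by blast

lemma e_forms: "ep \<in> forms 1" "em \<in> forms 1" "e0 \<in> forms 1"
  using bases(1) by (simp_all add: left_basis_def)

lemma coaction_linear: "clinear \<Delta>" and coaction_1: "\<Delta> 1 = 1 \<otimes> 1"
  and coaction_mult: "\<Delta> (a * b) = tensor_alg_mult (\<Delta> a) (\<Delta> b)"
  and coaction_gen: "\<Delta> (x f) = x f \<otimes> tpow (sl2_deg f)"
  using coaction by (auto simp: SL2_coaction_def)

text \<open>Homogeneity for the coaction, bundled with the commutation rules past the three basis
  1-forms. All these conditions are multiplicative and known on generators, so they can be carried
  together.\<close>

definition wt :: "int \<Rightarrow> 'a \<Rightarrow> bool"
  where "wt n a \<longleftrightarrow> \<Delta> a = a \<otimes> tpow n \<and> ep * iA a = q powi n *\<^sub>C (iA a * ep) \<and>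
    em * iA a = q powi n *\<^sub>C (iA a * em) \<and> e0 * iA a = q powi (2 * n) *\<^sub>C (iA a * e0)"

lemma wtD:
  assumes "wt n a"
  shows "\<Delta> a = a \<otimes> tpow n" "ep * iA a = q powi n *\<^sub>C (iA a * ep)"
    "em * iA a = q powi n *\<^sub>C (iA a * em)" "e0 * iA a = q powi (2 * n) *\<^sub>C (iA a * e0)"
  using assms by (simp_all add: wt_def)

lemma wt_1: "wt 0 1"
  by (simp add: wt_def coaction_1 tpow_0 iA_1 scaleC_one)

lemma wt_gen: "wt (sl2_deg f) (x f)"
  by (simp add: wt_def coaction_gen e_gen)

lemma wt_scaleC: "wt n a \<Longrightarrow> wt n (c *\<^sub>C a)"
  by (simp add: wt_def clinear_scaleC[OF coaction_linear] clinear_scaleC[OF iA_linear] pure_tensor_simps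
      mult_scaleC_left mult_scaleC_right scaleC_scaleC mult.commute)

lemma q_powi_mult: "q powi m * q powi n = q powi (m + n)"
  using q_nonzero by (simp add: power_int_add)

lemma wt_mult:
  assumes "wt m a" "wt n b"
  shows "wt (m + n) (a * b)"
proof -
  have "e * iA (a * b) = (c * d) *\<^sub>C (iA (a * b) * e)"
    if "e * iA a = c *\<^sub>C (iA a * e)" "e * iA b = d *\<^sub>C (iA b * e)" for e c d
  proof -
    have "e * iA (a * b) = (e * iA a) * iA b" by (simp add: iA_mult mult.assoc)
    also have "\<dots> = (c * d) *\<^sub>C (iA (a * b) * e)"
      by (simp add: that mult.assoc mult_scaleC_left mult_scaleC_right scaleC_scaleC iA_mult)
    finally show ?thesis .
  qed
  from this[OF wtD(2)[OF assms(1)] wtD(2)[OF assms(2)]] this[OF wtD(3)[OF assms(1)] wtD(3)[OF assms(2)]]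
    this[OF wtD(4)[OF assms(1)] wtD(4)[OF assms(2)]]
  show ?thesis
    by (simp add: wt_def coaction_mult wtD(1)[OF assms(1)] wtD(1)[OF assms(2)] tensor_alg_mult_pure tpow_mult
        q_powi_mult distrib_left)
qed

lemma wt_word: "\<exists>n. wt n (prod_list (map x ws))"
  by (induction ws) (auto intro: wt_1 wt_mult wt_gen)

text \<open>Words in the generators are homogeneous, scalar multiples stay homogeneous, and together
  they span A.\<close>

lemma weight_induct [case_names wt add]:
  assumes "\<And>n a. wt n a \<Longrightarrow> P a" "\<And>a b. P a \<Longrightarrow> P b \<Longrightarrow> P (a + b)"
  shows "P a"
  using presentation
proof (induction a rule: presented_by_induct)
  case (word c ws)
  show ?case using wt_word assms(1) wt_scaleC by blast
qed (rule assms(2))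

lemma wt_gens: "wt 1 \<alpha>" "wt (- 1) \<beta>" "wt 1 \<gamma>" "wt (- 1) \<delta>"
  using wt_gen[of Alpha] wt_gen[of Beta] wt_gen[of Gamma] wt_gen[of Delta] by simp_all

section \<open>Images of degree zero and of the basis 1-forms\<close>

definition \<Delta>\<^sub>0 :: "'a \<Rightarrow> ('w, 'h) tensor"
  where "\<Delta>\<^sub>0 a = tensor_map iA iH (\<Delta> a)"

lemma cbilinear_iA_iH: "cbilinear (\<lambda>x y. iA x \<otimes> iH y)"
  unfolding cbilinear_def
  by (auto intro!: clinearI simp: clinear_add[OF iA_linear] clinear_scaleC[OF iA_linear] iH_map_linear bilinear_simps)

lemma \<Delta>\<^sub>0_linear: "clinear \<Delta>\<^sub>0"
  unfolding \<Delta>\<^sub>0_def tensor_map_def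
  by (rule clinear_comp[OF coaction_linear clinear_tensor_lift[OF cbilinear_iA_iH]])

lemma \<Delta>\<^sub>0_wt: "wt n a \<Longrightarrow> \<Delta>\<^sub>0 a = iA a \<otimes> T n"
  by (simp add: \<Delta>\<^sub>0_def wtD(1) tensor_map_def tensor_lift_pure[OF cbilinear_iA_iH] T_def)

lemma \<Delta>\<^sub>0_1: "\<Delta>\<^sub>0 1 = 1"
  by (simp add: \<Delta>\<^sub>0_wt[OF wt_1] iA_1 T_0 one_tensor_def)

lemma \<Delta>\<^sub>0_mult: "\<Delta>\<^sub>0 (a * b) = \<Delta>\<^sub>0 a * \<Delta>\<^sub>0 b"
proof (induction a rule: weight_induct)
  case (wt m a)
  show ?case
  proof (induction b rule: weight_induct)
    case (wt n b)
    show ?case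
      by (simp add: \<Delta>\<^sub>0_wt[OF wt_mult[OF \<open>wt m a\<close> wt]] \<Delta>\<^sub>0_wt[OF \<open>wt m a\<close>] \<Delta>\<^sub>0_wt[OF wt]
          tensor_times_degree_0_left[OF T_forms] iA_mult T_mult)
  qed (simp add: distrib_left clinear_add[OF \<Delta>\<^sub>0_linear])
qed (simp add: distrib_right clinear_add[OF \<Delta>\<^sub>0_linear])

text \<open>Prospective images of \<open>ep\<close>, \<open>em\<close>, \<open>e0\<close>. The
  powers of t are the weights 2, -2 and 0 of the defining expressions; for \<open>e0\<close> the
  differential on the H leg contributes the summand with \<open>\<tau>\<close>.\<close>

definition g\<^sub>p :: "('w, 'h) tensor" where "g\<^sub>p = ep \<otimes> T 2"
definition g\<^sub>m :: "('w, 'h) tensor" where "g\<^sub>m = em \<otimes> T (- 2)"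
definition g\<^sub>0 :: "('w, 'h) tensor" where "g\<^sub>0 = e0 \<otimes> 1 + 1 \<otimes> \<tau>"

lemmas tensor_products =
  tensor_times_degree_0_left[OF T_forms] tensor_times_degree_0_left[OF forms_one]
  tensor_times_degree_0_right[OF iA_forms] tensor_times_degree_0_right[OF forms_one]
  tensor_times_degree_1[OF tau_forms e_forms(1)] tensor_times_degree_1[OF tau_forms e_forms(2)]
  tensor_times_degree_1[OF tau_forms e_forms(3)]

lemma q_powi_cancel: "q powi (- 2) * q ^ 2 = 1" "q powi (- 4) * q ^ 4 = 1" "q ^ 4 * q powi (- 4) = 1"
  using q_nonzero by (simp_all add: power_int_minus)

text \<open>Moving \<open>\<tau>\<close> past t^2 or t^(-2) gives the factor q^4 or q^(-4), which
  matches the relations of \<open>e0\<close> with \<open>ep\<close> and \<open>em\<close>. In the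
  square of \<open>g\<^sub>0\<close> the mixed terms cancel by the graded sign.\<close>

lemma g_relations: "g\<^sub>p * g\<^sub>m = - (q powi (- 2) *\<^sub>C (g\<^sub>m * g\<^sub>p))" "g\<^sub>p * g\<^sub>0 = - (q powi (- 4) *\<^sub>C (g\<^sub>0 * g\<^sub>p))"
    "g\<^sub>m * g\<^sub>0 = - (q powi 4 *\<^sub>C (g\<^sub>0 * g\<^sub>m))" "g\<^sub>p * g\<^sub>p = 0" "g\<^sub>m * g\<^sub>m = 0" "g\<^sub>0 * g\<^sub>0 = 0"
  by (simp_all add: g\<^sub>p_def g\<^sub>m_def g\<^sub>0_def tensor_products T_mult distrib_left distrib_right e_normal_form
      tau_T tau_tau pure_tensor_simps pure_tensor_uminus scaleC_add_right scaleC_scaleC scaleC_one q_powi_cancel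
      complex_vector.scale_right_diff_distrib)

lemmas g_normal_form = exterior_normal_form[OF q_nonzero g_relations] g_relations(4-6)

text \<open>For \<open>g\<^sub>0\<close> both summands give the same factor: \<open>e0\<close> past
  weight n, and \<open>\<tau>\<close> past t^n, each produce q^(2n).\<close>

lemma g_wt:
  assumes "wt n a"
  shows "g\<^sub>p * \<Delta>\<^sub>0 a = q powi n *\<^sub>C (\<Delta>\<^sub>0 a * g\<^sub>p)" "g\<^sub>m * \<Delta>\<^sub>0 a = q powi n *\<^sub>C (\<Delta>\<^sub>0 a * g\<^sub>m)"
    "g\<^sub>0 * \<Delta>\<^sub>0 a = q powi (2 * n) *\<^sub>C (\<Delta>\<^sub>0 a * g\<^sub>0)"
  by (simp_all add: g\<^sub>p_def g\<^sub>m_def g\<^sub>0_def \<Delta>\<^sub>0_wt[OF assms] tensor_products T_mult wtD[OF assms] distrib_left distrib_right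
      tau_T pure_tensor_simps add.commute scaleC_add_right)

section \<open>A left basis of all forms\<close>

definition es :: "'w list"
  where "es = [1, ep, em, e0, ep * e0, em * e0, ep * em, ep * (em * e0)]"

text \<open>Listed in the same order as \<open>es\<close>. In both lists the zero component stands
  rightmost in every product, which later lets it be split off.\<close>

definition gs :: "('w, 'h) tensor list"
  where "gs = [1, g\<^sub>p, g\<^sub>m, g\<^sub>0, g\<^sub>p * g\<^sub>0, g\<^sub>m * g\<^sub>0, g\<^sub>p * g\<^sub>m, g\<^sub>p * (g\<^sub>m * g\<^sub>0)]"

text \<open>Add the extensions from degrees 0 to 3; each vanishes on the basis forms of the other
  degrees.\<close>

lemma extend_es:
  fixes f :: "nat \<Rightarrow> 'a \<Rightarrow> 'v::complex_vector"
  assumes f: "\<And>j. clinear (f j)"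
  obtains F where "clinear F" "\<And>a j. j < 8 \<Longrightarrow> F (iA a * es ! j) = f j a"
proof -
  have range: "range iA \<subseteq> forms 0" using iA_range by simp
  note ext = left_basis_extend[OF iA_linear range, where ?'v = 'v]
  obtain F0 where F0: "clinear F0" "\<And>a. F0 (iA a) = f 0 a" "\<And>\<omega> m. \<omega> \<in> forms m \<Longrightarrow> m \<noteq> 0 \<Longrightarrow> F0 \<omega> = 0"
    by (rule ext[OF left_basis_degree_0[OF iA_calculus], where f = f, OF f]) auto
  obtain F1 where F1: "clinear F1" "\<And>a. F1 (iA a * ep) = f 1 a" "\<And>a. F1 (iA a * em) = f 2 a" "\<And>a. F1 (iA a * e0) = f 3 a"
    "\<And>\<omega> m. \<omega> \<in> forms m \<Longrightarrow> m \<noteq> 1 \<Longrightarrow> F1 \<omega> = 0"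
  \<comment> \<open>Position 0 of \<open>es\<close> is taken by the unit, so the basis 1-forms begin
    at 1 and, in the next block, the basis 2-forms at 4.\<close>
  proof (rule ext[OF bases(1), where f = "\<lambda>j. f (j + 1)", OF f])
    fix F :: "'w \<Rightarrow> 'v"
    assume F: "clinear F" "\<And>a j. j < length [ep, em, e0] \<Longrightarrow> F (iA a * [ep, em, e0] ! j) = f (j + 1) a"
      "\<And>\<omega> m. \<omega> \<in> forms m \<Longrightarrow> m \<noteq> 1 \<Longrightarrow> F \<omega> = 0"
    show thesis
      by (rule that[of F]) (use F(1) F(2)[of 0] F(2)[of 1] F(2)[of 2] F(3) in \<open>simp_all add: numeral_eq_Suc\<close>)
  qed
  obtain F2 where F2: "clinear F2" "\<And>a. F2 (iA a * (ep * e0)) = f 4 a" "\<And>a. F2 (iA a * (em * e0)) = f 5 a"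
    "\<And>a. F2 (iA a * (ep * em)) = f 6 a" "\<And>\<omega> m. \<omega> \<in> forms m \<Longrightarrow> m \<noteq> 2 \<Longrightarrow> F2 \<omega> = 0"
  proof (rule ext[OF bases(2), where f = "\<lambda>j. f (j + 4)", OF f])
    fix F :: "'w \<Rightarrow> 'v"
    assume F: "clinear F" "\<And>a j. j < length [ep * e0, em * e0, ep * em] \<Longrightarrow> F (iA a * [ep * e0, em * e0, ep * em] ! j) = f (j + 4) a"
      "\<And>\<omega> m. \<omega> \<in> forms m \<Longrightarrow> m \<noteq> 2 \<Longrightarrow> F \<omega> = 0"
    show thesis
      by (rule that[of F]) (use F(1) F(2)[of 0] F(2)[of 1] F(2)[of 2] F(3) in \<open>simp_all add: numeral_eq_Suc\<close>)
  qed
  obtain F3 where F3: "clinear F3" "\<And>a. F3 (iA a * (ep * (em * e0))) = f 7 a" "\<And>\<omega> m. \<omega> \<in> forms m \<Longrightarrow> m \<noteq> 3 \<Longrightarrow> F3 \<omega> = 0"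
    by (rule ext[OF bases(3), where f = "\<lambda>_. f 7", OF f]) (auto simp: mult.assoc)
  have deg: "iA a * e \<in> forms k" if "e \<in> forms k" for a e k
    using forms_mult[OF iA_forms that] by simp
  have deg2: "e * e' \<in> forms 2" if "e \<in> forms 1" "e' \<in> forms 1" for e e' :: 'w
    using forms_mult[OF that] by (simp add: numeral_2_eq_2)
  have deg3: "ep * (em * e0) \<in> forms 3"
    using forms_mult[OF e_forms(1) deg2[OF e_forms(2,3)]] by (simp add: numeral_eq_Suc)
  note zero1 = F0(3)[OF deg] F2(5)[OF deg] F3(3)[OF deg]
  note zero2 = F0(3)[OF deg[OF deg2]] F1(5)[OF deg[OF deg2]] F3(3)[OF deg[OF deg2]]
  show ?thesis
  proof (rule that[of "\<lambda>\<omega>. F0 \<omega> + F1 \<omega> + F2 \<omega> + F3 \<omega>"])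
    show "clinear (\<lambda>\<omega>. F0 \<omega> + F1 \<omega> + F2 \<omega> + F3 \<omega>)"
      by (intro clinear_add_fun F0(1) F1(1) F2(1) F3(1))
    fix a and j :: nat assume "j < 8"
    then consider "j = 0" | "j = 1" | "j = 2" | "j = 3" | "j = 4" | "j = 5" | "j = 6" | "j = 7"
      by linarith
    then show "F0 (iA a * es ! j) + F1 (iA a * es ! j) + F2 (iA a * es ! j) + F3 (iA a * es ! j) = f j a"
    proof cases
      case 1
      then show ?thesis
        using F1(5)[OF iA_forms] F2(5)[OF iA_forms] F3(3)[OF iA_forms] by (simp add: es_def F0(2))
    next
      case 2
      then show ?thesis using zero1[OF e_forms(1)] by (simp add: es_def F1)
    next
      case 3
      then show ?thesis using zero1[OF e_forms(2)] by (simp add: es_def F1)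
    next
      case 4
      then show ?thesis using zero1[OF e_forms(3)] by (simp add: es_def F1)
    next
      case 5
      then show ?thesis using zero2[OF e_forms(1) e_forms(3)] by (simp add: es_def F2)
    next
      case 6
      then show ?thesis using zero2[OF e_forms(2) e_forms(3)] by (simp add: es_def F2)
    next
      case 7
      then show ?thesis using zero2[OF e_forms(1) e_forms(2)] by (simp add: es_def F2)
    next
      case 8
      then show ?thesis
        using F0(3)[OF deg[OF deg3]] F1(5)[OF deg[OF deg3]] F2(5)[OF deg[OF deg3]] by (simp add: es_def F3)
    qed
  qed
qed

lemma form_basis_induct [case_names zero basis add]:
  assumes zero: "P 0" and basis: "\<And>a e. e \<in> set es \<Longrightarrow> P (iA a * e)"
    and add: "\<And>\<omega> \<eta>. P \<omega> \<Longrightarrow> P \<eta> \<Longrightarrow> P (\<omega> + \<eta>)"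
  shows "P (\<omega> :: 'w)"
proof (induction \<omega> rule: dga_induct)
  case (homogeneous k \<omega>)
  have range: "range iA \<subseteq> forms 0" using iA_range by simp
  have *: "P \<omega>" if "left_basis iA k bs" "set bs \<subseteq> set es" for bs
  proof (rule left_basis_induct[OF iA_linear range that(1) homogeneous])
    show "P (iA a * bs ! j)" if "j < length bs" for a j
      using basis nth_mem[OF that] \<open>set bs \<subseteq> set es\<close> by blast
  qed (use zero add in auto)
  consider "k = 0" | "k = 1" | "k = 2" | "k = 3" | "k > 3" by linarith
  then show ?case
  proof cases
    case 1
    show ?thesis by (rule *[of "[1]"]) (simp_all add: 1 left_basis_degree_0[OF iA_calculus] es_def)
  next
    case 2
    show ?thesis by (rule *[of "[ep, em, e0]"]) (use bases(1) in \<open>simp_all add: 2 es_def\<close>)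
  next
    case 3
    show ?thesis by (rule *[of "[ep * e0, em * e0, ep * em]"]) (use bases(2) in \<open>simp_all add: 3 es_def\<close>)
  next
    case 4
    show ?thesis by (rule *[of "[ep * em * e0]"]) (use bases(3) in \<open>simp_all add: 4 es_def mult.assoc\<close>)
  next
    case 5
    then show ?thesis using homogeneous forms_gt_3 zero by auto
  qed
qed (simp_all add: zero add)


subsection \<open>The extended coaction\<close>

text \<open>Left linear along \<open>\<Delta>\<^sub>0\<close> by construction; that it respects
  right multiplication, grading and differential has to be proved.\<close>

definition \<Phi> :: "'w \<Rightarrow> ('w, 'h) tensor"
  where "\<Phi> = (SOME F. clinear F \<and> (\<forall>a. \<forall>j<8. F (iA a * es ! j) = \<Delta>\<^sub>0 a * gs ! j))"

lemma \<Phi>_linear: "clinear \<Phi>"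
  and \<Phi>_basis: "j < 8 \<Longrightarrow> \<Phi> (iA a * es ! j) = \<Delta>\<^sub>0 a * gs ! j"
proof -
  have "clinear (\<lambda>a. \<Delta>\<^sub>0 a * gs ! j)" for j
    by (rule clinear_comp[OF \<Delta>\<^sub>0_linear clinear_mult_right])
  then obtain F where "clinear F" "\<And>a j. j < 8 \<Longrightarrow> F (iA a * es ! j) = \<Delta>\<^sub>0 a * gs ! j"
    using extend_es[where f = "\<lambda>j a. \<Delta>\<^sub>0 a * gs ! j"] by blast
  then have "\<exists>F. clinear F \<and> (\<forall>a. \<forall>j<8. F (iA a * es ! j) = \<Delta>\<^sub>0 a * gs ! j)"
    by blast
  from someI_ex[OF this] show "clinear \<Phi>" "j < 8 \<Longrightarrow> \<Phi> (iA a * es ! j) = \<Delta>\<^sub>0 a * gs ! j"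
    unfolding \<Phi>_def by blast+
qed

lemmas \<Phi>_lin = clinear_0[OF \<Phi>_linear] clinear_add[OF \<Phi>_linear] clinear_diff[OF \<Phi>_linear]
  clinear_uminus[OF \<Phi>_linear] clinear_scaleC[OF \<Phi>_linear]

lemma \<Phi>_es: "j < 8 \<Longrightarrow> \<Phi> (es ! j) = gs ! j"
  using \<Phi>_basis[of j 1] by (simp add: iA_1 \<Delta>\<^sub>0_1)

lemma \<Phi>_e:
  "\<Phi> 1 = 1" "\<Phi> ep = g\<^sub>p" "\<Phi> em = g\<^sub>m" "\<Phi> e0 = g\<^sub>0" "\<Phi> (ep * e0) = g\<^sub>p * g\<^sub>0" "\<Phi> (em * e0) = g\<^sub>m * g\<^sub>0"
  "\<Phi> (ep * em) = g\<^sub>p * g\<^sub>m" "\<Phi> (ep * (em * e0)) = g\<^sub>p * (g\<^sub>m * g\<^sub>0)"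
  using \<Phi>_es[of 0] \<Phi>_es[of 1] \<Phi>_es[of 2] \<Phi>_es[of 3] \<Phi>_es[of 4] \<Phi>_es[of 5] \<Phi>_es[of 6] \<Phi>_es[of 7]
  by (simp_all add: es_def gs_def)

lemma \<Phi>_iA_es:
  assumes "e \<in> set es"
  shows "\<Phi> (iA a * e) = \<Delta>\<^sub>0 a * \<Phi> e"
proof -
  obtain j where "j < length es" "e = es ! j"
    using assms by (metis in_set_conv_nth)
  then have "j < 8" "e = es ! j" by (simp_all add: es_def)
  then show ?thesis by (simp add: \<Phi>_basis \<Phi>_es)
qed

lemma \<Phi>_iA: "\<Phi> (iA a) = \<Delta>\<^sub>0 a"
  using \<Phi>_iA_es[of 1 a] by (simp add: es_def \<Phi>_e)

lemma \<Phi>_iA_mult: "\<Phi> (iA a * \<omega>) = \<Phi> (iA a) * \<Phi> \<omega>"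
proof (induction \<omega> rule: form_basis_induct)
  case (basis b e)
  then show ?case
    by (simp add: iA_mult' \<Phi>_iA_es \<Phi>_iA \<Delta>\<^sub>0_mult mult.assoc)
qed (simp_all add: \<Phi>_lin distrib_left)

text \<open>Moving the generator past a homogeneous coefficient costs the same scalar before and
  after applying \<Phi>, so only its products with basis forms remain to be compared.\<close>

lemma \<Phi>_e_mult_aux:
  assumes comm: "\<And>n a. wt n a \<Longrightarrow> e * iA a = c n *\<^sub>C (iA a * e)" "\<And>n a. wt n a \<Longrightarrow> g * \<Delta>\<^sub>0 a = c n *\<^sub>C (\<Delta>\<^sub>0 a * g)"
    and es: "\<And>e'. e' \<in> set es \<Longrightarrow> \<Phi> (e * e') = g * \<Phi> e'"
  shows "\<Phi> (e * \<omega>) = g * \<Phi> \<omega>"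
proof (induction \<omega> rule: form_basis_induct)
  case (basis a e')
  show ?case
  proof (induction a rule: weight_induct)
    case (wt n a)
    have "e * (iA a * e') = c n *\<^sub>C (iA a * (e * e'))"
      by (simp add: comm(1)[OF wt] mult_scaleC_left mult.assoc flip: mult.assoc[of e])
    then have "\<Phi> (e * (iA a * e')) = c n *\<^sub>C (\<Delta>\<^sub>0 a * (g * \<Phi> e'))"
      by (simp add: \<Phi>_lin \<Phi>_iA_mult \<Phi>_iA es[OF basis])
    also have "\<dots> = (g * \<Delta>\<^sub>0 a) * \<Phi> e'"
      by (simp add: comm(2)[OF wt] mult_scaleC_left mult.assoc)
    finally show ?case
      by (simp add: \<Phi>_iA_es[OF basis] mult.assoc)
  qed (simp add: clinear_add[OF iA_linear] distrib_left distrib_right \<Phi>_lin)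
qed (simp_all add: \<Phi>_lin distrib_left)

text \<open>For the 24 products of a basis 1-form with an element of \<open>es\<close>, both sides
  reduce to the same normal form, since the two families obey identical relations.\<close>

lemma \<Phi>_e_mult: "\<Phi> (ep * \<omega>) = \<Phi> ep * \<Phi> \<omega>" "\<Phi> (em * \<omega>) = \<Phi> em * \<Phi> \<omega>" "\<Phi> (e0 * \<omega>) = \<Phi> e0 * \<Phi> \<omega>"
proof -
  have set_es: "P e" if "e \<in> set es" "P 1" "P ep" "P em" "P e0" "P (ep * e0)" "P (em * e0)" "P (ep * em)" "P (ep * (em * e0))" for P e
    using that by (auto simp: es_def)
  note s = e_normal_form g_normal_form \<Phi>_e \<Phi>_lin mult_scaleC_left mult_scaleC_right
  have "\<Phi> (ep * e') = g\<^sub>p * \<Phi> e'" "\<Phi> (em * e') = g\<^sub>m * \<Phi> e'" "\<Phi> (e0 * e') = g\<^sub>0 * \<Phi> e'" if "e' \<in> set es" for e'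
    by (rule set_es[OF that]; simp add: s)+
  from \<Phi>_e_mult_aux[OF wtD(2) g_wt(1) this(1)] \<Phi>_e_mult_aux[OF wtD(3) g_wt(2) this(2)]
    \<Phi>_e_mult_aux[OF wtD(4) g_wt(3) this(3)]
  show "\<Phi> (ep * \<omega>) = \<Phi> ep * \<Phi> \<omega>" "\<Phi> (em * \<omega>) = \<Phi> em * \<Phi> \<omega>" "\<Phi> (e0 * \<omega>) = \<Phi> e0 * \<Phi> \<omega>"
    by (simp_all add: \<Phi>_e)
qed

lemma \<Phi>_mult: "\<Phi> (\<omega> * \<eta>) = \<Phi> \<omega> * \<Phi> \<eta>"
proof (induction \<omega> rule: form_basis_induct)
  case (basis a e)
  then have "\<Phi> (e * \<eta>) = \<Phi> e * \<Phi> \<eta>"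
    by (auto simp: es_def \<Phi>_e_mult mult.assoc \<Phi>_e(1))
  then show ?case by (simp add: mult.assoc \<Phi>_iA_mult)
qed (simp_all add: \<Phi>_lin distrib_right)

lemma \<Delta>\<^sub>0_forms: "\<Delta>\<^sub>0 a \<in> forms 0"
proof (induction a rule: weight_induct)
  case (wt n a)
  show ?case
    by (simp add: \<Delta>\<^sub>0_wt[OF wt] forms_def tensor_hcomp_homogeneous[OF iA_forms T_forms])
qed (auto simp: clinear_add[OF \<Delta>\<^sub>0_linear] forms_def hcomp_add)

lemma g_forms: "g\<^sub>p \<in> forms 1" "g\<^sub>m \<in> forms 1" "g\<^sub>0 \<in> forms 1"
  by (simp_all add: g\<^sub>p_def g\<^sub>m_def g\<^sub>0_def forms_def hcomp_add tensor_hcomp_homogeneous[OF e_forms(1) T_forms]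
      tensor_hcomp_homogeneous[OF e_forms(2) T_forms] tensor_hcomp_homogeneous[OF e_forms(3) forms_one]
      tensor_hcomp_homogeneous[OF forms_one tau_forms] del: One_nat_def)

lemma es_degree: "e \<in> set es \<Longrightarrow> \<exists>k. e \<in> forms k \<and> \<Phi> e \<in> forms k"
proof -
  note 2 = forms_mult[OF e_forms(1) e_forms(3)] forms_mult[OF e_forms(2) e_forms(3)] forms_mult[OF e_forms(1) e_forms(2)]
    forms_mult[OF g_forms(1) g_forms(3)] forms_mult[OF g_forms(2) g_forms(3)] forms_mult[OF g_forms(1) g_forms(2)]
  note 3 = forms_mult[OF e_forms(1) 2(2)] forms_mult[OF g_forms(1) 2(5)]
  assume "e \<in> set es"
  then show ?thesis
    using forms_one[where 'a = 'w] forms_one[where 'a = "('w, 'h) tensor"] e_forms g_forms 2 3 by (auto simp: es_def \<Phi>_e)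
qed

lemma \<Phi>_hcomp: "\<Phi> (hcomp k \<omega>) = hcomp k (\<Phi> \<omega>)"
proof (induction \<omega> rule: form_basis_induct)
  case (basis a e)
  then obtain j where j: "e \<in> forms j" "\<Phi> e \<in> forms j" using es_degree by blast
  have "hcomp k (iA a * e) = (if k = j then iA a * e else 0)"
    using hcomp_forms[OF forms_mult[OF iA_forms j(1)]] by simp
  moreover have "hcomp k (\<Delta>\<^sub>0 a * \<Phi> e) = (if k = j then \<Delta>\<^sub>0 a * \<Phi> e else 0)"
    using hcomp_forms[OF forms_mult[OF \<Delta>\<^sub>0_forms j(2)]] by simp
  ultimately show ?case
    using basis by (simp add: \<Phi>_iA_es \<Phi>_lin)
qed (simp_all add: \<Phi>_lin hcomp_add clinear_0[OF clinear_hcomp])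

lemma \<Phi>_forms: "\<omega> \<in> forms k \<Longrightarrow> \<Phi> \<omega> \<in> forms k"
  by (simp add: forms_def flip: \<Phi>_hcomp)

text \<open>By the graded Leibniz rule, compatibility with the differential passes to products, so
  it need only be verified on the generators of A and on the basis 1-forms.\<close>

lemma \<Phi>_dif_mult:
  assumes "\<omega> \<in> forms k" "\<Phi> (dif \<omega>) = dif (\<Phi> \<omega>)" "\<Phi> (dif \<eta>) = dif (\<Phi> \<eta>)"
  shows "\<Phi> (dif (\<omega> * \<eta>)) = dif (\<Phi> (\<omega> * \<eta>))"
  by (simp add: dif_mult_forms[OF assms(1)] dif_mult_forms[OF \<Phi>_forms[OF assms(1)]] \<Phi>_lin \<Phi>_mult assms)

lemma \<Phi>_gen:
  "\<Phi> (iA \<alpha>) = iA \<alpha> \<otimes> T 1" "\<Phi> (iA \<beta>) = iA \<beta> \<otimes> T (- 1)" "\<Phi> (iA \<gamma>) = iA \<gamma> \<otimes> T 1" "\<Phi> (iA \<delta>) = iA \<delta> \<otimes> T (- 1)"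
  by (simp_all add: \<Phi>_iA \<Delta>\<^sub>0_wt[OF wt_gens(1)] \<Delta>\<^sub>0_wt[OF wt_gens(2)] \<Delta>\<^sub>0_wt[OF wt_gens(3)] \<Delta>\<^sub>0_wt[OF wt_gens(4)])

text \<open>The \<open>e0\<close> coefficient in the differential of a generator, 1 for weight 1 and
  -q^(-2) for weight -1, equals the \<open>\<tau>\<close> coefficient in the differential of the
  matching power of t.\<close>

lemma \<Phi>_dif_gen: "\<Phi> (dif (iA (x f))) = dif (\<Phi> (iA (x f)))"
  by (cases f)
    (simp_all add: dif_gen \<Phi>_lin \<Phi>_mult \<Phi>_gen \<Phi>_e g\<^sub>p_def g\<^sub>m_def g\<^sub>0_def distrib_left tensor_products
      tensor_dif_homogeneous[OF iA_forms] T_mult dif_T_1 dif_T_minus_1 scaleC_one pure_tensor_simps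
      pure_tensor_diff pure_tensor_uminus scaleC_add_right)

lemma \<Phi>_dif_iA: "\<Phi> (dif (iA a)) = dif (\<Phi> (iA a))"
  using presentation
proof (induction a rule: presented_by_induct)
  case (word c ws)
  have "\<Phi> (dif (iA (prod_list (map x ws)))) = dif (\<Phi> (iA (prod_list (map x ws))))"
  proof (induction ws)
    case Nil
    show ?case by (simp add: iA_1 dif_1 \<Phi>_lin \<Phi>_e)
  next
    case (Cons f ws)
    show ?case
      using \<Phi>_dif_mult[OF iA_forms \<Phi>_dif_gen Cons] by (simp add: iA_mult)
  qed
  then show ?case
    by (simp add: clinear_scaleC[OF iA_linear] dif_scaleC \<Phi>_lin)
qed (simp add: clinear_add[OF iA_linear] dif_add \<Phi>_lin)

text \<open>The structure constants of \<open>dif ep\<close> and \<open>dif em\<close> are those of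
  d(t^2) and d(t^(-2)) up to the sign from moving d past a 1-form; for \<open>e0\<close> one uses
  that \<open>\<tau>\<close> is closed.\<close>

lemma \<Phi>_dif_e: "\<Phi> (dif ep) = dif (\<Phi> ep)" "\<Phi> (dif em) = dif (\<Phi> em)" "\<Phi> (dif e0) = dif (\<Phi> e0)"
  by (simp_all add: dif_e \<Phi>_lin \<Phi>_e g\<^sub>p_def g\<^sub>m_def g\<^sub>0_def distrib_left tensor_products dif_add
      tensor_dif_homogeneous[OF e_forms(1)] tensor_dif_homogeneous[OF e_forms(2)] tensor_dif_homogeneous[OF e_forms(3)]
      tensor_dif_homogeneous[OF forms_one] dif_1 dif_tau
      T_mult T_0 dif_T_2 dif_T_minus_2 scaleC_one complex_vector.scale_minus_left pure_tensor_simps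
      pure_tensor_diff pure_tensor_uminus scaleC_add_right scaleC_add_left complex_vector.scale_left_diff_distrib)

lemma \<Phi>_dif: "\<Phi> (dif \<omega>) = dif (\<Phi> \<omega>)"
proof (induction \<omega> rule: form_basis_induct)
  case (basis a e)
  note d = \<Phi>_dif_mult[OF e_forms(1)] \<Phi>_dif_mult[OF e_forms(2)]
  have "\<Phi> (dif e) = dif (\<Phi> e)"
    using basis by (auto simp: es_def dif_1 \<Phi>_e(1) \<Phi>_lin intro!: d \<Phi>_dif_e)
  then show ?case by (intro \<Phi>_dif_mult[OF iA_forms] \<Phi>_dif_iA)
qed (simp_all add: clinear_0[OF clinear_dif] dif_add \<Phi>_lin)

lemma \<Phi>_dga_hom: "dga_hom \<Phi>"
  by (simp add: dga_hom_def alg_hom_def \<Phi>_linear \<Phi>_e(1) \<Phi>_mult \<Phi>_hcomp \<Phi>_dif)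

lemma \<Phi>_extends: "extends_coaction iA iH \<Delta> \<Phi>"
  by (simp add: extends_coaction_def \<Phi>_dga_hom \<Phi>_iA \<Delta>\<^sub>0_def)


subsection \<open>Base and horizontal forms\<close>

lemmas iA_lin = clinear_0[OF iA_linear] clinear_add[OF iA_linear] clinear_diff[OF iA_linear] clinear_scaleC[OF iA_linear]

lemma ext_coaction: "ext_coaction iA iH \<Delta> = \<Phi>"
  by (rule ext_coaction_eq[OF iA_calculus \<Phi>_extends])

lemma base_forms_iff: "\<omega> \<in> base_forms iA iH \<Delta> \<longleftrightarrow> \<Phi> \<omega> = \<omega> \<otimes> 1"
  by (simp add: base_forms_def ext_coaction)

lemma dg_subalgebra_base_forms: "dg_subalgebra (base_forms iA iH \<Delta>)"
  using dg_subalgebra_coinvariant[OF \<Phi>_dga_hom] by (simp add: base_forms_def ext_coaction)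

text \<open>The factor \<open>e0\<close> is the only source of \<open>\<tau>\<close>: the extra
  summand arises by replacing it.\<close>

lemma \<Phi>_wt:
  assumes "wt n a"
  shows "\<Phi> (iA a) = iA a \<otimes> T n"
    "\<Phi> (iA a * ep) = iA a * ep \<otimes> T (n + 2)"
    "\<Phi> (iA a * em) = iA a * em \<otimes> T (n - 2)"
    "\<Phi> (iA a * e0) = iA a * e0 \<otimes> T n + iA a \<otimes> T n * \<tau>"
    "\<Phi> (iA a * (ep * e0)) = iA a * (ep * e0) \<otimes> T (n + 2) + iA a * ep \<otimes> T (n + 2) * \<tau>"
    "\<Phi> (iA a * (em * e0)) = iA a * (em * e0) \<otimes> T (n - 2) + iA a * em \<otimes> T (n - 2) * \<tau>"
    "\<Phi> (iA a * (ep * em)) = iA a * (ep * em) \<otimes> T n"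
    "\<Phi> (iA a * (ep * (em * e0))) = iA a * (ep * (em * e0)) \<otimes> T n + iA a * (ep * em) \<otimes> T n * \<tau>"
  by (simp_all add: \<Phi>_mult \<Phi>_e \<Phi>_iA \<Delta>\<^sub>0_wt[OF assms] g\<^sub>p_def g\<^sub>m_def g\<^sub>0_def tensor_products distrib_left
      T_mult T_mult' mult.assoc T_0 pure_tensor_simps)

lemma wt_coinvariant: "wt 0 b \<Longrightarrow> b \<in> coinvariants \<Delta>"
  by (simp add: coinvariants_def wtD(1) tpow_0)

lemma \<Phi>_coinvariant: "b \<in> coinvariants \<Delta> \<Longrightarrow> \<Phi> (iA b) = iA b \<otimes> 1"
  using T_0 by (simp add: coinvariants_def \<Phi>_iA \<Delta>\<^sub>0_def tensor_map_def tensor_lift_pure[OF cbilinear_iA_iH] T_def tpow_0)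

text \<open>Base forms are a differential graded subalgebra containing B.\<close>

lemma pullback_subset_base: "pullback_calculus iA (coinvariants \<Delta>) \<subseteq> base_forms iA iH \<Delta>"
  unfolding pullback_calculus_def
proof (rule complex_vector.span_minimal)
  note sub = dg_subalgebra_base_forms[unfolded dg_subalgebra_def]
  show "csubspace (base_forms iA iH \<Delta>)" using sub by blast
  have b: "iA b \<in> base_forms iA iH \<Delta>" if "b \<in> coinvariants \<Delta>" for b
    by (simp add: base_forms_iff \<Phi>_coinvariant that)
  have "prod_list (map (\<lambda>c. dif (iA c)) cs) \<in> base_forms iA iH \<Delta>" if "set cs \<subseteq> coinvariants \<Delta>" for cs
    using that by (induction cs) (use sub b in auto)
  then show "{iA b * prod_list (map (\<lambda>c. dif (iA c)) cs) |b cs. b \<in> coinvariants \<Delta> \<and> set cs \<subseteq> coinvariants \<Delta>}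
      \<subseteq> base_forms iA iH \<Delta>"
    using sub b by blast
qed

section \<open>Horizontal forms have no \<open>e0\<close> component\<close>

definition hor_span :: "'w set"
  where "hor_span = cspan {iA a * e |a e. e \<in> {1, ep, em, ep * em}}"

lemma hor_span_basis: "iA a \<in> hor_span" "iA a * ep \<in> hor_span" "iA a * em \<in> hor_span" "iA a * (ep * em) \<in> hor_span"
  unfolding hor_span_def
  by (rule complex_vector.span_base, force)+

text \<open>On a basis form the slice of \<Phi> deletes a trailing \<open>e0\<close> and gives zero
  if there is none. Multiplying by \<open>e0\<close> again restores the forms that contain it, and
  these cancel in the difference.\<close>

lemma hor_decomposition:
  assumes \<epsilon>: "clinear \<epsilon>" "\<And>n. \<epsilon> (T n) = 0" "\<And>n. \<epsilon> (T n * \<tau>) = (1 :: complex)"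
  shows "\<omega> - tensor_lift (\<lambda>v h. \<epsilon> h *\<^sub>C v) (\<Phi> \<omega>) * e0 \<in> hor_span"
proof -
  let ?N = "\<lambda>\<omega>. tensor_lift (\<lambda>v h. \<epsilon> h *\<^sub>C v) (\<Phi> \<omega>)"
  have bil: "cbilinear (\<lambda>(v :: 'w) h. \<epsilon> h *\<^sub>C v)"
    by (rule cbilinear_functional_right[OF \<epsilon>(1)])
  note lift = tensor_lift_pure[OF bil] clinear_add[OF clinear_tensor_lift[OF bil]]
  note lin = clinear_comp[OF \<Phi>_linear clinear_tensor_lift[OF bil]]
  show ?thesis
  proof (induction \<omega> rule: form_basis_induct)
    case zero
    show ?case by (simp add: clinear_0[OF lin] hor_span_def complex_vector.span_zero)
  next
    case (basis a e)
    show ?case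
    proof (induction a rule: weight_induct)
      case (wt n a)
      have "0 \<in> hor_span" by (simp add: hor_span_def complex_vector.span_zero)
      with basis show ?case
        unfolding es_def by (auto simp: \<Phi>_wt[OF wt] lift \<epsilon> scaleC_one mult.assoc hor_span_basis)
    next
      case (add a b)
      then have "iA a * e - ?N (iA a * e) * e0 + (iA b * e - ?N (iA b * e) * e0) \<in> hor_span"
        unfolding hor_span_def by (rule complex_vector.span_add)
      then show ?case
        by (simp add: clinear_add[OF iA_linear] distrib_right clinear_add[OF lin] algebra_simps)
    qed
  next
    case (add \<omega> \<eta>)
    then have "\<omega> - ?N \<omega> * e0 + (\<eta> - ?N \<eta> * e0) \<in> hor_span"
      unfolding hor_span_def by (rule complex_vector.span_add)
    then show ?case
      by (simp add: distrib_right clinear_add[OF lin] algebra_simps)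
  qed
qed

text \<open>The functional vanishes on degree zero of H, so the slice of a horizontal form is zero
  and \<open>hor_decomposition\<close> leaves the form itself.\<close>

lemma hor_subset_hor_span: "hor_forms iA iH \<Delta> \<subseteq> hor_span"
proof
  fix \<omega> assume "\<omega> \<in> hor_forms iA iH \<Delta>"
  then have hor: "\<Phi> \<omega> \<in> tensor_sub UNIV (range iH)" by (simp add: hor_forms_def ext_coaction)
  obtain \<epsilon> :: "'h \<Rightarrow> complex" where \<epsilon>: "clinear \<epsilon>" "\<And>n. \<epsilon> (T n) = 0" "\<And>n. \<epsilon> (T n * \<tau>) = 1"
    using extend_T_tau[of "\<lambda>_. 0" "\<lambda>_. 1"] by blast
  have bil: "cbilinear (\<lambda>(v :: 'w) h. \<epsilon> h *\<^sub>C v)"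
    by (rule cbilinear_functional_right[OF \<epsilon>(1)])
  note lin = clinear_tensor_lift[OF bil]
  have "\<epsilon> (iH h) = 0" for h
    by (induction h rule: laurent_induct)
      (simp_all add: clinear_0[OF iH_linear] clinear_add[OF iH_linear] clinear_scaleC[OF iH_linear]
        clinear_0[OF \<epsilon>(1)] clinear_add[OF \<epsilon>(1)] clinear_scaleC[OF \<epsilon>(1)] \<epsilon>(2)[unfolded T_def])
  with hor have "tensor_lift (\<lambda>v h. \<epsilon> h *\<^sub>C v) (\<Phi> \<omega>) = 0"
    unfolding tensor_sub_def
    by (induction rule: complex_vector.span_induct_alt)
      (auto simp: clinear_0[OF lin] clinear_add[OF lin] clinear_scaleC[OF lin] tensor_lift_pure[OF bil])
  then show "\<omega> \<in> hor_span"
    using hor_decomposition[OF \<epsilon>, of \<omega>] by simp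
qed

section \<open>Quadratic determinant identities and differentials of coinvariants\<close>

lemma normal_order:
  "\<alpha> * \<beta> = q powi (- 1) *\<^sub>C (\<beta> * \<alpha>)" "\<alpha> * \<gamma> = q powi (- 1) *\<^sub>C (\<gamma> * \<alpha>)"
  "\<alpha> * (\<beta> * u) = q powi (- 1) *\<^sub>C (\<beta> * (\<alpha> * u))" "\<alpha> * (\<gamma> * u) = q powi (- 1) *\<^sub>C (\<gamma> * (\<alpha> * u))"
  "\<delta> * (\<beta> * u) = q *\<^sub>C (\<beta> * (\<delta> * u))" "\<delta> * (\<gamma> * u) = q *\<^sub>C (\<gamma> * (\<delta> * u))" "\<gamma> * (\<beta> * u) = \<beta> * (\<gamma> * u)"
  "\<alpha> * (\<delta> * u) = u + q powi (- 1) *\<^sub>C (\<beta> * (\<gamma> * u))" "\<delta> * (\<alpha> * u) = u + q *\<^sub>C (\<beta> * (\<gamma> * u))"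
proof -
  show 1: "\<alpha> * \<beta> = q powi (- 1) *\<^sub>C (\<beta> * \<alpha>)" "\<alpha> * \<gamma> = q powi (- 1) *\<^sub>C (\<gamma> * \<alpha>)"
    using q_nonzero by (simp_all add: relations scaleC_scaleC scaleC_one power_int_minus)
  show "\<alpha> * (\<beta> * u) = q powi (- 1) *\<^sub>C (\<beta> * (\<alpha> * u))" "\<alpha> * (\<gamma> * u) = q powi (- 1) *\<^sub>C (\<gamma> * (\<alpha> * u))"
    "\<delta> * (\<beta> * u) = q *\<^sub>C (\<beta> * (\<delta> * u))" "\<delta> * (\<gamma> * u) = q *\<^sub>C (\<gamma> * (\<delta> * u))" "\<gamma> * (\<beta> * u) = \<beta> * (\<gamma> * u)"
    "\<alpha> * (\<delta> * u) = u + q powi (- 1) *\<^sub>C (\<beta> * (\<gamma> * u))" "\<delta> * (\<alpha> * u) = u + q *\<^sub>C (\<beta> * (\<gamma> * u))"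
    using 1[THEN arg_cong, of "\<lambda>v. v * u"] relations[THEN arg_cong, of "\<lambda>v. v * u"]
    by (simp_all add: mult.assoc mult_scaleC_left distrib_right)
qed

lemma q_cancel: "q * inverse q = 1" "inverse q * q = 1" "q * (inverse q * c) = c" "inverse q * (q * c) = c"
  "q powi (- 2) = inverse q * inverse q"
  using q_nonzero by (simp_all add: power_int_minus power2_eq_square)

lemmas normal_order_simps = normal_order relations(3-7) mult.assoc mult_scaleC_left mult_scaleC_right distrib_left distrib_right
  scaleC_scaleC scaleC_add_right

text \<open>The weight 2 coefficients pair to 1 with the \<open>ep\<close> coefficients and to 0
  with the \<open>em\<close> coefficients in \<open>dif_coinvariants\<close>. Normal ordering puts
  \<beta> and \<gamma> first and eliminates mixed products of \<alpha> and \<delta>.\<close>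

lemma det_squared_plus:
  "q powi (- 2) *\<^sub>C (\<gamma> * \<gamma> * (\<beta> * \<beta>)) - (q + q powi (- 1)) *\<^sub>C (\<alpha> * \<gamma> * (\<beta> * \<delta>)) + \<alpha> * \<alpha> * (\<delta> * \<delta>) = 1"
  "q powi (- 2) *\<^sub>C (\<gamma> * \<gamma> * (\<alpha> * \<alpha>)) - (q + q powi (- 1)) *\<^sub>C (\<alpha> * \<gamma> * (\<alpha> * \<gamma>)) + \<alpha> * \<alpha> * (\<gamma> * \<gamma>) = 0"
  by (simp_all add: normal_order_simps scaleC_add_left power2_eq_square power3_eq_cube q_cancel)

text \<open>The counterpart in weight -2, from the other determinant relation: 1 against the
  \<open>em\<close> coefficients and 0 against the \<open>ep\<close> coefficients.\<close>

lemma det_squared_minus: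
  "\<delta> * \<delta> * (\<alpha> * \<alpha>) - (q ^ 3 + q) *\<^sub>C (\<beta> * \<delta> * (\<alpha> * \<gamma>)) + q ^ 2 *\<^sub>C (\<beta> * \<beta> * (\<gamma> * \<gamma>)) = 1"
  "\<delta> * \<delta> * (\<beta> * \<beta>) - (q ^ 3 + q) *\<^sub>C (\<beta> * \<delta> * (\<beta> * \<delta>)) + q ^ 2 *\<^sub>C (\<beta> * \<beta> * (\<delta> * \<delta>)) = 0"
  by (simp_all add: normal_order_simps scaleC_add_left power2_eq_square power3_eq_cube q_cancel)

lemma dif_iA_mult: "dif (iA (a * b)) = dif (iA a) * iA b + iA a * dif (iA b)"
  using dif_mult_forms[OF iA_forms, of a "iA b"] by (simp add: iA_mult scaleC_one)

text \<open>The two contributions of \<open>e0\<close> cancel once it is moved past the second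
  generator.\<close>

lemma dif_coinvariants:
  "dif (iA (\<alpha> * \<beta>)) = iA (\<beta> * \<beta>) * ep + iA (\<alpha> * \<alpha>) * em"
  "dif (iA (\<alpha> * \<delta>)) = iA (\<beta> * \<delta>) * ep + iA (\<alpha> * \<gamma>) * em"
  "dif (iA (\<gamma> * \<delta>)) = iA (\<delta> * \<delta>) * ep + iA (\<gamma> * \<gamma>) * em"
  unfolding dif_iA_mult using q_nonzero
  by (simp_all add: dif_gen distrib_right mult.assoc mult_scaleC_left mult_scaleC_right e_gen
      iA_mult right_diff_distrib scaleC_scaleC power_int_minus scaleC_one)

text \<open>Inverts the system \<open>dif_coinvariants\<close> for \<open>ep\<close> by means of
  \<open>det_squared_plus\<close>. The prefactor \<open>a\<close> is included so that its weight can
  balance the weight 2 coefficients.\<close>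

lemma ep_eq: "iA a * ep =
    iA (a * (q powi (- 2) *\<^sub>C (\<gamma> * \<gamma>))) * dif (iA (\<alpha> * \<beta>))
    - iA (a * ((q + q powi (- 1)) *\<^sub>C (\<alpha> * \<gamma>))) * dif (iA (\<alpha> * \<delta>))
    + iA (a * (\<alpha> * \<alpha>)) * dif (iA (\<gamma> * \<delta>))" (is "_ = ?rhs")
proof -
  have "?rhs = iA (a * (q powi (- 2) *\<^sub>C (\<gamma> * \<gamma> * (\<beta> * \<beta>)) - (q + q powi (- 1)) *\<^sub>C (\<alpha> * \<gamma> * (\<beta> * \<delta>)) + \<alpha> * \<alpha> * (\<delta> * \<delta>))) * ep
    + iA (a * (q powi (- 2) *\<^sub>C (\<gamma> * \<gamma> * (\<alpha> * \<alpha>)) - (q + q powi (- 1)) *\<^sub>C (\<alpha> * \<gamma> * (\<alpha> * \<gamma>)) + \<alpha> * \<alpha> * (\<gamma> * \<gamma>))) * em"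
    by (simp only: dif_coinvariants distrib_left distrib_right left_diff_distrib right_diff_distrib iA_mult' mult.assoc
        iA_lin mult_scaleC_left mult_scaleC_right scaleC_add_right complex_vector.scale_right_diff_distrib) (simp add: algebra_simps)
  also have "\<dots> = iA a * ep"
    unfolding det_squared_plus by (simp add: iA_lin)
  finally show ?thesis ..
qed

lemma em_eq: "iA a * em =
    iA (a * (\<delta> * \<delta>)) * dif (iA (\<alpha> * \<beta>))
    - iA (a * ((q ^ 3 + q) *\<^sub>C (\<beta> * \<delta>))) * dif (iA (\<alpha> * \<delta>))
    + iA (a * (q ^ 2 *\<^sub>C (\<beta> * \<beta>))) * dif (iA (\<gamma> * \<delta>))" (is "_ = ?rhs")
proof -
  have "?rhs = iA (a * (\<delta> * \<delta> * (\<beta> * \<beta>) - (q ^ 3 + q) *\<^sub>C (\<beta> * \<delta> * (\<beta> * \<delta>)) + q ^ 2 *\<^sub>C (\<beta> * \<beta> * (\<delta> * \<delta>)))) * ep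
    + iA (a * (\<delta> * \<delta> * (\<alpha> * \<alpha>) - (q ^ 3 + q) *\<^sub>C (\<beta> * \<delta> * (\<alpha> * \<gamma>)) + q ^ 2 *\<^sub>C (\<beta> * \<beta> * (\<gamma> * \<gamma>)))) * em"
    by (simp only: dif_coinvariants distrib_left distrib_right left_diff_distrib right_diff_distrib iA_mult' mult.assoc
        iA_lin mult_scaleC_left mult_scaleC_right scaleC_add_right complex_vector.scale_right_diff_distrib) (simp add: algebra_simps)
  also have "\<dots> = iA a * em"
    unfolding det_squared_minus by (simp add: iA_lin)
  finally show ?thesis ..
qed

section \<open>Weight zero horizontal forms lie in the pullback calculus\<close>

lemma pullback_coinvariant_mult_dif:
  assumes "wt 0 a" "wt 0 b"
  shows "iA a * dif (iA b) \<in> pullback_calculus iA (coinvariants \<Delta>)"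
  by (intro pullback_calculus_mult_dif pullback_calculus_base wt_coinvariant assms)

lemma wt_coinvariant_gens: "wt 0 (\<alpha> * \<beta>)" "wt 0 (\<alpha> * \<delta>)" "wt 0 (\<gamma> * \<delta>)"
  using wt_mult[OF wt_gens(1,2)] wt_mult[OF wt_gens(1,4)] wt_mult[OF wt_gens(3,4)] by simp_all

lemma wt_quadratic:
  "wt 2 (q powi (- 2) *\<^sub>C (\<gamma> * \<gamma>))" "wt 2 (c *\<^sub>C (\<alpha> * \<gamma>))" "wt 2 (\<alpha> * \<alpha>)"
  "wt (- 2) (\<delta> * \<delta>)" "wt (- 2) (c *\<^sub>C (\<beta> * \<delta>))" "wt (- 2) (q ^ 2 *\<^sub>C (\<beta> * \<beta>))"
  using wt_mult[OF wt_gens(3,3)] wt_mult[OF wt_gens(1,3)] wt_mult[OF wt_gens(1,1)]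
    wt_mult[OF wt_gens(4,4)] wt_mult[OF wt_gens(2,4)] wt_mult[OF wt_gens(2,2)]
  by (auto intro!: wt_scaleC)

text \<open>Weight -2 meets the weight 2 coefficients in \<open>ep_eq\<close>, so every term is a
  coinvariant times the differential of a coinvariant.\<close>

lemma pullback_ep:
  assumes "wt (- 2) a"
  shows "iA a * ep \<in> pullback_calculus iA (coinvariants \<Delta>)"
proof -
  have *: "wt 0 (a * p)" if "wt 2 p" for p
    using wt_mult[OF assms that] by simp
  show ?thesis
    unfolding ep_eq
    by (intro * pullback_calculus_add pullback_calculus_diff pullback_coinvariant_mult_dif wt_coinvariant_gens wt_quadratic)
qed

lemma pullback_em:
  assumes "wt 2 a"
  shows "iA a * em \<in> pullback_calculus iA (coinvariants \<Delta>)"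
proof -
  have *: "wt 0 (a * r)" if "wt (- 2) r" for r
    using wt_mult[OF assms that] by simp
  show ?thesis
    unfolding em_eq
    by (intro * pullback_calculus_add pullback_calculus_diff pullback_coinvariant_mult_dif wt_coinvariant_gens wt_quadratic)
qed

text \<open>Expand \<open>em\<close> as a sum of r db with r of weight -2 and move r to the left of
  \<open>ep\<close>. Then \<open>pullback_ep\<close> applies to the coefficient a r, and db is
  appended on the right.\<close>

lemma pullback_ep_em:
  assumes "wt 0 a"
  shows "iA a * (ep * em) \<in> pullback_calculus iA (coinvariants \<Delta>)"
proof -
  have *: "iA a * ep * (iA r * dif (iA b)) \<in> pullback_calculus iA (coinvariants \<Delta>)" if "wt (- 2) r" "wt 0 b" for r b
  proof -
    have "iA a * ep * (iA r * dif (iA b)) = iA a * (ep * iA r) * dif (iA b)"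
      by (simp add: mult.assoc)
    also have "\<dots> = q powi (- 2) *\<^sub>C (iA (a * r) * ep * dif (iA b))"
      by (simp add: wtD(2)[OF that(1)] mult_scaleC_left mult_scaleC_right mult.assoc iA_mult)
    finally show ?thesis
      using wt_mult[OF assms that(1)]
      by (simp only:) (intro pullback_calculus_scaleC pullback_calculus_mult_dif pullback_ep wt_coinvariant that, simp)
  qed
  \<comment> \<open>The unit is inserted so that \<open>em_eq\<close> can be used with prefactor
    1.\<close>
  have "iA a * (ep * em) = iA a * ep * (iA 1 * em)"
    by (simp add: iA_1 mult.assoc)
  also have "\<dots> \<in> pullback_calculus iA (coinvariants \<Delta>)"
    unfolding em_eq mult_1_left distrib_left[of "iA a * ep"] right_diff_distrib[of "iA a * ep"]
    by (intro pullback_calculus_add pullback_calculus_diff * wt_coinvariant_gens wt_quadratic)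
  finally show ?thesis .
qed

lemma base_subset_hor: "base_forms iA iH \<Delta> \<subseteq> hor_forms iA iH \<Delta>"
proof
  fix \<omega> assume "\<omega> \<in> base_forms iA iH \<Delta>"
  then have "\<Phi> \<omega> = \<omega> \<otimes> iH 1"
    by (simp add: base_forms_iff alg_homD(2)[OF iH_hom])
  then show "\<omega> \<in> hor_forms iA iH \<Delta>"
    by (auto simp: hor_forms_def ext_coaction tensor_sub_def intro!: complex_vector.span_base)
qed

text \<open>A base form is its own component of weight zero, and the weight zero part of a horizontal form lies in the
  pullback calculus.\<close>

lemma base_subset_pullback: "base_forms iA iH \<Delta> \<subseteq> pullback_calculus iA (coinvariants \<Delta>)"
proof
  fix \<omega> assume base: "\<omega> \<in> base_forms iA iH \<Delta>"
  then have hor: "\<omega> \<in> hor_span" using base_subset_hor hor_subset_hor_span by blast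
  \<comment> \<open>Extracting the coefficient of t^0 turns the slice \<open>?P\<close> into the
    projection onto weight zero of horizontal forms.\<close>
  obtain \<chi> :: "'h \<Rightarrow> complex" where \<chi>: "clinear \<chi>" "\<And>n. \<chi> (T n) = (if n = 0 then 1 else 0)" "\<And>n. \<chi> (T n * \<tau>) = 0"
    using extend_T_tau[of "\<lambda>n. if n = 0 then 1 else 0" "\<lambda>_. 0"] by blast
  have bil: "cbilinear (\<lambda>(v :: 'w) h. \<chi> h *\<^sub>C v)"
    by (rule cbilinear_functional_right[OF \<chi>(1)])
  let ?P = "\<lambda>\<omega>. tensor_lift (\<lambda>v h. \<chi> h *\<^sub>C v) (\<Phi> \<omega>)"
  note lin = clinear_comp[OF \<Phi>_linear clinear_tensor_lift[OF bil]]
  have zero: "0 \<in> pullback_calculus iA (coinvariants \<Delta>)"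
    by (simp add: pullback_calculus_def complex_vector.span_zero)
  \<comment> \<open>A term with \<open>ep\<close> survives only for coefficients of weight -2, one
    with \<open>em\<close> only for weight 2, and the other two only for weight 0.\<close>
  have gen: "?P (iA a * e) \<in> pullback_calculus iA (coinvariants \<Delta>)" if "e \<in> {1, ep, em, ep * em}" for a e
  proof (induction a rule: weight_induct)
    case (wt n a)
    show ?case
      using that wt zero pullback_ep pullback_em pullback_ep_em
      by (auto simp: \<Phi>_wt[OF wt] tensor_lift_pure[OF bil] \<chi> scaleC_one eq_neg_iff_add_eq_0[symmetric]
          intro!: pullback_calculus_base wt_coinvariant)
  next
    case (add a b)
    then show ?case
      by (simp add: clinear_add[OF iA_linear] distrib_right clinear_add[OF lin] pullback_calculus_add)
  qed
  have "?P \<omega> \<in> pullback_calculus iA (coinvariants \<Delta>)"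
    using hor unfolding hor_span_def
  proof (induction rule: complex_vector.span_induct_alt)
    case base
    show ?case by (simp add: clinear_0[OF lin] zero)
  next
    case (step c \<omega> \<eta>)
    then show ?case
      using gen by (auto simp only: clinear_add[OF lin] clinear_scaleC[OF lin] intro!: pullback_calculus_add pullback_calculus_scaleC)
  qed
  moreover have "?P \<omega> = \<omega>"
    using base \<chi>(2)[of 0] by (simp add: base_forms_iff tensor_lift_pure[OF bil] T_0 scaleC_one)
  ultimately show "\<omega> \<in> pullback_calculus iA (coinvariants \<Delta>)" by simp
qed

lemma base_forms_eq_pullback: "base_forms iA iH \<Delta> = pullback_calculus iA (coinvariants \<Delta>)"
  using pullback_subset_base base_subset_pullback by blast

text \<open>Multiplication from the left suffices: \<open>ep_eq\<close> and \<open>em_eq\<close>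
  write the basis 1-forms through exact base forms, and \<open>ep * em\<close> is itself a base
  form.\<close>

lemma hor_subset: "hor_forms iA iH \<Delta> \<subseteq> cspan {iA a * \<omega> * iA a' |a \<omega> a'. \<omega> \<in> base_forms iA iH \<Delta>}"
  (is "_ \<subseteq> cspan ?S")
proof -
  have S: "iA a * \<omega> \<in> cspan ?S" if "\<omega> \<in> base_forms iA iH \<Delta>" for a \<omega>
  proof (rule complex_vector.span_base)
    have "iA a * \<omega> = iA a * \<omega> * iA 1" by (simp add: iA_1)
    then show "iA a * \<omega> \<in> ?S" using that by blast
  qed
  have b: "dif (iA b) \<in> base_forms iA iH \<Delta>" if "wt 0 b" for b
    using pullback_coinvariant_mult_dif[OF wt_1 that] by (simp add: iA_1 base_forms_eq_pullback)
  have 1: "1 \<in> base_forms iA iH \<Delta>" "ep * em \<in> base_forms iA iH \<Delta>"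
    using pullback_calculus_base[OF wt_coinvariant[OF wt_1], of iA] pullback_ep_em[OF wt_1]
    by (simp_all add: iA_1 base_forms_eq_pullback)
  have e: "iA a * ep \<in> cspan ?S" "iA a * em \<in> cspan ?S" for a
    unfolding ep_eq em_eq
    by (intro complex_vector.span_add complex_vector.span_diff S b wt_coinvariant_gens)+
  have "hor_span \<subseteq> cspan ?S"
    unfolding hor_span_def
    using S[OF 1(1)] S[OF 1(2)] e by (intro complex_vector.span_minimal) (auto simp: complex_vector.subspace_span)
  then show ?thesis using hor_subset_hor_span by blast
qed

text \<open>Homogeneous factors on either side of a base form change the H leg only by powers of t,
  which have degree zero.\<close>

lemma hor_superset: "cspan {iA a * \<omega> * iA a' |a \<omega> a'. \<omega> \<in> base_forms iA iH \<Delta>} \<subseteq> hor_forms iA iH \<Delta>"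
proof (rule complex_vector.span_minimal)
  let ?H = "tensor_sub UNIV (range iH) :: ('w, 'h) tensor set"
  have sub: "csubspace ?H"
    unfolding tensor_sub_def by (rule complex_vector.subspace_span)
  note sub' = sub[unfolded complex_vector.subspace_def]
  show "csubspace (hor_forms iA iH \<Delta>)"
    unfolding complex_vector.subspace_def
    using sub' by (auto simp: hor_forms_def ext_coaction \<Phi>_lin)
  have "\<Phi> (iA a * \<omega> * iA a') \<in> ?H" if "\<omega> \<in> base_forms iA iH \<Delta>" for a \<omega> a'
  proof (induction a rule: weight_induct)
    case (wt m a)
    note wta = this
    show ?case
    proof (induction a' rule: weight_induct)
      case (wt n a')
      have "\<Phi> (iA a * \<omega> * iA a') = iA a * \<omega> * iA a' \<otimes> T (m + n)"
        using that by (simp add: \<Phi>_mult \<Phi>_iA \<Delta>\<^sub>0_wt[OF wta] \<Delta>\<^sub>0_wt[OF wt] base_forms_iff tensor_products T_mult)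
      then show ?case
        by (auto simp: tensor_sub_def T_def intro!: complex_vector.span_base)
    qed (use sub' in \<open>auto simp: clinear_add[OF iA_linear] distrib_left \<Phi>_lin\<close>)
  qed (use sub' in \<open>auto simp: clinear_add[OF iA_linear] distrib_right \<Phi>_lin\<close>)
  then show "{iA a * \<omega> * iA a' |a \<omega> a'. \<omega> \<in> base_forms iA iH \<Delta>} \<subseteq> hor_forms iA iH \<Delta>"
    by (auto simp: hor_forms_def ext_coaction)
qed


subsection \<open>The connection\<close>

text \<open>The first summand carries the right coaction on 1-forms and the second the vertical
  projection; each is isolated by a slice below.\<close>

lemma \<Phi>_mult_dif:
  assumes "wt m a" "wt n a'" "dif (T n) = c *\<^sub>C (T n * \<tau>)"
  shows "\<Phi> (iA a * dif (iA a')) = iA a * dif (iA a') \<otimes> T (m + n) + c *\<^sub>C (iA (a * a') \<otimes> T (m + n) * \<tau>)"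
  by (simp add: \<Phi>_mult \<Phi>_dif \<Phi>_iA \<Delta>\<^sub>0_wt[OF assms(1)] \<Delta>\<^sub>0_wt[OF assms(2)] tensor_dif_homogeneous[OF iA_forms]
      assms(3) distrib_left tensor_products T_mult T_mult' mult_scaleC_right scaleC_one pure_tensor_simps iA_mult)

text \<open>\<open>id \<otimes> \<pi>\<close> applied to the extended coaction satisfies the specification, where \<open>\<pi>\<close> projects onto degree zero.\<close>

lemma right_coaction_1_spec:
  "clinear (right_coaction_1 iA \<Delta>)"
  "wt m a \<Longrightarrow> wt n a' \<Longrightarrow> right_coaction_1 iA \<Delta> (iA a * dif (iA a')) = iA a * dif (iA a') \<otimes> tpow (m + n)"
proof -
  let ?in = "\<lambda>a0 h. \<lambda>a0' h'. iA a0 * dif (iA a0') \<otimes> (h :: laurent) * h'"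
  let ?out = "\<lambda>a'. \<lambda>a0 h. tensor_lift (?in a0 h) (\<Delta> a')"
  let ?spec = "\<lambda>R. clinear R \<and> (\<forall>a a'. R (iA a * dif (iA a')) = tensor_lift (?out a') (\<Delta> a))"
  note add = clinear_add[OF iA_linear] clinear_add[OF clinear_dif] distrib_left distrib_right pure_tensor_simps
  note scale = clinear_scaleC[OF iA_linear] clinear_scaleC[OF clinear_dif] mult_scaleC_left mult_scaleC_right pure_tensor_simps
  have bin: "cbilinear (?in a0 h)" for a0 h
    unfolding cbilinear_def by (auto intro!: clinearI simp: add scale)
  have bout: "cbilinear (?out a')" for a'
    unfolding cbilinear_def by (intro conjI allI clinear_tensor_lift_fun clinearI) (simp_all add: add scale)
  \<comment> \<open>The Sweedler formula on homogeneous elements; additivity in both arguments,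
    shown next, reduces the general case to this one.\<close>
  have rhs: "tensor_lift (?out a') (\<Delta> a) = iA a * dif (iA a') \<otimes> tpow (m + n)" if "wt m a" "wt n a'" for m n a a'
    unfolding wtD(1)[OF that(1)] wtD(1)[OF that(2)]
    by (subst tensor_lift_pure[OF bout[of a', unfolded wtD(1)[OF that(2)]]], subst tensor_lift_pure[OF bin])
      (simp add: tpow_mult)
  have rhs_add: "tensor_lift (?out a') (\<Delta> (a + b)) = tensor_lift (?out a') (\<Delta> a) + tensor_lift (?out a') (\<Delta> b)" for a' a b
    by (simp only: clinear_add[OF coaction_linear] clinear_add[OF clinear_tensor_lift[OF bout]])
  have rhs_add': "tensor_lift (?out (a' + b')) (\<Delta> a) = tensor_lift (?out a') (\<Delta> a) + tensor_lift (?out b') (\<Delta> a)" for a' a b'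
    by (rule clinear_add, rule clinear_tensor_lift_fun, rule clinear_comp[OF coaction_linear clinear_tensor_lift[OF bin]])
  obtain \<pi> :: "'h \<Rightarrow> laurent" where \<pi>: "clinear \<pi>" "\<And>n. \<pi> (T n) = tpow n" "\<And>n. \<pi> (T n * \<tau>) = 0"
    using extend_T_tau[of tpow "\<lambda>_. 0"] by blast
  have bil: "cbilinear (\<lambda>(v :: 'w) h. v \<otimes> \<pi> h)"
    unfolding cbilinear_def by (auto intro!: clinearI simp: pure_tensor_simps clinear_add[OF \<pi>(1)] clinear_scaleC[OF \<pi>(1)])
  note lift = clinear_tensor_lift[OF bil]
  let ?R = "\<lambda>\<omega>. tensor_lift (\<lambda>v h. v \<otimes> \<pi> h) (\<Phi> \<omega>)"
  have lin: "clinear ?R" by (rule clinear_comp[OF \<Phi>_linear lift])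
  have zero: "(v :: 'w) \<otimes> (0 :: laurent) = 0" for v
    using pure_tensor_scaleC_right[of v 0 "0 :: laurent"] by simp
  have "?R (iA a * dif (iA a')) = tensor_lift (?out a') (\<Delta> a)" for a a'
  proof (induction a rule: weight_induct)
    case (wt m a)
    note wta = this
    show ?case
    proof (induction a' rule: weight_induct)
      case (wt n a')
      obtain c where c: "dif (T n) = c *\<^sub>C (T n * \<tau>)" using dif_T by blast
      show ?case
        by (simp add: \<Phi>_mult_dif[OF wta wt c] clinear_add[OF lift] clinear_scaleC[OF lift] tensor_lift_pure[OF bil] \<pi> zero rhs[OF wta wt])
    qed (simp only: rhs_add' clinear_add[OF iA_linear] clinear_add[OF clinear_dif] distrib_left clinear_add[OF lin])
  qed (simp only: rhs_add clinear_add[OF iA_linear] distrib_right clinear_add[OF lin])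
  then have "?spec ?R" using lin by blast
  then have spec: "?spec (right_coaction_1 iA \<Delta>)"
    unfolding right_coaction_1_def by (rule someI[of ?spec])
  then show "clinear (right_coaction_1 iA \<Delta>)" by blast
  show "right_coaction_1 iA \<Delta> (iA a * dif (iA a')) = iA a * dif (iA a') \<otimes> tpow (m + n)" if "wt m a" "wt n a'"
    using spec rhs[OF that] by simp
qed

text \<open>Here one applies \<open>\<pi> \<otimes> \<epsilon>\<close> to the extended coaction, where \<open>\<pi>\<close> projects onto degree zero and
  \<open>\<epsilon> (t\<^sup>n \<tau>) = \<tau>\<close>.\<close>

lemma ver_projection_spec:
  "clinear (ver_projection iA iH \<Delta>)"
  "wt m a \<Longrightarrow> wt n a' \<Longrightarrow> ver_projection iA iH \<Delta> (iA a * dif (iA a')) = a * a' \<otimes> T (- n) * dif (T n)"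
proof -
  let ?in = "\<lambda>a a0 h1 h2. a * a0 \<otimes> iH (antipode h1) * dif (iH h2)"
  let ?out = "\<lambda>a a0 h. tensor_lift (?in a a0) (comult h)"
  let ?spec = "\<lambda>R. clinear R \<and> (\<forall>a a'. R (iA a * dif (iA a')) = tensor_lift (?out a) (\<Delta> a'))"
  have bin: "cbilinear (?in a a0)" for a a0 :: 'a
    unfolding cbilinear_def by (auto intro!: clinearI simp: iH_map_linear bilinear_simps)
  have bout: "cbilinear (?out a)" for a :: 'a
    unfolding cbilinear_def
  proof (intro conjI allI)
    show "clinear (?out a a0)" for a0
      by (rule clinear_comp[OF clinear_comult clinear_tensor_lift[OF bin]])
    show "clinear (\<lambda>a0. ?out a a0 h)" for h
      by (rule clinear_tensor_lift_fun, rule clinearI) (simp_all add: bilinear_simps)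
  qed
  have rhs: "tensor_lift (?out a) (\<Delta> a') = a * a' \<otimes> T (- n) * dif (T n)" if "wt n a'" for n a a'
    unfolding wtD(1)[OF that]
    by (subst tensor_lift_pure[OF bout], subst comult_lift[OF bin]) (simp add: antipode_tpow T_def)
  have rhs_add': "tensor_lift (?out a) (\<Delta> (a' + b')) = tensor_lift (?out a) (\<Delta> a') + tensor_lift (?out a) (\<Delta> b')" for a' a b'
    by (simp only: clinear_add[OF coaction_linear] clinear_add[OF clinear_tensor_lift[OF bout]])
  have rhs_add: "tensor_lift (?out (a + b)) (\<Delta> a') = tensor_lift (?out a) (\<Delta> a') + tensor_lift (?out b) (\<Delta> a')" for a' a b
    by (rule clinear_add, rule clinear_tensor_lift_fun, rule clinear_tensor_lift_fun, rule clinearI) (simp_all add: bilinear_simps)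
  obtain \<epsilon> :: "'h \<Rightarrow> 'h" where \<epsilon>: "clinear \<epsilon>" "\<And>n. \<epsilon> (T n) = 0" "\<And>n. \<epsilon> (T n * \<tau>) = \<tau>"
    using extend_T_tau[of "\<lambda>_. 0" "\<lambda>_. \<tau>"] by blast
  have "range iA \<subseteq> forms 0" using iA_range by simp
  \<comment> \<open>The degree zero projection onto A arises by extending the identity on
    coefficients.\<close>
  then obtain \<pi> :: "'w \<Rightarrow> 'a" where \<pi>: "clinear \<pi>" "\<And>a. \<pi> (iA a) = a"
    using left_basis_extend[OF iA_linear _ left_basis_degree_0[OF iA_calculus], of "\<lambda>_ a. a"] complex_vector.linear_ident
    by (metis One_nat_def length_Cons less_Suc0 list.size(3) mult.right_neutral nth_Cons_0)
  have bil: "cbilinear (\<lambda>v h. \<pi> v \<otimes> \<epsilon> h)"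
    unfolding cbilinear_def by (auto intro!: clinearI simp: pure_tensor_simps clinear_add[OF \<pi>(1)] clinear_scaleC[OF \<pi>(1)]
        clinear_add[OF \<epsilon>(1)] clinear_scaleC[OF \<epsilon>(1)])
  note lift = clinear_tensor_lift[OF bil]
  let ?R = "\<lambda>\<omega>. tensor_lift (\<lambda>v h. \<pi> v \<otimes> \<epsilon> h) (\<Phi> \<omega>)"
  have lin: "clinear ?R" by (rule clinear_comp[OF \<Phi>_linear lift])
  have zero: "(v :: 'a) \<otimes> (0 :: 'h) = 0" for v
    using pure_tensor_scaleC_right[of v 0 "0 :: 'h"] by simp
  have "?R (iA a * dif (iA a')) = tensor_lift (?out a) (\<Delta> a')" for a a'
  proof (induction a rule: weight_induct)
    case (wt m a)
    note wta = this
    show ?case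
    proof (induction a' rule: weight_induct)
      case (wt n a')
      obtain c where c: "dif (T n) = c *\<^sub>C (T n * \<tau>)" using dif_T by blast
      \<comment> \<open>The first summand of \<open>\<Phi>_mult_dif\<close> is killed by
        \<open>\<epsilon>\<close>; the second gives c \<tau>, which is also t^(-n) d(t^n).\<close>
      show ?case
        by (simp add: \<Phi>_mult_dif[OF wta wt c] clinear_add[OF lift] clinear_scaleC[OF lift] tensor_lift_pure[OF bil] \<pi> \<epsilon> zero rhs[OF wt]
            c mult_scaleC_right T_mult' T_0 pure_tensor_simps)
    qed (simp only: rhs_add' clinear_add[OF iA_linear] clinear_add[OF clinear_dif] distrib_left clinear_add[OF lin])
  qed (subst rhs_add, simp only: clinear_add[OF iA_linear] distrib_right clinear_add[OF lin])
  then have "?spec ?R" using lin by blast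
  then have spec: "?spec (ver_projection iA iH \<Delta>)"
    unfolding ver_projection_def by (rule someI[of ?spec])
  then show "clinear (ver_projection iA iH \<Delta>)" by blast
  show "ver_projection iA iH \<Delta> (iA a * dif (iA a')) = a * a' \<otimes> T (- n) * dif (T n)" if "wt m a" "wt n a'"
    using spec rhs[OF that(2)] by simp
qed

text \<open>Colinearity holds because \<open>e0\<close> has weight zero and the adjoint coaction is
  trivial on invariant 1-forms; the vertical part of \<open>e0\<close> is computed from the quantum
  determinant.\<close>

lemma connection:
  "\<exists>s. clinear s \<and> s \<tau> = e0 \<and> connection_1_form iA iH \<Delta> s"
proof -
  obtain s :: "'h \<Rightarrow> 'w" where s: "clinear s" "\<And>n. s (T n * \<tau>) = e0"
    \<comment> \<open>Only the value at n = 0 matters; the constant choice is one convenient linear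
      extension.\<close>
    using extend_T_tau[of "\<lambda>_. 0" "\<lambda>_. e0"] by blast
  have s_tau: "s \<tau> = e0" using s(2)[of 0] by (simp add: T_0)
  have "right_coaction_1 iA \<Delta> e0 = e0 \<otimes> 1"
    unfolding SL2_e_zero_def
    by (simp add: clinear_diff[OF right_coaction_1_spec(1)] clinear_scaleC[OF right_coaction_1_spec(1)]
        right_coaction_1_spec(2)[OF wt_gens(4) wt_gens(1)] right_coaction_1_spec(2)[OF wt_gens(2) wt_gens(3)] tpow_0
        pure_tensor_diff pure_tensor_simps)
  moreover have "ver_projection iA iH \<Delta> e0 = 1 \<otimes> \<tau>"
  proof -
    \<comment> \<open>Both terms of \<open>e0\<close> differentiate an element of weight 1, so each
      contributes \<open>\<tau>\<close>, and \<delta>\<alpha> - q \<beta>\<gamma> = 1 remains in the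
      first leg.\<close>
    have "ver_projection iA iH \<Delta> e0 = \<delta> * \<alpha> \<otimes> \<tau> - q *\<^sub>C (\<beta> * \<gamma> \<otimes> \<tau>)"
      unfolding SL2_e_zero_def
      by (simp add: clinear_diff[OF ver_projection_spec(1)] clinear_scaleC[OF ver_projection_spec(1)] \<tau>_def
          ver_projection_spec(2)[OF wt_gens(4) wt_gens(1)] ver_projection_spec(2)[OF wt_gens(2) wt_gens(3)])
    then show ?thesis by (simp add: relations(7) pure_tensor_simps)
  qed
  moreover have "tensor_map s id (\<theta> \<otimes> 1) = s \<theta> \<otimes> (1 :: laurent)" for \<theta>
  proof -
    have "cbilinear (\<lambda>x (y :: laurent). s x \<otimes> id y)"
      unfolding cbilinear_def by (auto intro!: clinearI simp: pure_tensor_simps clinear_add[OF s(1)] clinear_scaleC[OF s(1)])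
    then show ?thesis by (simp only: tensor_map_def tensor_lift_pure id_apply)
  qed
  moreover have "c *\<^sub>C e0 \<in> forms 1" for c
    using e_forms(3) by (simp add: forms_def hcomp_scaleC)
  ultimately have "connection_1_form iA iH \<Delta> s"
    unfolding connection_1_form_def
    using s(1) adjoint_coaction_left_inv
    by (auto simp: left_inv_1_forms_eq complex_vector.span_singleton clinear_scaleC[OF s(1)] s_tau pure_tensor_simps
        clinear_scaleC[OF right_coaction_1_spec(1)] clinear_scaleC[OF ver_projection_spec(1)])
  then show ?thesis using s(1) s_tau by blast
qed

end

theorem theorem6p3:
  fixes q :: complex
    and x :: "sl2_gen \<Rightarrow> 'a::complex_algebra_1"
    and iA :: "'a \<Rightarrow> 'w::dga"
    and iH :: "laurent \<Rightarrow> 'h::dga"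
    and \<Delta> :: "'a \<Rightarrow> ('a, laurent) tensor"
  assumes "q \<noteq> 0" and "\<forall>n>0. q ^ n \<noteq> 1"
    and "presented_by x (SL2_relators q)"
    and "SL2_coaction x \<Delta>"
    and "SL2_calculus q x iA"
    and "U1_calculus q iH"
  shows "complete_calculus iA iH \<Delta> \<and>
    \<comment> \<open>(i)\<close>
    base_forms iA iH \<Delta> = pullback_calculus iA (coinvariants \<Delta>) \<and>
    dg_subalgebra (base_forms iA iH \<Delta>) \<and>
    \<comment> \<open>(ii)\<close>
    (ver_forms iH :: ('a, 'h) tensor set) =
      tensor_sub UNIV {c *\<^sub>C 1 + \<theta> |c \<theta>. \<theta> \<in> left_inv_1_forms iH} \<and>
    left_inv_1_forms iH = cspan {iH (tpow (- 1)) * dif (iH (tpow 1))} \<and>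
    hor_forms iA iH \<Delta> = cspan {iA a * \<omega> * iA a' |a \<omega> a'. \<omega> \<in> base_forms iA iH \<Delta>} \<and>
    \<comment> \<open>(iii)\<close>
    (\<exists>s. clinear s \<and> s (iH (tpow (- 1)) * dif (iH (tpow 1))) = SL2_e_zero q x iA \<and>
      connection_1_form iA iH \<Delta> s)"
proof -
  interpret quantum_hopf_fibration q iH x iA \<Delta>
    using assms by unfold_locales
  have \<tau>: "iH (tpow (- 1)) * dif (iH (tpow 1)) = \<tau>"
    by (simp add: \<tau>_def T_def)
  show ?thesis
    unfolding \<tau>
  proof (intro conjI)
    show "complete_calculus iA iH \<Delta>"
      using \<Phi>_extends by (auto simp: complete_calculus_def)
    show "hor_forms iA iH \<Delta> = cspan {iA a * \<omega> * iA a' |a \<omega> a'. \<omega> \<in> base_forms iA iH \<Delta>}"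
      using hor_subset hor_superset by (rule equalityI)
  qed (rule base_forms_eq_pullback dg_subalgebra_base_forms ver_forms_eq left_inv_1_forms_eq connection)+
qed

end
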